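(* Let $n\ge1$, $\alpha\in(0,n+2)$, $T>0$, and let $\Omega$ be a nonempty open subset of $\mathbb{R}^n$. Call $u$ an admissible solution if $u\ge0$, $u\in C^{2,1}(\mathbb{R}^n\times(0,T))\cap L^\lambda(\mathbb{R}^n\times(0,T))$, and $$0\le u_t-\Delta u\le \Big(\iint_{\mathbb{R}^n\times(0,T)}\Phi(x-y,t-s)^{\alpha/n}u(y,s)^\lambda\,dy\,ds\Big)\,u(x,t)^\sigma\quad\text{in }\Omega\times(0,T).$$ (i) If $0<\lambda<\frac{n+2-\alpha}{n}$ and $\sigma=g_\alpha(\lambda)$, then for every compact $K\subset\Omega$ and every admissible solution $u$, $\max_{x\in K}u(x,t)=O(t^{-n/2})$ as $t\to0^+$. (ii) If $\alpha\in(2,n+2)$, $\lambda>\frac{n+2}{\alpha-2}$ and $\sigma=g_\alpha(\lambda)$, then there is no continuous function $\varphi:(0,1)\to(0,\infty)$ such that for every compact $K\subset\Omega$ and every admissible solution $u$ one has $\max_{x\in K}u(x,t)=O(\varphi(t))$ as $t\to0^+$.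
   Context: $\Phi$ is the heat kernel: $\Phi(x,t)=(4\pi t)^{-n/2}e^{-|x|^2/(4t)}$ for $t>0$ and $\Phi(x,t)=0$ for $t\le0$. For $\alpha\in(0,n+2)$, $g_\alpha(\lambda)=\frac{n+2}{n}$ if $0<\lambda<\frac{n+2-\alpha}{n}$; $g_\alpha(\lambda)=\frac{2(n+2)-\alpha}{n}-\lambda$ if $\frac{n+2-\alpha}{n}\le\lambda<\frac{n+2}{n}$; $g_\alpha(\lambda)=\max\{0,1-\frac{\alpha-2}{n+2}\lambda\}$ if $\lambda\ge\frac{n+2}{n}$. *)

theory Defs
  imports "HOL-Analysis.Analysis" "HOL-Library.Landau_Symbols"
begin

definition heat_kernel :: "real^'n \<Rightarrow> real \<Rightarrow> real" where
  "heat_kernel x t = (if t > 0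
     then (4 * pi * t) powr (- real CARD('n) / 2) * exp (- (norm x)\<^sup>2 / (4 * t))
     else 0)"

definition g_exp :: "real \<Rightarrow> real \<Rightarrow> real \<Rightarrow> real" where
  "g_exp n \<alpha> lam =
     (if lam < (n + 2 - \<alpha>) / n then (n + 2) / n
      else if lam < (n + 2) / n then (2 * (n + 2) - \<alpha>) / n - lam
      else max 0 (1 - (\<alpha> - 2) / (n + 2) * lam))"

text \<open>Real power of a nonnegative base with the convention a^0 = 1 (also for a = 0).\<close>
definition rpow :: "real \<Rightarrow> real \<Rightarrow> real" where
  "rpow a b = (if b = 0 then 1 else a powr b)"

definition partial :: "'n \<Rightarrow> (real^'n \<Rightarrow> real) \<Rightarrow> real^'n \<Rightarrow> real" where
  "partial i f x = deriv (\<lambda>h. f (x + h *\<^sub>R axis i 1)) 0"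

definition laplacian :: "(real^'n \<Rightarrow> real) \<Rightarrow> real^'n \<Rightarrow> real" where
  "laplacian f x = (\<Sum>i\<in>UNIV. partial i (partial i f) x)"

definition dt :: "(real^'n \<Rightarrow> real \<Rightarrow> real) \<Rightarrow> real^'n \<Rightarrow> real \<Rightarrow> real" where
  "dt u x t = deriv (\<lambda>s. u x s) t"

definition C21 :: "real \<Rightarrow> (real^'n \<Rightarrow> real \<Rightarrow> real) \<Rightarrow> bool" where
  "C21 T u \<longleftrightarrow>
     (\<forall>x. \<forall>t\<in>{0<..<T}.
        (\<lambda>s. u x s) differentiable (at t) \<and>
        (\<lambda>y. u y t) differentiable (at x) \<and>
        (\<forall>i. (\<lambda>y. partial i (\<lambda>z. u z t) y) differentiable (at x))) \<and>
     continuous_on (UNIV \<times> {0<..<T}) (\<lambda>(x,t). u x t) \<and>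
     continuous_on (UNIV \<times> {0<..<T}) (\<lambda>(x,t). dt u x t) \<and>
     (\<forall>i. continuous_on (UNIV \<times> {0<..<T}) (\<lambda>(x,t). partial i (\<lambda>z. u z t) x)) \<and>
     (\<forall>i j. continuous_on (UNIV \<times> {0<..<T})
              (\<lambda>(x,t). partial j (partial i (\<lambda>z. u z t)) x))"

definition nonlocal :: "real \<Rightarrow> real \<Rightarrow> real \<Rightarrow> (real^'n \<Rightarrow> real \<Rightarrow> real) \<Rightarrow> real^'n \<Rightarrow> real \<Rightarrow> ennreal" where
  "nonlocal T \<alpha> lam u x t =
     (\<integral>\<^sup>+ z. indicator (UNIV \<times> {0<..<T}) z *
        ennreal ((heat_kernel (x - fst z) (t - snd z)) powr (\<alpha> / real CARD('n))
                 * (u (fst z) (snd z)) powr lam) \<partial>lborel)"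

definition admissible ::
  "real \<Rightarrow> real \<Rightarrow> real \<Rightarrow> real \<Rightarrow> (real^'n) set \<Rightarrow> (real^'n \<Rightarrow> real \<Rightarrow> real) \<Rightarrow> bool" where
  "admissible \<alpha> lam \<sigma> T \<Omega> u \<longleftrightarrow>
     (\<forall>x. \<forall>t\<in>{0<..<T}. u x t \<ge> 0) \<and>
     C21 T u \<and>
     set_integrable lborel (UNIV \<times> {0<..<T}) (\<lambda>z. \<bar>u (fst z) (snd z)\<bar> powr lam) \<and>
     (\<forall>x\<in>\<Omega>. \<forall>t\<in>{0<..<T}.
        0 \<le> dt u x t - laplacian (\<lambda>y. u y t) x \<and>
        ennreal (dt u x t - laplacian (\<lambda>y. u y t) x)
          \<le> nonlocal T \<alpha> lam u x t * ennreal (rpow (u x t) \<sigma>))"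

end

theory Submission
  imports Defs "HOL-Probability.Distributions"
begin

text \<open>
  Part (i). Testing a nonnegative supersolution \<open>u\<close> with a radial weight whose Laplacian is bounded below by a
  multiple of the weight shows that the local mass of \<open>u\<close> stays bounded and that \<open>f = u\<^sub>t - \<Delta>u\<close> is integrable
  down to \<open>t = 0\<close>; testing with a truncated heat kernel gives Duhamel's formula as an upper bound for \<open>u\<close>.
  Hence \<open>u\<close> is locally in \<open>L\<^sup>p\<close> for \<open>p < (n+2)/n\<close>, so by Young's inequality the nonlocal factor is bounded and
  \<open>f \<le> C u\<^bsup>1+2/n\<^esup>\<close>. This power is critical for the parabolic scaling that preserves mass: at a maximum point of
  \<open>u d\<^sup>n\<close>, where \<open>d\<close> is the parabolic distance to the boundary, \<open>u\<close> is at most \<open>2\<^sup>n\<close> times its value on a backward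
  cylinder of size \<open>d/2\<close>, and since the integral of \<open>f\<close> over short times is small, Duhamel's formula bounds the maximum.

  Part (ii). Here the exponent \<open>\<sigma>\<close> is \<open>0\<close>. If \<open>\<eta>\<close> is nondecreasing, \<open>\<eta>(t) \<Phi>(x,t-a)\<close> is a supersolution with
  source \<open>\<eta>'(t) \<Phi>(x,t-a)\<close>. A bump of this kind of width \<open>\<rho>\<^bsup>1/2\<^esup>\<close> and height \<open>\<rho>\<^sup>-\<^sup>b\<close> produces, for small \<open>\<rho>\<close>, a
  nonlocal term that dominates the source of the next bump, of parameter \<open>q\<rho>\<close>, with all bumps of a cascade focusing at
  the same time. A cascade starting with \<open>\<rho>\<close> and focusing at time \<open>\<rho>/2\<close> thus reaches any prescribed height, while its
  \<open>L\<^sup>\<lambda>\<close> norm is controlled by \<open>\<rho>\<close> alone; such an exponent \<open>b\<close> exists precisely because \<open>\<lambda> > (n+2)/(\<alpha>-2)\<close>.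
  Superposing cascades that focus at times tending to \<open>0\<close> gives a solution that beats a given \<open>\<phi>\<close>.
\<close>

section \<open>The heat kernel\<close>

text \<open>Nothing is known about u at time 0, and u need not be integrable over space, since lam
  may be smaller than 1. There is thus no initial value to represent u by, and part (i) works with
  one-sided estimates on time intervals that start at some s0 > 0, with constants independent of s0.
  An inequality in Duhamel's formula, with a bounded error due to the cutoff, is all that is needed.
  In part (ii) the exponents come from scaling. A bump of height \<rho>^(-b) occupies a parabolic
  cylinder of volume of order \<rho>^(1+n/2), on which the kernel power is of order
  \<rho>^(-\<alpha>/2). Its nonlocal term is therefore of order \<rho>^((n+2-\<alpha>)/2 - b lam),
  the source of the next bump, with q fixed, of order \<rho>^(-b-1), and the lam-th power of its
  norm of order \<rho>^((n+2)/2 - b lam). The nonlocal term wins for b > (n+4-\<alpha>)/(2(lam-1)),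
  the norm is small for b < (n+2)/(2 lam), and these are compatible exactly if lam (\<alpha>-2) >
  n+2. The largest bump of a cascade needs no nonlocal term to support it: it is switched on before
  time 0.\<close>

lemma heat_kernel_nonneg: "0 \<le> heat_kernel x t"
  by (simp add: heat_kernel_def)

lemma heat_kernel_le:
  fixes x :: "real^'n"
  assumes "t > 0"
  shows "heat_kernel x t \<le> t powr (- real CARD('n) / 2)"
proof -
  have "(4 * pi * t) powr (- real CARD('n) / 2) \<le> t powr (- real CARD('n) / 2)"
    using assms pi_ge_two by (intro powr_mono2') auto
  moreover have "exp (- (norm x)\<^sup>2 / (4 * t)) \<le> 1" using assms by simp
  ultimately have "(4 * pi * t) powr (- real CARD('n) / 2) * exp (- (norm x)\<^sup>2 / (4 * t))
      \<le> t powr (- real CARD('n) / 2) * 1" by (intro mult_mono) auto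
  then show ?thesis using assms by (simp add: heat_kernel_def)
qed

lemma heat_kernel_measurable [measurable (raw)]:
  assumes [measurable]: "f \<in> borel_measurable M" "g \<in> borel_measurable M"
  shows "(\<lambda>z. heat_kernel (f z :: real^'n) (g z)) \<in> borel_measurable M"
  unfolding heat_kernel_def by measurable

text \<open>A multiple of the normal density of variance 1 / (2 c), whose total mass is
  known.\<close>

lemma nn_integral_gaussian_real:
  assumes "c > 0"
  shows "(\<integral>\<^sup>+x. ennreal (exp (- c * x\<^sup>2)) \<partial>lborel) = ennreal (sqrt (pi / c))"
proof -
  define \<sigma> where "\<sigma> = sqrt (1 / (2 * c))"
  have s: "\<sigma> > 0" "\<sigma>\<^sup>2 = 1 / (2 * c)" using assms by (auto simp: \<sigma>_def)
  have eq: "exp (- c * x\<^sup>2) = sqrt (pi / c) * normal_density 0 \<sigma> x" for x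
  proof -
    have "2 * pi * \<sigma>\<^sup>2 = pi / c" "x\<^sup>2 / (2 * \<sigma>\<^sup>2) = c * x\<^sup>2" "sqrt (pi / c) > 0"
      unfolding s(2) using assms by (auto simp: field_simps)
    then show ?thesis using assms by (simp add: normal_density_def)
  qed
  have "(\<integral>\<^sup>+x. ennreal (exp (- c * x\<^sup>2)) \<partial>lborel)
     = (\<integral>\<^sup>+x. ennreal (sqrt (pi / c)) * ennreal (normal_density 0 \<sigma> x) \<partial>lborel)"
    unfolding eq by (simp add: ennreal_mult'')
  also have "\<dots> = ennreal (sqrt (pi / c)) * (\<integral>\<^sup>+x. ennreal (normal_density 0 \<sigma> x) \<partial>lborel)"
    by (rule nn_integral_cmult) simp
  also have "(\<integral>\<^sup>+x. ennreal (normal_density 0 \<sigma> x) \<partial>lborel) = 1"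
    using s integral_normal_density[of \<sigma> 0] integrable_normal_density[of \<sigma> 0]
    by (subst nn_integral_eq_integral) auto
  finally show ?thesis by simp
qed

text \<open>The map y -> x - y preserves Lebesgue measure and centres the integrand, which then
  factors over the coordinates.\<close>

lemma nn_integral_gaussian:
  fixes x :: "real^'n"
  assumes "c > 0"
  shows "(\<integral>\<^sup>+y. ennreal (exp (- c * (norm (x - y))\<^sup>2)) \<partial>lborel) = ennreal ((pi / c) powr (real CARD('n) / 2))"
proof -
  have "(\<integral>\<^sup>+y. ennreal (exp (- c * (norm (x - y))\<^sup>2)) \<partial>lborel)
      = (\<integral>\<^sup>+y. ennreal (exp (- c * (norm y)\<^sup>2)) \<partial>(distr lborel borel (\<lambda>y. x + (- 1) *\<^sub>R y)))"
    by (subst nn_integral_distr) auto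
  also have "distr lborel borel (\<lambda>y. x + (- 1) *\<^sub>R y) = (lborel :: (real^'n) measure)"
    using lborel_affine_euclidean[where c="\<lambda>_. - 1" and t = x]
    by (simp add: density_1 euclidean_representation scaleR_sum_right[symmetric] sum_negf)
  also have "(\<integral>\<^sup>+y. ennreal (exp (- c * (norm (y::real^'n))\<^sup>2)) \<partial>lborel)
      = (\<integral>\<^sup>+y. (\<Prod>b\<in>(Basis::(real^'n) set). ennreal (exp (- c * (y \<bullet> b)\<^sup>2))) \<partial>lborel)"
  proof (rule nn_integral_cong)
    fix y :: "real^'n"
    have "(norm y)\<^sup>2 = (\<Sum>b\<in>Basis. (y \<bullet> b)\<^sup>2)"
      by (subst power2_norm_eq_inner, subst euclidean_inner) (simp add: power2_eq_square)
    then have "exp (- c * (norm y)\<^sup>2) = (\<Prod>b\<in>Basis. exp (- c * (y \<bullet> b)\<^sup>2))"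
      by (simp add: exp_sum[symmetric] sum_distrib_left sum_negf)
    then show "ennreal (exp (- c * (norm y)\<^sup>2)) = (\<Prod>b\<in>Basis. ennreal (exp (- c * (y \<bullet> b)\<^sup>2)))"
      by (simp add: prod_ennreal)
  qed
  also have "\<dots> = (\<Prod>b\<in>(Basis::(real^'n) set). ennreal (sqrt (pi / c)))"
    using nn_integral_gaussian_real[OF assms] by (subst nn_integral_lborel_prod) auto
  also have "\<dots> = ennreal (sqrt (pi / c) ^ CARD('n))" using assms by (simp add: ennreal_power)
  also have "sqrt (pi / c) ^ CARD('n) = (pi / c) powr (real CARD('n) / 2)"
  proof -
    have "sqrt (pi / c) ^ CARD('n) = ((pi / c) powr (1/2)) powr real CARD('n)"
      using assms by (simp add: powr_half_sqrt powr_realpow)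
    then show ?thesis by (simp add: powr_powr)
  qed
  finally show ?thesis .
qed

text \<open>A power of the kernel is again a Gaussian, with parameter p / (4 \<tau>). The resulting
  exponent n/2 (1 - p) of \<tau> governs integrability in time: it exceeds -1, so that small times
  are harmless, exactly for p < (n+2)/n, and lies below -1, so that large times are harmless,
  exactly for p > (n+2)/n. Both regimes occur later.\<close>

lemma nn_integral_heat_kernel_powr:
  fixes x :: "real^'n"
  assumes "\<tau> > 0" "p > 0"
  shows "(\<integral>\<^sup>+y. ennreal (heat_kernel (x - y) \<tau> powr p) \<partial>lborel)
    = ennreal ((4 * pi * \<tau>) powr (real CARD('n) / 2 * (1 - p)) * p powr (- real CARD('n) / 2))"
proof -
  let ?n = "real CARD('n)"
  have "(\<integral>\<^sup>+y. ennreal (heat_kernel (x - y) \<tau> powr p) \<partial>lborel)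
    = (\<integral>\<^sup>+y. ennreal ((4 * pi * \<tau>) powr (- ?n / 2 * p)) * ennreal (exp (- (p / (4 * \<tau>)) * (norm (x - y))\<^sup>2)) \<partial>lborel)"
  proof (rule nn_integral_cong)
    fix y :: "real^'n"
    have "heat_kernel (x - y) \<tau> powr p
       = (4 * pi * \<tau>) powr (- ?n / 2 * p) * exp (- (p / (4 * \<tau>)) * (norm (x - y))\<^sup>2)"
      using assms by (simp add: heat_kernel_def powr_mult powr_powr exp_powr_real field_simps)
    then show "ennreal (heat_kernel (x - y) \<tau> powr p)
       = ennreal ((4 * pi * \<tau>) powr (- ?n / 2 * p)) * ennreal (exp (- (p / (4 * \<tau>)) * (norm (x - y))\<^sup>2))"
      by (simp add: ennreal_mult'')
  qed
  also have "\<dots> = ennreal ((4 * pi * \<tau>) powr (- ?n / 2 * p)) * ennreal ((pi / (p / (4 * \<tau>))) powr (?n / 2))"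
    using assms nn_integral_gaussian[of "p / (4 * \<tau>)" x] by (subst nn_integral_cmult) simp_all
  also have "\<dots> = ennreal ((4 * pi * \<tau>) powr (- ?n / 2 * p) * (pi / (p / (4 * \<tau>))) powr (?n / 2))"
    by (simp add: ennreal_mult'')
  also have "(4 * pi * \<tau>) powr (- ?n / 2 * p) * (pi / (p / (4 * \<tau>))) powr (?n / 2)
     = (4 * pi * \<tau>) powr (?n / 2 * (1 - p)) * p powr (- ?n / 2)"
  proof -
    have e: "pi / (p / (4 * \<tau>)) = (4 * pi * \<tau>) / p" by simp
    have "(4 * pi * \<tau>) powr (?n / 2 * (1 - p)) = (4 * pi * \<tau>) powr (- ?n / 2 * p) * (4 * pi * \<tau>) powr (?n / 2)"
      by (simp add: powr_add[symmetric] algebra_simps diff_divide_distrib)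
    then show ?thesis unfolding e using assms by (simp add: powr_divide powr_minus field_simps)
  qed
  finally show ?thesis .
qed

lemma nn_integral_heat_kernel:
  fixes x :: "real^'n"
  assumes "\<tau> > 0"
  shows "(\<integral>\<^sup>+y. ennreal (heat_kernel (x - y) \<tau>) \<partial>lborel) = 1"
  using nn_integral_heat_kernel_powr[OF assms, of 1 x] assms
  by (simp add: heat_kernel_nonneg abs_of_nonneg)

lemma heat_kernel_commute: "heat_kernel (x - y) \<tau> = heat_kernel (y - x) \<tau>"
  by (simp add: heat_kernel_def norm_minus_commute)

lemma nn_integral_powr_from_0:
  fixes a T :: real
  assumes "a > - 1" "T > 0"
  shows "(\<integral>\<^sup>+s. ennreal (s powr a) * indicator {0<..<T} s \<partial>lborel) \<le> ennreal (T powr (a + 1) / (a + 1))"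
proof -
  have h: "((\<lambda>x. x powr a) has_integral (T powr (a + 1) / (a + 1))) {0..T}"
    using has_integral_powr_from_0[of a T] assms by simp
  have "(\<integral>\<^sup>+s. ennreal (s powr a) * indicator {0<..<T} s \<partial>lborel)
     \<le> (\<integral>\<^sup>+s. ennreal (s powr a) * indicator {0..T} s \<partial>lborel)"
    by (intro nn_integral_mono) (auto split: split_indicator)
  also have "\<dots> = ennreal (T powr (a + 1) / (a + 1))"
    by (rule nn_integral_has_integral_lebesgue'[OF _ h]) auto
  finally show ?thesis .
qed

section \<open>Green's identity for radial test functions\<close>

text \<open>The integral of a translate does not depend on the translation, so its derivative vanishes.\<close>

lemma integral_line_derivative_eq_0:
  fixes G G' :: "real^'n \<Rightarrow> real"
  assumes der: "\<And>y. ((\<lambda>h. G (y + h *\<^sub>R axis i 1)) has_real_derivative G' y) (at 0)"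
    and cG: "continuous_on UNIV G" and cG': "continuous_on UNIV G'"
    and supp: "\<And>y. y \<notin> cball x \<rho> \<Longrightarrow> G y = 0"
    and Q: "cball x (\<rho> + 1) \<subseteq> cbox a b"
  shows "integral (cbox a b) G' = 0"
proof -
  define e :: "real^'n" where "e = axis i 1"
  have ne: "norm e = 1" by (simp add: e_def)
  have der': "((\<lambda>h. G (y + h *\<^sub>R e)) has_real_derivative G' (y + h *\<^sub>R e)) (at h)" for y h
  proof -
    have "((\<lambda>k. G (y + h *\<^sub>R e + k *\<^sub>R e)) has_real_derivative G' (y + h *\<^sub>R e)) (at 0)"
      using der[of "y + h *\<^sub>R e"] by (simp add: e_def)
    then have "((\<lambda>k. G (y + (k + h) *\<^sub>R e)) has_real_derivative G' (y + h *\<^sub>R e)) (at 0)"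
      by (simp add: algebra_simps)
    then show ?thesis using DERIV_shift[of "\<lambda>h. G (y + h *\<^sub>R e)" _ 0 h] by simp
  qed
  have int: "integrable lborel G"
  proof -
    have "integrable lborel (\<lambda>y. indicator (cball x \<rho>) y *\<^sub>R G y)"
      by (rule borel_integrable_compact) (auto intro: continuous_on_subset[OF cG])
    also have "(\<lambda>y. indicator (cball x \<rho>) y *\<^sub>R G y) = G"
      by (rule ext) (use supp in \<open>auto simp: indicator_def\<close>)
    finally show ?thesis .
  qed
  \<comment> \<open>The box contains the support with a margin of width 1, so for shifts shorter
    than 1 the translated function still vanishes off the box and its integral is the one over the
    whole space.\<close>
  have const: "integral (cbox a b) (\<lambda>y. G (y + h *\<^sub>R e)) = integral\<^sup>L lborel G" if "\<bar>h\<bar> < 1" for h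
  proof -
    have "has_bochner_integral lborel (\<lambda>y. G (h *\<^sub>R e + y)) (integral\<^sup>L lborel G)"
      using integrable_distr_eq[of "(+) (h *\<^sub>R e)" lborel borel G] integral_distr[of "(+) (h *\<^sub>R e)" lborel borel G]
        int borel_measurable_integrable[OF int] lborel_distr_plus[of "h *\<^sub>R e"]
      by (simp add: has_bochner_integral_iff)
    then have "((\<lambda>y. G (h *\<^sub>R e + y)) has_integral (integral\<^sup>L lborel G)) UNIV"
      using has_integral_integral_lborel[of "\<lambda>y. G (h *\<^sub>R e + y)"] by (auto simp: has_bochner_integral_iff)
    moreover have "(\<lambda>y. if y \<in> cbox a b then G (h *\<^sub>R e + y) else 0) = (\<lambda>y. G (h *\<^sub>R e + y))"
    proof
      fix y
      have "G (h *\<^sub>R e + y) = 0" if "y \<notin> cbox a b"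
      proof (rule supp, rule notI)
        assume "h *\<^sub>R e + y \<in> cball x \<rho>"
        then have "dist x (h *\<^sub>R e + y) \<le> \<rho>" by simp
        moreover have "dist (h *\<^sub>R e + y) y \<le> 1"
          using \<open>\<bar>h\<bar> < 1\<close> by (simp add: dist_norm ne)
        ultimately have "dist x y \<le> \<rho> + 1" using dist_triangle[of x y "h *\<^sub>R e + y"] by simp
        with that Q show False by auto
      qed
      then show "(if y \<in> cbox a b then G (h *\<^sub>R e + y) else 0) = G (h *\<^sub>R e + y)" by simp
    qed
    ultimately have "((\<lambda>y. G (h *\<^sub>R e + y)) has_integral (integral\<^sup>L lborel G)) (cbox a b)"
      using has_integral_restrict_UNIV[of "cbox a b" "\<lambda>y. G (h *\<^sub>R e + y)"] by simp
    then show ?thesis by (simp add: integral_unique add.commute)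
  qed
  have "((\<lambda>h. integral (cbox a b) (\<lambda>y. G (y + h *\<^sub>R e))) has_field_derivative
      integral (cbox a b) (\<lambda>y. G' (y + 0 *\<^sub>R e))) (at 0 within {-1<..<1})"
  proof (rule leibniz_rule_field_derivative)
    show "((\<lambda>h. G (t + h *\<^sub>R e)) has_real_derivative G' (t + h *\<^sub>R e)) (at h within {- 1<..<1})" for h t
      using der'[of t h] by (rule has_field_derivative_at_within)
    show "(\<lambda>y. G (y + h *\<^sub>R e)) integrable_on cbox a b" for h
      by (intro integrable_continuous continuous_on_compose2[OF cG] continuous_intros) auto
    show "continuous_on ({- 1<..<1} \<times> cbox a b) (\<lambda>(h, y). G' (y + h *\<^sub>R e))"
      unfolding split_beta by (intro continuous_on_compose2[OF cG'] continuous_intros) auto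
  qed auto
  then have "((\<lambda>h. integral (cbox a b) (\<lambda>y. G (y + h *\<^sub>R e))) has_field_derivative
      integral (cbox a b) G') (at 0)"
    by (simp add: at_within_open[of 0 "{-1<..<1::real}"])
  moreover have "((\<lambda>h. integral (cbox a b) (\<lambda>y. G (y + h *\<^sub>R e))) has_field_derivative 0) (at 0)"
  proof (rule has_field_derivative_transform_within_open[of "\<lambda>_. integral\<^sup>L lborel G" _ _ "{-1<..<1}"])
    fix h :: real assume "h \<in> {-1<..<1}"
    then show "integral\<^sup>L lborel G = integral (cbox a b) (\<lambda>y. G (y + h *\<^sub>R e))"
      using const[of h] by auto
  qed auto
  ultimately show ?thesis by (rule DERIV_unique)
qed

lemma C21_dt:
  assumes "C21 T u" "t \<in> {0<..<T}"
  shows "((\<lambda>s. u x s) has_real_derivative dt u x t) (at t)"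
  using assms unfolding C21_def dt_def
  by (simp add: DERIV_deriv_iff_real_differentiable)

text \<open>\<open>partial\<close> is a \<open>deriv\<close> along a line, which is meaningful only
  once differentiability is known; total differentiability supplies it.\<close>

lemma line_derivative:
  fixes g :: "real^'n \<Rightarrow> real"
  assumes "g differentiable (at y)"
  shows "((\<lambda>h. g (y + h *\<^sub>R axis i 1)) has_real_derivative partial i g y) (at 0)"
proof -
  have "(\<lambda>h. g (y + h *\<^sub>R axis i 1)) differentiable (at 0)"
    using differentiable_chain_at[of "\<lambda>h. y + h *\<^sub>R axis i 1" 0 g] assms
    by (simp add: o_def)
  then show ?thesis unfolding partial_def
    by (simp add: DERIV_deriv_iff_real_differentiable)
qed

lemma norm_axis_line:
  fixes x y :: "real^'n"
  shows "(norm (y + h *\<^sub>R axis i 1 - x))\<^sup>2 = (norm (y - x))\<^sup>2 + 2 * h * (y - x) $ i + h\<^sup>2"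
proof -
  have "y + h *\<^sub>R axis i 1 - x = (y - x) + h *\<^sub>R axis i 1" by simp
  moreover have "(norm (z + h *\<^sub>R axis i 1))\<^sup>2 = (norm z)\<^sup>2 + 2 * h * z $ i + h\<^sup>2" for z :: "real^'n"
    unfolding power2_norm_eq_inner
    by (simp add: inner_add_left inner_add_right inner_axis inner_axis' power2_eq_square algebra_simps)
  ultimately show ?thesis by (simp only:)
qed

lemma line_derivative_radial:
  fixes x y :: "real^'n"
  assumes "(P has_real_derivative P') (at ((norm (y - x))\<^sup>2))"
  shows "((\<lambda>h. P ((norm (y + h *\<^sub>R axis i 1 - x))\<^sup>2)) has_real_derivative 2 * (y - x) $ i * P') (at 0)"
proof -
  have "((\<lambda>h. (norm (y + h *\<^sub>R axis i 1 - x))\<^sup>2) has_real_derivative 2 * (y - x) $ i) (at 0)"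
    unfolding norm_axis_line by (auto intro!: derivative_eq_intros)
  from DERIV_chain'[OF this, of P P'] assms show ?thesis by (simp add: mult.commute)
qed

text \<open>For each direction i the component (d_i v) P - v (d_i P) is compactly supported, so its
  derivative in that direction integrates to 0. Summed over i, this moves the Laplacian onto the
  radial weight, whose Laplacian in terms of r = |y - x|^2 is 2n P' + 4r P''.\<close>

lemma green_radial:
  fixes v :: "real^'n \<Rightarrow> real" and P P1 P2 :: "real \<Rightarrow> real"
  assumes d0: "\<And>y. v differentiable (at y)"
    and d1: "\<And>i y. partial i v differentiable (at y)"
    and c2: "\<And>i. continuous_on UNIV (partial i (partial i v))"
    and P: "\<And>r. (P has_real_derivative P1 r) (at r)" "\<And>r. (P1 has_real_derivative P2 r) (at r)"
    and cP2: "continuous_on UNIV P2"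
    and supp: "\<And>r. r > \<rho>\<^sup>2 \<Longrightarrow> P r = 0 \<and> P1 r = 0" and \<rho>: "\<rho> \<ge> 0"
    and Q: "cball x (\<rho> + 1) \<subseteq> cbox a b"
  shows "integral (cbox a b) (\<lambda>y. laplacian v y * P ((norm (y - x))\<^sup>2))
     = integral (cbox a b) (\<lambda>y. v y * (2 * real CARD('n) * P1 ((norm (y - x))\<^sup>2)
          + 4 * (norm (y - x))\<^sup>2 * P2 ((norm (y - x))\<^sup>2)))"
proof -
  define R where "R = (\<lambda>y. (norm (y - x))\<^sup>2)"
  have cR: "continuous_on UNIV R" unfolding R_def by (intro continuous_intros)
  have cP: "continuous_on UNIV P" "continuous_on UNIV P1"
    by (rule DERIV_continuous_on, rule has_field_derivative_at_within, rule P)+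
  have cv: "continuous_on UNIV v" "continuous_on UNIV (partial i v)" for i
    by (rule differentiable_imp_continuous_on, simp add: differentiable_on_def d0 d1)+
  have cPR: "continuous_on UNIV (\<lambda>y. P (R y))" "continuous_on UNIV (\<lambda>y. P1 (R y))" "continuous_on UNIV (\<lambda>y. P2 (R y))"
    using continuous_on_compose2[OF cP(1) cR subset_UNIV] continuous_on_compose2[OF cP(2) cR subset_UNIV]
      continuous_on_compose2[OF cP2 cR subset_UNIV] by auto
  note cont = cv c2 cPR cR
  note crules = continuous_on_diff continuous_on_mult continuous_on_add continuous_on_power continuous_on_sum
    continuous_on_const continuous_on_component continuous_on_id
  define G where "G = (\<lambda>i y. partial i v y * P (R y) - v y * (2 * (y - x) $ i * P1 (R y)))"
  define G' where "G' = (\<lambda>i y. partial i (partial i v) y * P (R y)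
      - v y * (2 * P1 (R y) + (2 * (y - x) $ i)\<^sup>2 * P2 (R y)))"
  have z: "integral (cbox a b) (G' i) = 0" for i
  proof (rule integral_line_derivative_eq_0[of "G i" i, OF _ _ _ _ Q])
    fix y
    note lp = line_derivative_radial[where y=y and x=x and i=i, OF P(1)] line_derivative_radial[where y=y and x=x and i=i, OF P(2)]
    note lv = line_derivative[where y=y and i=i, OF d0] line_derivative[where y=y and i=i, OF d1]
    have lin: "((\<lambda>h. (y + h *\<^sub>R axis i 1 - x) $ i) has_real_derivative 1) (at 0)"
    proof -
      have "(y + h *\<^sub>R axis i 1 - x) $ i = h + (y $ i - x $ i)" for h by (simp add: axis_def)
      then show ?thesis using DERIV_add[OF DERIV_ident DERIV_const, of "y $ i - x $ i" 0] by (simp only:) simp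
    qed
    show "((\<lambda>h. G i (y + h *\<^sub>R axis i 1)) has_real_derivative G' i y) (at 0)"
      unfolding G_def G'_def R_def
      by (rule DERIV_cong[OF DERIV_diff[OF DERIV_mult[OF lv(2) lp(1)]
            DERIV_mult[OF lv(1) DERIV_mult[OF DERIV_cmult[OF lin, of 2] lp(2)]]]])
         (simp add: algebra_simps power2_eq_square)
  next
    show "continuous_on UNIV (G i)" unfolding G_def
      by (rule cont crules)+
    show "continuous_on UNIV (G' i)" unfolding G'_def
      by (rule cont crules)+
    fix y assume "y \<notin> cball x \<rho>"
    then have "norm (y - x) > \<rho>" by (simp add: dist_norm norm_minus_commute)
    then have "R y > \<rho>\<^sup>2" using \<rho> unfolding R_def by (intro power_strict_mono) auto
    then show "G i y = 0" using supp by (simp add: G_def)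
  qed
  have "0 = (\<Sum>i\<in>UNIV. integral (cbox a b) (G' i))" by (simp add: z)
  also have "\<dots> = integral (cbox a b) (\<lambda>y. \<Sum>i\<in>UNIV. G' i y)"
  proof (rule integral_sum[symmetric])
    show "G' i integrable_on cbox a b" for i unfolding G'_def
      by (rule integrable_continuous, rule continuous_on_subset[OF _ subset_UNIV]) (rule cont crules)+
  qed auto
  also have "\<dots> = integral (cbox a b) (\<lambda>y. laplacian v y * P (R y)
      - v y * (2 * real CARD('n) * P1 (R y) + 4 * R y * P2 (R y)))"
  proof -
    have "(\<Sum>i\<in>UNIV. G' i y) = laplacian v y * P (R y)
      - v y * (2 * real CARD('n) * P1 (R y) + 4 * R y * P2 (R y))" for y
    proof -
      have "(\<Sum>i\<in>UNIV. ((y - x) $ i)\<^sup>2) = R y"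
        unfolding R_def power2_norm_eq_inner by (simp add: inner_vec_def power2_eq_square)
      then have "(\<Sum>i\<in>UNIV. 2 * P1 (R y) + (2 * (y - x) $ i)\<^sup>2 * P2 (R y))
         = 2 * real CARD('n) * P1 (R y) + 4 * R y * P2 (R y)"
        by (simp only: sum.distrib sum_distrib_right[symmetric] power_mult_distrib sum_distrib_left[symmetric]) simp
      then show ?thesis
        unfolding G'_def laplacian_def by (simp only: sum_subtractf sum_distrib_right sum_distrib_left[symmetric])
    qed
    then show ?thesis by simp
  qed
  also have "\<dots> = integral (cbox a b) (\<lambda>y. laplacian v y * P (R y))
      - integral (cbox a b) (\<lambda>y. v y * (2 * real CARD('n) * P1 (R y) + 4 * R y * P2 (R y)))"
    unfolding laplacian_def
  proof (rule integral_diff)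
    show "(\<lambda>y. (\<Sum>i\<in>UNIV. partial i (partial i v) y) * P (R y)) integrable_on cbox a b"
      by (rule integrable_continuous, rule continuous_on_subset[OF _ subset_UNIV]) (rule cont crules)+
    show "(\<lambda>y. v y * (2 * real CARD('n) * P1 (R y) + 4 * R y * P2 (R y))) integrable_on cbox a b"
      by (rule integrable_continuous, rule continuous_on_subset[OF _ subset_UNIV]) (rule cont crules)+
  qed
  finally show ?thesis unfolding R_def by simp
qed

section \<open>Evolution of localised integrals\<close>

definition heat_op :: "(real^'n \<Rightarrow> real \<Rightarrow> real) \<Rightarrow> real^'n \<Rightarrow> real \<Rightarrow> real" where
  "heat_op u x t = dt u x t - laplacian (\<lambda>y. u y t) x"

text \<open>The left side is largest at \<tau> = b / a, where it equals (a / b) powr a times exp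
  (-a). The last factor is given away by discarding the -1 in ln z \<le> z - 1.\<close>

lemma powr_neg_times_exp_le:
  fixes a b \<tau> :: real
  assumes "a > 0" "b > 0" "\<tau> > 0"
  shows "\<tau> powr (- a) * exp (- b / \<tau>) \<le> (a / b) powr a"
proof -
  have "ln (b / (a * \<tau>)) \<le> b / (a * \<tau>) - 1"
    using assms by (intro ln_le_minus_one) auto
  then have "a * ln (b / (a * \<tau>)) \<le> a * (b / (a * \<tau>))" using assms by (intro mult_left_mono) auto
  then have *: "a * ln (b / (a * \<tau>)) \<le> b / \<tau>" using assms by simp
  have "ln (b / (a * \<tau>)) = - ln \<tau> - ln (a / b)"
    using assms by (simp add: ln_div ln_mult)
  then have "a * ln (b / (a * \<tau>)) = - a * ln \<tau> - a * ln (a / b)" by (simp add: right_diff_distrib)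
  with * have "- a * ln \<tau> - b / \<tau> \<le> a * ln (a / b)" by simp
  then have "exp (- a * ln \<tau> - b / \<tau>) \<le> exp (a * ln (a / b))" by simp
  moreover have "\<tau> powr (- a) * exp (- b / \<tau>) = exp (- a * ln \<tau> - b / \<tau>)"
    using assms by (simp add: powr_def exp_add[symmetric])
  ultimately show ?thesis using assms by (simp add: powr_def)
qed

text \<open>Uniform in time: the previous estimate with exponent n/2 and b = |x|^2 / 4. This is what
  makes contributions from distant points harmless, however short the elapsed time.\<close>

lemma heat_kernel_le_norm:
  fixes x :: "real^'n"
  assumes "x \<noteq> 0" "t > 0"
  shows "heat_kernel x t \<le> (2 * real CARD('n)) powr (real CARD('n) / 2) * norm x powr (- real CARD('n))"
proof -
  let ?n = "real CARD('n)"
  have "heat_kernel x t \<le> t powr (- (?n / 2)) * exp (- ((norm x)\<^sup>2 / 4) / t)"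
  proof -
    have "(4 * pi * t) powr (- ?n / 2) \<le> t powr (- ?n / 2)"
      using assms pi_ge_two by (intro powr_mono2') auto
    then show ?thesis using assms by (simp add: heat_kernel_def field_simps)
  qed
  also have "\<dots> \<le> (?n / 2 / ((norm x)\<^sup>2 / 4)) powr (?n / 2)"
    using assms by (intro powr_neg_times_exp_le) auto
  also have "?n / 2 / ((norm x)\<^sup>2 / 4) = 2 * ?n * norm x powr (- 2)"
    using assms by (simp add: powr_minus powr_numeral field_simps)
  also have "\<dots> powr (?n / 2) = (2 * ?n) powr (?n / 2) * norm x powr (- ?n)"
    using assms by (simp add: powr_mult powr_powr)
  finally show ?thesis .
qed

text \<open>An exponent of at least 2 makes the difference quotient at 0 vanish in the limit.
  Truncated powers are the building blocks of the weight, the spatial cutoff and the step in time,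
  for which a finite order of smoothness is enough.\<close>

lemma DERIV_pos_power:
  "((\<lambda>r::real. max 0 r ^ Suc (Suc k)) has_real_derivative real (Suc (Suc k)) * max 0 r ^ Suc k) (at r)"
proof -
  consider "r > 0" | "r < 0" | "r = 0" by linarith
  then show ?thesis
  proof cases
    case 1
    have "((\<lambda>r::real. r ^ Suc (Suc k)) has_real_derivative real (Suc (Suc k)) * r ^ Suc k) (at r)"
      using DERIV_pow[of "Suc (Suc k)" r] by simp
    then show ?thesis using 1
      by (subst max_absorb2) (auto intro: has_field_derivative_transform_within_open[of _ _ _ "{0<..}"])
  next
    case 2
    then show ?thesis
      by (subst max_absorb1) (auto intro: has_field_derivative_transform_within_open[of "\<lambda>_. 0" _ _ "{..<0}"])
  next
    case 3
    have "((\<lambda>h::real. max 0 h ^ Suc k) \<longlongrightarrow> max 0 0 ^ Suc k) (at 0)"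
      by (intro tendsto_intros)
    moreover have "eventually (\<lambda>h::real. max 0 h ^ Suc k = max 0 h ^ Suc (Suc k) / h) (at 0)"
      by (auto simp: eventually_at_filter max_def)
    ultimately have "((\<lambda>h::real. max 0 h ^ Suc (Suc k) / h) \<longlongrightarrow> max 0 0 ^ Suc k) (at 0)"
      by (rule Lim_transform_eventually)
    then show ?thesis using 3 by (simp add: DERIV_def)
  qed
qed

lemma nn_integral_cbox_continuous:
  fixes g :: "'a::euclidean_space \<Rightarrow> real"
  assumes "continuous_on (cbox a b) g" "\<And>y. y \<in> cbox a b \<Longrightarrow> 0 \<le> g y"
  shows "(\<integral>\<^sup>+y. ennreal (g y) * indicator (cbox a b) y \<partial>lborel) = ennreal (integral (cbox a b) g)"
  using assms by (intro nn_integral_has_integral_lebesgue' integrable_integral integrable_continuous) auto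

text \<open>Monotone convergence as the lower end of the time interval decreases to 0. The estimates
  are first proved away from time 0, where u is continuous, with a constant that does not depend on
  s.\<close>

lemma nn_integral_time_exhaust:
  fixes g :: "'a::euclidean_space \<times> real \<Rightarrow> ennreal"
  assumes g: "\<And>s. 0 < s \<Longrightarrow> s < T0 \<Longrightarrow> (\<lambda>z. g z * indicator (B \<times> {s..T0}) z) \<in> borel_measurable lborel"
    and le: "\<And>s. 0 < s \<Longrightarrow> s < T0 \<Longrightarrow> (\<integral>\<^sup>+z. g z * indicator (B \<times> {s..T0}) z \<partial>lborel) \<le> C"
    and T0: "T0 > 0"
  shows "(\<integral>\<^sup>+z. g z * indicator (B \<times> {0<..T0}) z \<partial>lborel) \<le> C"
proof -
  \<comment> \<open>The shift by 2 instead of 1 keeps the times strictly below T0 already for k =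
    0.\<close>
  define s where "s = (\<lambda>k::nat. T0 / (real k + 2))"
  have s: "0 < s k" "s k < T0" for k using T0 by (auto simp: s_def field_simps intro: add_pos_nonneg)
  have dec: "s k' \<le> s k" if "k \<le> k'" for k k' using that T0 by (auto simp: s_def intro!: divide_left_mono)
  have lim: "\<exists>k. s k < r" if r: "r > 0" for r
  proof -
    obtain k :: nat where "T0 / r < real k" using reals_Archimedean2 by blast
    then have "T0 < r * real k" using r by (simp add: field_simps)
    also have "\<dots> \<le> r * (real k + 2)" using r by simp
    finally show ?thesis by (intro exI[of _ k]) (simp add: s_def field_simps)
  qed
  have "(\<integral>\<^sup>+z. g z * indicator (B \<times> {0<..T0}) z \<partial>lborel)
     \<le> (\<integral>\<^sup>+z. (SUP k. g z * indicator (B \<times> {s k..T0}) z) \<partial>lborel)"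
  proof (rule nn_integral_mono)
    fix z :: "'a \<times> real"
    show "g z * indicator (B \<times> {0<..T0}) z \<le> (SUP k. g z * indicator (B \<times> {s k..T0}) z)"
    proof (cases "z \<in> B \<times> {0<..T0}")
      case True
      then obtain k where "s k < snd z" using lim[of "snd z"] by auto
      with True have "z \<in> B \<times> {s k..T0}" by auto
      then show ?thesis using True by (intro SUP_upper2[of k]) auto
    qed auto
  qed
  also have "\<dots> = (SUP k. \<integral>\<^sup>+z. g z * indicator (B \<times> {s k..T0}) z \<partial>lborel)"
  proof (rule nn_integral_monotone_convergence_SUP)
    show "incseq (\<lambda>k z. g z * indicator (B \<times> {s k..T0}) z)"
      by (intro incseq_SucI le_funI mult_left_mono) (auto split: split_indicator dest: order_trans[OF dec[OF le_SucI[OF order_refl]]])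
  qed (use g s in auto)
  also have "\<dots> \<le> C" using le s by (intro SUP_least) auto
  finally show ?thesis .
qed

lemma C21_continuous:
  assumes "C21 T u"
  shows "continuous_on (UNIV \<times> {0<..<T}) (\<lambda>(x,t). u x t)"
    and "continuous_on (UNIV \<times> {0<..<T}) (\<lambda>(x,t). dt u x t)"
    and "continuous_on (UNIV \<times> {0<..<T}) (\<lambda>(x,t). laplacian (\<lambda>y. u y t) x)"
    and "continuous_on (UNIV \<times> {0<..<T}) (\<lambda>(x,t). heat_op u x t)"
proof -
  show 1: "continuous_on (UNIV \<times> {0<..<T}) (\<lambda>(x,t). u x t)"
    "continuous_on (UNIV \<times> {0<..<T}) (\<lambda>(x,t). dt u x t)"
    using assms by (auto simp: C21_def)
  have c: "continuous_on (UNIV \<times> {0<..<T}) (\<lambda>(x,t). partial i (partial i (\<lambda>z. u z t)) x)" for i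
    using assms by (simp add: C21_def)
  show 2: "continuous_on (UNIV \<times> {0<..<T}) (\<lambda>(x,t). laplacian (\<lambda>y. u y t) x)"
    unfolding laplacian_def split_beta
    by (rule continuous_on_sum) (rule c[unfolded split_beta])
  show "continuous_on (UNIV \<times> {0<..<T}) (\<lambda>(x,t). heat_op u x t)"
    using continuous_on_diff[OF 1(2) 2] by (simp add: heat_op_def split_beta)
qed

text \<open>The indicator belongs to the claim because nothing is known about u outside the open
  time interval; only the restricted function is known to be measurable.\<close>

lemma C21_measurable:
  assumes "C21 T u" "S \<in> sets borel" "S \<subseteq> UNIV \<times> {0<..<T}"
  shows "(\<lambda>z. ennreal (heat_op u (fst z) (snd z)) * indicator S z) \<in> borel_measurable borel"
    and "(\<lambda>z. indicator S z *\<^sub>R u (fst z) (snd z)) \<in> borel_measurable borel"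
proof -
  have "(\<lambda>z. indicator S z *\<^sub>R heat_op u (fst z) (snd z)) \<in> borel_measurable borel"
    using continuous_on_subset[OF C21_continuous(4)[OF assms(1)] assms(3)] assms(2)
    by (intro borel_measurable_continuous_on_indicator) (auto simp: split_beta)
  then have "(\<lambda>z. ennreal (indicator S z *\<^sub>R heat_op u (fst z) (snd z))) \<in> borel_measurable borel" by measurable
  also have "(\<lambda>z. ennreal (indicator S z *\<^sub>R heat_op u (fst z) (snd z)))
    = (\<lambda>z. ennreal (heat_op u (fst z) (snd z)) * indicator S z)"
    by (auto split: split_indicator)
  finally show "(\<lambda>z. ennreal (heat_op u (fst z) (snd z)) * indicator S z) \<in> borel_measurable borel" .
  show "(\<lambda>z. indicator S z *\<^sub>R u (fst z) (snd z)) \<in> borel_measurable borel"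
    using continuous_on_subset[OF C21_continuous(1)[OF assms(1)] assms(3)] assms(2)
    by (intro borel_measurable_continuous_on_indicator) (auto simp: split_beta)
qed

lemma C21_measurable_slice:
  assumes "C21 T u" "s \<in> {0<..<T}"
  shows "(\<lambda>y. u y s) \<in> borel_measurable borel"
proof -
  have "continuous_on UNIV (\<lambda>y. u y s)"
    using continuous_on_compose2[OF C21_continuous(1)[OF assms(1)], of UNIV "\<lambda>y. (y, s)"] assms(2)
    by (simp add: continuous_on_Pair image_subset_iff)
  then show ?thesis by (rule borel_measurable_continuous_onI)
qed

lemma closed_times_Ioc_sets:
  fixes B :: "(real^'n) set"
  assumes "closed B"
  shows "B \<times> {0<..T0::real} \<in> sets borel"
  unfolding borel_prod[symmetric] by (rule pair_measureI) (auto intro: borel_closed assms)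

abbreviation local_mass :: "(real^'n \<Rightarrow> real \<Rightarrow> real) \<Rightarrow> (real^'n) set \<Rightarrow> real \<Rightarrow> ennreal" where
  "local_mass u B s \<equiv> \<integral>\<^sup>+y. ennreal (u y s) * indicator B y \<partial>lborel"

abbreviation source_mass :: "(real^'n \<Rightarrow> real \<Rightarrow> real) \<Rightarrow> ((real^'n) \<times> real) set \<Rightarrow> ennreal" where
  "source_mass u S \<equiv> \<integral>\<^sup>+z. ennreal (heat_op u (fst z) (snd z)) * indicator S z \<partial>lborel"

text \<open>The two terms of Duhamel's formula on the time interval from \<open>s0\<close> to \<open>t\<close>, localised to \<open>B\<close>.\<close>

abbreviation initial_term :: "(real^'n \<Rightarrow> real \<Rightarrow> real) \<Rightarrow> (real^'n) set \<Rightarrow> real^'n \<Rightarrow> real \<Rightarrow> real \<Rightarrow> ennreal" where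
  "initial_term u B x s0 t \<equiv> \<integral>\<^sup>+y. ennreal (u y s0 * heat_kernel (x - y) (t - s0)) * indicator B y \<partial>lborel"

abbreviation source_term :: "(real^'n \<Rightarrow> real \<Rightarrow> real) \<Rightarrow> (real^'n) set \<Rightarrow> real^'n \<Rightarrow> real \<Rightarrow> real \<Rightarrow> ennreal" where
  "source_term u B x s0 t \<equiv> \<integral>\<^sup>+z. ennreal (heat_op u (fst z) (snd z) * heat_kernel (x - fst z) (t - snd z))
     * indicator (B \<times> {s0..<t}) z \<partial>lborel"

text \<open>
  A test function is given through \<open>P r s\<close> with \<open>r\<close> the squared distance to \<open>x\<close>; \<open>P1\<close>, \<open>P2\<close> are its first two
  derivatives in \<open>r\<close> and \<open>Ps\<close> the one in \<open>s\<close>. Then \<open>L\<close> below is the backward heat operator applied to it.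
\<close>

locale radial_test =
  fixes u :: "real^'n \<Rightarrow> real \<Rightarrow> real" and P P1 P2 Ps :: "real \<Rightarrow> real \<Rightarrow> real"
    and T c d \<rho> :: real and x a b :: "real^'n"
  assumes u: "C21 T u"
    and I: "{c<..<d} \<subseteq> {0<..<T}"
    and P: "\<And>r s. s \<in> {c<..<d} \<Longrightarrow> ((\<lambda>r. P r s) has_real_derivative P1 r s) (at r)"
       "\<And>r s. s \<in> {c<..<d} \<Longrightarrow> ((\<lambda>r. P1 r s) has_real_derivative P2 r s) (at r)"
       "\<And>r s. s \<in> {c<..<d} \<Longrightarrow> ((\<lambda>s. P r s) has_real_derivative Ps r s) (at s)"
    and cP: "continuous_on (UNIV \<times> {c<..<d}) (\<lambda>(r,s). P r s)"
       "continuous_on (UNIV \<times> {c<..<d}) (\<lambda>(r,s). P1 r s)"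
       "continuous_on (UNIV \<times> {c<..<d}) (\<lambda>(r,s). P2 r s)"
       "continuous_on (UNIV \<times> {c<..<d}) (\<lambda>(r,s). Ps r s)"
    and supp: "\<And>r s. s \<in> {c<..<d} \<Longrightarrow> r > \<rho>\<^sup>2 \<Longrightarrow> P r s = 0 \<and> P1 r s = 0" and rho_nonneg: "\<rho> \<ge> 0"
    and Q: "cball x (\<rho> + 1) \<subseteq> cbox a b"
begin

definition R :: "real^'n \<Rightarrow> real" where "R y = (norm (y - x))\<^sup>2"

definition L :: "real^'n \<Rightarrow> real \<Rightarrow> real" where
  "L y s = Ps (R y) s + 2 * real CARD('n) * P1 (R y) s + 4 * R y * P2 (R y) s"

text \<open>Product rule in time, then u_s written as \<open>heat_op\<close> plus the Laplacian of
  u, then Green's identity to move the Laplacian onto the test function; what is left on u is the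
  backward operator \<open>L\<close>. The continuity claims prepare the integration in time.\<close>

lemma evolution:
  shows "s \<in> {c<..<d} \<Longrightarrow> ((\<lambda>s. integral (cbox a b) (\<lambda>y. u y s * P (R y) s)) has_real_derivative
     integral (cbox a b) (\<lambda>y. heat_op u y s * P (R y) s) + integral (cbox a b) (\<lambda>y. u y s * L y s)) (at s)"
    and "continuous_on {c<..<d} (\<lambda>s. integral (cbox a b) (\<lambda>y. heat_op u y s * P (R y) s))"
    and "continuous_on {c<..<d} (\<lambda>s. integral (cbox a b) (\<lambda>y. u y s * L y s))"
    and "s \<in> {c<..<d} \<Longrightarrow> continuous_on UNIV (\<lambda>y. heat_op u y s * P (R y) s)"
    and "s \<in> {c<..<d} \<Longrightarrow> continuous_on UNIV (\<lambda>y. u y s * L y s)"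
    and "s \<in> {c<..<d} \<Longrightarrow> continuous_on UNIV (\<lambda>y. u y s * P (R y) s)"
    and "continuous_on ({c<..<d} \<times> UNIV) (\<lambda>z. heat_op u (snd z) (fst z) * P (R (snd z)) (fst z))"
proof -
  let ?I = "{c<..<d}"
  have cR: "continuous_on S (\<lambda>z. R (snd z))" for S :: "(real \<times> (real^'n)) set"
    unfolding R_def by (intro continuous_intros)
  have sI: "(\<lambda>z. (snd z, fst z)) ` (?I \<times> (UNIV :: (real^'n) set)) \<subseteq> UNIV \<times> {0<..<T}" using I by auto
  have sw: "continuous_on (?I \<times> (UNIV :: (real^'n) set)) (\<lambda>z. (snd z, fst z))" by (intro continuous_intros)
  have cu: "continuous_on (?I \<times> UNIV) (\<lambda>z. u (snd z) (fst z))"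
     "continuous_on (?I \<times> UNIV) (\<lambda>z. dt u (snd z) (fst z))"
     "continuous_on (?I \<times> UNIV) (\<lambda>z. laplacian (\<lambda>y. u y (fst z)) (snd z))"
     "continuous_on (?I \<times> UNIV) (\<lambda>z. heat_op u (snd z) (fst z))"
    using continuous_on_compose2[OF C21_continuous(1)[OF u] sw] continuous_on_compose2[OF C21_continuous(2)[OF u] sw]
      continuous_on_compose2[OF C21_continuous(3)[OF u] sw] continuous_on_compose2[OF C21_continuous(4)[OF u] sw] sI
    by simp_all
  have rI: "(\<lambda>z. (R (snd z), fst z)) ` (?I \<times> UNIV) \<subseteq> UNIV \<times> ?I" by auto
  have rs: "continuous_on (?I \<times> UNIV) (\<lambda>z. (R (snd z), fst z))" by (intro continuous_intros cR)
  have cp: "continuous_on (?I \<times> UNIV) (\<lambda>z. P (R (snd z)) (fst z))"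
     "continuous_on (?I \<times> UNIV) (\<lambda>z. P1 (R (snd z)) (fst z))"
     "continuous_on (?I \<times> UNIV) (\<lambda>z. P2 (R (snd z)) (fst z))"
     "continuous_on (?I \<times> UNIV) (\<lambda>z. Ps (R (snd z)) (fst z))"
    using continuous_on_compose2[OF cP(1) rs] continuous_on_compose2[OF cP(2) rs]
      continuous_on_compose2[OF cP(3) rs] continuous_on_compose2[OF cP(4) rs] rI
    by simp_all
  note rules = continuous_on_add continuous_on_mult continuous_on_const cu cp cR
  have c1: "continuous_on (?I \<times> UNIV) (\<lambda>z. heat_op u (snd z) (fst z) * P (R (snd z)) (fst z))"
    by (rule rules)+
  have c2: "continuous_on (?I \<times> UNIV) (\<lambda>z. u (snd z) (fst z) * L (snd z) (fst z))"
    unfolding L_def by (rule rules)+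
  have c3: "continuous_on (?I \<times> UNIV) (\<lambda>z. u (snd z) (fst z) * P (R (snd z)) (fst z))"
    by (rule rules)+
  have c4: "continuous_on (?I \<times> UNIV) (\<lambda>z. dt u (snd z) (fst z) * P (R (snd z)) (fst z) + u (snd z) (fst z) * Ps (R (snd z)) (fst z))"
    by (rule rules)+
  have c5: "continuous_on (?I \<times> UNIV) (\<lambda>z. laplacian (\<lambda>y. u y (fst z)) (snd z) * P (R (snd z)) (fst z))"
    by (rule rules)+
  have c6: "continuous_on (?I \<times> UNIV) (\<lambda>z. u (snd z) (fst z) * (2 * real CARD('n) * P1 (R (snd z)) (fst z) + 4 * R (snd z) * P2 (R (snd z)) (fst z)))"
    by (rule rules)+
  have c7: "continuous_on (?I \<times> UNIV) (\<lambda>z. u (snd z) (fst z) * Ps (R (snd z)) (fst z))"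
    by (rule rules)+
  have slice: "continuous_on UNIV (\<lambda>y. F (s, y))" if "continuous_on (?I \<times> UNIV) F" "s \<in> ?I" for F :: "real \<times> (real^'n) \<Rightarrow> real" and s
    by (rule continuous_on_compose2[OF that(1)]) (use that(2) in \<open>auto intro!: continuous_intros\<close>)
  have par: "continuous_on ?I (\<lambda>s. integral (cbox a b) (\<lambda>y. F (s, y)))" if "continuous_on (?I \<times> UNIV) F" for F :: "real \<times> (real^'n) \<Rightarrow> real"
    by (rule integral_continuous_on_param) (use that in \<open>auto intro: continuous_on_subset\<close>)
  show "continuous_on {c<..<d} (\<lambda>s. integral (cbox a b) (\<lambda>y. heat_op u y s * P (R y) s))"
    using par[OF c1] by simp
  show "continuous_on {c<..<d} (\<lambda>s. integral (cbox a b) (\<lambda>y. u y s * L y s))"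
    using par[OF c2] by simp
  show "continuous_on ({c<..<d} \<times> UNIV) (\<lambda>z. heat_op u (snd z) (fst z) * P (R (snd z)) (fst z))"
    by (rule c1)
  show "continuous_on UNIV (\<lambda>y. heat_op u y s * P (R y) s)" if "s \<in> ?I"
    using slice[OF c1 that] by simp
  show "continuous_on UNIV (\<lambda>y. u y s * L y s)" if "s \<in> ?I"
    using slice[OF c2 that] by simp
  have s3: "continuous_on UNIV (\<lambda>y. u y s * P (R y) s)" if "s \<in> ?I" for s
    using slice[OF c3 that] by simp
  then show "s \<in> ?I \<Longrightarrow> continuous_on UNIV (\<lambda>y. u y s * P (R y) s)" .
  have ic: "F integrable_on cbox a b" if "continuous_on UNIV F" for F :: "real^'n \<Rightarrow> real"
    by (rule integrable_continuous[OF continuous_on_subset[OF that]]) simp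
  assume s: "s \<in> ?I"
  have "((\<lambda>s. integral (cbox a b) (\<lambda>y. u y s * P (R y) s)) has_field_derivative
      integral (cbox a b) (\<lambda>y. dt u y s * P (R y) s + u y s * Ps (R y) s)) (at s within ?I)"
  proof (rule leibniz_rule_field_derivative)
    fix s y assume "s \<in> ?I"
    then have "((\<lambda>s. u y s * P (R y) s) has_real_derivative dt u y s * P (R y) s + u y s * Ps (R y) s) (at s)"
      using I by (intro DERIV_cong[OF DERIV_mult[OF C21_dt[OF u] P(3)]]) auto
    then show "((\<lambda>s. u y s * P (R y) s) has_real_derivative dt u y s * P (R y) s + u y s * Ps (R y) s) (at s within ?I)"
      by (rule has_field_derivative_at_within)
  next
    show "(\<lambda>y. u y s * P (R y) s) integrable_on cbox a b" if "s \<in> ?I" for s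
      by (rule ic[OF s3[OF that]])
    show "continuous_on (?I \<times> cbox a b) (\<lambda>(s, y). dt u y s * P (R y) s + u y s * Ps (R y) s)"
      unfolding split_beta by (rule continuous_on_subset[OF c4]) auto
  qed (use s in auto)
  then have D: "((\<lambda>s. integral (cbox a b) (\<lambda>y. u y s * P (R y) s)) has_field_derivative
      integral (cbox a b) (\<lambda>y. dt u y s * P (R y) s + u y s * Ps (R y) s)) (at s)"
    using s by (simp add: at_within_open[of s ?I])
  have green: "integral (cbox a b) (\<lambda>y. laplacian (\<lambda>y. u y s) y * P (R y) s)
     = integral (cbox a b) (\<lambda>y. u y s * (2 * real CARD('n) * P1 (R y) s + 4 * R y * P2 (R y) s))"
    unfolding R_def
  proof (rule green_radial[of "\<lambda>y. u y s" "\<lambda>r. P r s" "\<lambda>r. P1 r s" "\<lambda>r. P2 r s" \<rho> x a b])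
    have sT: "s \<in> {0<..<T}" using s I by auto
    show "(\<lambda>y. u y s) differentiable at y" "partial i (\<lambda>y. u y s) differentiable at y" for y i
      using u sT by (auto simp: C21_def)
    have "continuous_on (UNIV \<times> {0<..<T}) (\<lambda>(x,t). partial i (partial i (\<lambda>z. u z t)) x)" for i
      using u by (simp add: C21_def)
    note pp = continuous_on_compose2[OF this, of UNIV "\<lambda>y. (y, s)"]
    show "continuous_on UNIV (partial i (partial i (\<lambda>y. u y s)))" for i
      using pp[of i] sT by (simp add: continuous_on_Pair image_subset_iff)
    show "continuous_on UNIV (\<lambda>r. P2 r s)"
      using continuous_on_compose2[OF cP(3), of UNIV "\<lambda>r. (r, s)"] s
      by (simp add: continuous_on_Pair image_subset_iff)
  qed (use P s supp rho_nonneg Q in auto)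
  have "integral (cbox a b) (\<lambda>y. dt u y s * P (R y) s + u y s * Ps (R y) s)
     = integral (cbox a b) (\<lambda>y. (heat_op u y s * P (R y) s + laplacian (\<lambda>y. u y s) y * P (R y) s) + u y s * Ps (R y) s)"
    by (simp add: heat_op_def algebra_simps)
  also have "\<dots> = integral (cbox a b) (\<lambda>y. heat_op u y s * P (R y) s)
       + integral (cbox a b) (\<lambda>y. laplacian (\<lambda>y. u y s) y * P (R y) s) + integral (cbox a b) (\<lambda>y. u y s * Ps (R y) s)"
    using slice[OF c1 s] slice[OF c5 s] slice[OF c7 s]
    by (subst integral_add, simp add: ic integrable_add, simp add: ic, subst integral_add) (simp_all add: ic)
  also have "\<dots> = integral (cbox a b) (\<lambda>y. heat_op u y s * P (R y) s)
      + (integral (cbox a b) (\<lambda>y. u y s * (2 * real CARD('n) * P1 (R y) s + 4 * R y * P2 (R y) s)) + integral (cbox a b) (\<lambda>y. u y s * Ps (R y) s))"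
    unfolding green by simp
  also have "integral (cbox a b) (\<lambda>y. u y s * (2 * real CARD('n) * P1 (R y) s + 4 * R y * P2 (R y) s)) + integral (cbox a b) (\<lambda>y. u y s * Ps (R y) s)
     = integral (cbox a b) (\<lambda>y. u y s * L y s)"
    using slice[OF c6 s] slice[OF c7 s]
    by (subst integral_add[symmetric]) (simp_all add: ic L_def algebra_simps)
  finally show "((\<lambda>s. integral (cbox a b) (\<lambda>y. u y s * P (R y) s)) has_real_derivative
     integral (cbox a b) (\<lambda>y. heat_op u y s * P (R y) s) + integral (cbox a b) (\<lambda>y. u y s * L y s)) (at s)"
    using D by simp
qed

lemma R_outside:
  assumes "y \<notin> cball x \<rho>"
  shows "R y > \<rho>\<^sup>2"
proof -
  have "norm (y - x) > \<rho>" using assms by (simp add: dist_norm norm_minus_commute)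
  then show ?thesis using rho_nonneg unfolding R_def by (intro power_strict_mono) auto
qed

lemma nn_integral_test:
  assumes "s \<in> {c<..<d}" "\<And>y. 0 \<le> u y s * P (R y) s"
  shows "(\<integral>\<^sup>+y. ennreal (u y s * P (R y) s) \<partial>lborel) = ennreal (integral (cbox a b) (\<lambda>y. u y s * P (R y) s))"
proof -
  have z: "u y s * P (R y) s = 0" if "y \<notin> cbox a b" for y
  proof -
    have "y \<notin> cball x \<rho>" using that Q subset_cball[of \<rho> "\<rho> + 1" x] by auto
    then show ?thesis using supp[OF assms(1) R_outside] by simp
  qed
  have "(\<integral>\<^sup>+y. ennreal (u y s * P (R y) s) \<partial>lborel)
      = (\<integral>\<^sup>+y. ennreal (u y s * P (R y) s) * indicator (cbox a b) y \<partial>lborel)"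
    by (intro nn_integral_cong, rename_tac y, case_tac "y \<in> cbox a b") (simp, metis z ennreal_0 mult_zero_left)
  also have "\<dots> = ennreal (integral (cbox a b) (\<lambda>y. u y s * P (R y) s))"
    by (rule nn_integral_cbox_continuous) (use assms in \<open>auto intro: continuous_on_subset[OF evolution(6)]\<close>)
  finally show ?thesis .
qed

text \<open>The evolution identity integrated over a compact time interval; Tonelli identifies the
  iterated source integral with a Lebesgue integral over space-time. A sign is asked only of the
  product with the test function, because \<open>heat_op\<close> will be controlled only on its
  support.\<close>

lemma evolution_integral:
  assumes s: "c < s1" "s1 \<le> s2" "s2 < d"
    and pos: "\<And>y s. s \<in> {c<..<d} \<Longrightarrow> 0 \<le> heat_op u y s * P (R y) s"
  defines "G \<equiv> integral {s1..s2} (\<lambda>s. integral (cbox a b) (\<lambda>y. heat_op u y s * P (R y) s))"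
  shows "(\<integral>\<^sup>+z. ennreal (heat_op u (fst z) (snd z) * P (R (fst z)) (snd z)) * indicator (UNIV \<times> {s1..s2}) z \<partial>lborel) = ennreal G"
    and "integral (cbox a b) (\<lambda>y. u y s2 * P (R y) s2) = integral (cbox a b) (\<lambda>y. u y s1 * P (R y) s1)
      + G + integral {s1..s2} (\<lambda>s. integral (cbox a b) (\<lambda>y. u y s * L y s))"
    and "G \<ge> 0"
proof -
  define g where "g = (\<lambda>s. integral (cbox a b) (\<lambda>y. heat_op u y s * P (R y) s))"
  define e where "e = (\<lambda>s. integral (cbox a b) (\<lambda>y. u y s * L y s))"
  define J where "J = (\<lambda>s. integral (cbox a b) (\<lambda>y. u y s * P (R y) s))"
  have sub: "{s1..s2} \<subseteq> {c<..<d}" using s by auto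
  have "((\<lambda>s. g s + e s) has_integral (J s2 - J s1)) {s1..s2}"
  proof (rule fundamental_theorem_of_calculus)
    fix t assume "t \<in> {s1..s2}"
    then have "t \<in> {c<..<d}" using sub by auto
    from has_field_derivative_at_within[OF evolution(1)[OF this], of "{s1..s2}"]
    have "(J has_real_derivative g t + e t) (at t within {s1..s2})"
      unfolding g_def e_def J_def .
    then show "(J has_vector_derivative g t + e t) (at t within {s1..s2})"
      by (simp add: has_real_derivative_iff_has_vector_derivative)
  qed (rule s)
  then have *: "J s2 - J s1 = integral {s1..s2} (\<lambda>s. g s + e s)" by (simp add: integral_unique)
  have ig: "g integrable_on {s1..s2}" "e integrable_on {s1..s2}"
    unfolding g_def e_def
    by (rule integrable_continuous_real[OF continuous_on_subset[OF evolution(2) sub]],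
        rule integrable_continuous_real[OF continuous_on_subset[OF evolution(3) sub]])
  have "integral {s1..s2} (\<lambda>s. g s + e s) = integral {s1..s2} g + integral {s1..s2} e"
    using ig by (rule integral_add)
  with * show "integral (cbox a b) (\<lambda>y. u y s2 * P (R y) s2) = integral (cbox a b) (\<lambda>y. u y s1 * P (R y) s1)
      + G + integral {s1..s2} (\<lambda>s. integral (cbox a b) (\<lambda>y. u y s * L y s))"
    unfolding J_def g_def e_def G_def by simp
  have cg: "(\<integral>\<^sup>+y. ennreal (heat_op u y s * P (R y) s) \<partial>lborel) = ennreal (g s)" and g0: "0 \<le> g s" if "s \<in> {c<..<d}" for s
  proof -
    have z: "heat_op u y s * P (R y) s = 0" if "y \<notin> cbox a b" for y
    proof -
      have "y \<notin> cball x \<rho>" using that Q subset_cball[of \<rho> "\<rho> + 1" x] by auto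
      then show ?thesis using supp[OF \<open>s \<in> _\<close> R_outside] by simp
    qed
    have "(\<integral>\<^sup>+y. ennreal (heat_op u y s * P (R y) s) \<partial>lborel)
        = (\<integral>\<^sup>+y. ennreal (heat_op u y s * P (R y) s) * indicator (cbox a b) y \<partial>lborel)"
      by (intro nn_integral_cong, rename_tac y, case_tac "y \<in> cbox a b") (simp, metis z ennreal_0 mult_zero_left)
    also have "\<dots> = ennreal (g s)" unfolding g_def
      by (rule nn_integral_cbox_continuous) (use that pos in \<open>auto intro: continuous_on_subset[OF evolution(4)]\<close>)
    finally show "(\<integral>\<^sup>+y. ennreal (heat_op u y s * P (R y) s) \<partial>lborel) = ennreal (g s)" .
    show "0 \<le> g s" unfolding g_def
      by (rule integral_nonneg) (use that pos in \<open>auto intro!: integrable_continuous continuous_on_subset[OF evolution(4)]\<close>)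
  qed
  show "G \<ge> 0" unfolding G_def using integral_nonneg[OF ig(1)] g0 sub unfolding g_def by blast
  define F where "F = (\<lambda>z. ennreal (heat_op u (fst z) (snd z) * P (R (fst z)) (snd z)) * indicator (UNIV \<times> {s1..s2}) z)"
  have "(\<lambda>z. indicator (UNIV \<times> {s1..s2}) z *\<^sub>R (heat_op u (fst z) (snd z) * P (R (fst z)) (snd z))) \<in> borel_measurable borel"
  proof (rule borel_measurable_continuous_on_indicator)
    show "UNIV \<times> {s1..s2} \<in> sets borel" by (intro borel_closed closed_Times) auto
    show "continuous_on (UNIV \<times> {s1..s2}) (\<lambda>z. heat_op u (fst z) (snd z) * P (R (fst z)) (snd z))"
    proof -
      have "continuous_on (UNIV \<times> {s1..s2}) (\<lambda>z::(real^'n) \<times> real. (snd z, fst z))" by (intro continuous_intros)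
      moreover have "(\<lambda>z::(real^'n) \<times> real. (snd z, fst z)) ` (UNIV \<times> {s1..s2}) \<subseteq> {c<..<d} \<times> UNIV" using sub by auto
      ultimately show ?thesis using continuous_on_compose2[OF evolution(7)] by fastforce
    qed
  qed
  then have "(\<lambda>z. ennreal (indicator (UNIV \<times> {s1..s2}) z *\<^sub>R (heat_op u (fst z) (snd z) * P (R (fst z)) (snd z)))) \<in> borel_measurable borel"
    by measurable
  also have "(\<lambda>z. ennreal (indicator (UNIV \<times> {s1..s2}) z *\<^sub>R (heat_op u (fst z) (snd z) * P (R (fst z)) (snd z)))) = F"
    by (auto simp: F_def split: split_indicator)
  finally have Fm: "F \<in> borel_measurable (lborel \<Otimes>\<^sub>M lborel)" by (simp add: lborel_prod)
  have "(\<integral>\<^sup>+z. F z \<partial>lborel) = (\<integral>\<^sup>+s. \<integral>\<^sup>+y. F (y, s) \<partial>lborel \<partial>lborel)"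
    using lborel_pair.nn_integral_snd[OF Fm] by (simp add: lborel_prod)
  also have "\<dots> = (\<integral>\<^sup>+s. ennreal (g s) * indicator {s1..s2} s \<partial>lborel)"
  proof (rule nn_integral_cong)
    fix s
    show "(\<integral>\<^sup>+y. F (y, s) \<partial>lborel) = ennreal (g s) * indicator {s1..s2} s"
      using cg[of s] sub by (cases "s \<in> {s1..s2}") (auto simp: F_def indicator_def)
  qed
  also have "\<dots> = ennreal G"
    unfolding G_def g_def[symmetric] by (rule nn_integral_has_integral_lebesgue') (use g0 sub ig in \<open>auto simp: integrable_integral\<close>)
  finally show "(\<integral>\<^sup>+z. ennreal (heat_op u (fst z) (snd z) * P (R (fst z)) (snd z)) * indicator (UNIV \<times> {s1..s2}) z \<partial>lborel) = ennreal G"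
    unfolding F_def .
qed

end

section \<open>Local mass and Duhamel's formula for supersolutions\<close>

text \<open>The weight makes the backward operator \<open>L\<close> nonnegative. The weighted mass
  \<open>J\<close> then never decreases in time, so its value at T0 dominates both all earlier
  values and the total source; no information at time 0 enters.\<close>

lemma supersolution_mass:
  fixes u :: "real^'n \<Rightarrow> real \<Rightarrow> real"
  assumes u: "C21 T u" and pos: "\<And>y s. s \<in> {0<..<T} \<Longrightarrow> 0 \<le> u y s"
    and sup: "\<And>y s. y \<in> cball x \<rho> \<Longrightarrow> s \<in> {0<..<T} \<Longrightarrow> 0 \<le> heat_op u y s"
    and \<rho>: "\<rho> > 0" and T0: "0 < T0" "T0 < T"
  obtains C where "C \<ge> 0"
    "\<And>s. 0 < s \<Longrightarrow> s \<le> T0 \<Longrightarrow> local_mass u (cball x (\<rho>/2)) s \<le> ennreal C"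
    "source_mass u (cball x (\<rho>/2) \<times> {0<..T0}) \<le> ennreal C"
proof -
  let ?n = "real CARD('n)"
  obtain c where c: "cball x (\<rho> + 1) \<subseteq> cbox (- c) c"
    using bounded_subset_cbox_symmetric[OF bounded_cball] by blast
  (* With this value the quadratic kappa v^2 - (6n+24) v + 24 rho^2 has no sign change, so L is nonnegative. *)
  define \<kappa> where "\<kappa> = (6 * ?n + 24)\<^sup>2 / (96 * \<rho>\<^sup>2)"
  have \<kappa>: "\<kappa> \<ge> 0" by (simp add: \<kappa>_def)
  define w where "w = (\<lambda>r. max 0 (\<rho>\<^sup>2 - r))"
  \<comment> \<open>The cube is the lowest integer power of \<open>w\<close> with a continuous
    second derivative. Near the edge of the ball the term with R * P2 is of first order in
    \<open>w\<close> and wins; elsewhere the growth factor exp (\<kappa> s) supplies \<kappa> w^3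
    against the negative part of the Laplacian.\<close>
  define P where "P = (\<lambda>r s. exp (\<kappa> * s) * w r ^ 3)"
  define P1 where "P1 = (\<lambda>r s. exp (\<kappa> * s) * (- 3 * w r ^ 2))"
  define P2 where "P2 = (\<lambda>r s. exp (\<kappa> * s) * (6 * w r))"
  define Ps where "Ps = (\<lambda>r s. \<kappa> * (exp (\<kappa> * s) * w r ^ 3))"
  have w0: "0 \<le> w r" for r by (simp add: w_def)
  have dw: "((\<lambda>r. w r ^ Suc (Suc k)) has_real_derivative - real (Suc (Suc k)) * w r ^ Suc k) (at r)" for k r
  proof -
    have "((\<lambda>r. \<rho>\<^sup>2 - r) has_real_derivative - 1) (at r)" by (auto intro!: derivative_eq_intros)
    note d = DERIV_chain2[where g = "\<lambda>r. \<rho>\<^sup>2 - r" and x = r, OF DERIV_pos_power[of k "\<rho>\<^sup>2 - r"] this]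
    show ?thesis unfolding w_def by (rule DERIV_cong[OF d]) (simp add: algebra_simps)
  qed
  interpret radial_test u P P1 P2 Ps T 0 T \<rho> x "- c" c
  proof
    fix r s
    show "((\<lambda>r. P r s) has_real_derivative P1 r s) (at r)"
      using DERIV_cmult[OF dw[of 1 r], of "exp (\<kappa> * s)"] by (simp add: P_def P1_def numeral_eq_Suc)
    show "((\<lambda>r. P1 r s) has_real_derivative P2 r s) (at r)"
      using DERIV_cmult[OF dw[of 0 r], of "exp (\<kappa> * s) * (- 3)"] by (simp add: P1_def P2_def numeral_eq_Suc algebra_simps)
    show "((\<lambda>s. P r s) has_real_derivative Ps r s) (at s)"
      unfolding P_def Ps_def by (auto intro!: derivative_eq_intros)
    show "\<rho>\<^sup>2 < r \<Longrightarrow> P r s = 0 \<and> P1 r s = 0" by (simp add: P_def P1_def w_def)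
  qed (use u c \<rho> in \<open>auto simp: P_def P1_def P2_def Ps_def w_def split_beta intro!: continuous_intros\<close>)
  have P0: "0 \<le> P r s" for r s by (simp add: P_def w0)
  have L0: "0 \<le> L y s" for y s
  proof -
    have L: "L y s = exp (\<kappa> * s) * (w (R y) * (\<kappa> * (w (R y))\<^sup>2 - 6 * ?n * w (R y) + 24 * R y))"
      unfolding L_def by (simp add: Ps_def P1_def P2_def algebra_simps power2_eq_square power3_eq_cube)
    show ?thesis
    proof (cases "w (R y) = 0")
      case False
      then have wr: "w (R y) = \<rho>\<^sup>2 - R y" by (auto simp: w_def max_def split: if_splits)
      define v where "v = w (R y)"
      define m where "m = 6 * ?n + 24"
      have "\<kappa> * v\<^sup>2 - m * v + 24 * \<rho>\<^sup>2 \<ge> 0"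
      proof -
        have "0 \<le> (m * v / (\<rho> * sqrt 96) - sqrt 24 * \<rho>)\<^sup>2" by simp
        also have "\<dots> = m\<^sup>2 * v\<^sup>2 / (96 * \<rho>\<^sup>2) - 2 * (m * v / (\<rho> * sqrt 96)) * (sqrt 24 * \<rho>) + 24 * \<rho>\<^sup>2"
          by (simp add: power2_diff power_divide power_mult_distrib)
        also have "2 * (m * v / (\<rho> * sqrt 96)) * (sqrt 24 * \<rho>) = m * v"
        proof -
          have "sqrt 96 = 2 * sqrt 24" using real_sqrt_mult[of 4 24] by simp
          then show ?thesis using \<rho> by simp
        qed
        finally show ?thesis by (simp add: \<kappa>_def m_def)
      qed
      then have "\<kappa> * v\<^sup>2 - 6 * ?n * v + 24 * (\<rho>\<^sup>2 - v) \<ge> 0" by (simp add: m_def algebra_simps)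
      moreover have Rv: "R y = \<rho>\<^sup>2 - v" using wr by (simp add: v_def)
      moreover have "0 \<le> v" by (simp add: v_def w0)
      ultimately show ?thesis unfolding L unfolding v_def[symmetric] unfolding Rv by simp
    qed (simp add: L)
  qed
  have fP: "0 \<le> heat_op u y s * P (R y) s" if "s \<in> {0<..<T}" for y s
  proof (cases "y \<in> cball x \<rho>")
    case True then show ?thesis using sup[OF _ that] P0 by simp
  next
    case False then show ?thesis using supp[OF that R_outside] by simp
  qed
  define J where "J = (\<lambda>s. integral (cbox (- c) c) (\<lambda>y. u y s * P (R y) s))"
  \<comment> \<open>The minimum of w^3 over the ball of half the radius, attained where r = \<rho>^2
    / 4; the growth factor is at least 1 for s > 0.\<close>
  define m where "m = (3/4 * \<rho>\<^sup>2) ^ 3"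
  have m: "m > 0" using \<rho> by (simp add: m_def)
  have Pm: "m \<le> P (R y) s" if "y \<in> cball x (\<rho>/2)" "s > 0" for y s
  proof -
    have "R y \<le> (\<rho>/2)\<^sup>2" unfolding R_def using that \<rho> by (intro power_mono) (auto simp: dist_norm norm_minus_commute)
    then have "3/4 * \<rho>\<^sup>2 \<le> w (R y)" by (simp add: w_def power_divide le_max_iff_disj)
    then have "m \<le> w (R y) ^ 3" unfolding m_def by (intro power_mono) auto
    moreover have "1 \<le> exp (\<kappa> * s)" using \<kappa> that by simp
    ultimately have "1 * m \<le> exp (\<kappa> * s) * w (R y) ^ 3" using m by (intro mult_mono) auto
    then show ?thesis by (simp add: P_def)
  qed
  have J0: "J s \<ge> 0" if "s \<in> {0<..<T}" for s
    unfolding J_def by (rule integral_nonneg)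
      (use that pos P0 in \<open>auto intro!: integrable_continuous continuous_on_subset[OF evolution(6)]\<close>)
  have e0: "0 \<le> integral {s1..s2} (\<lambda>s. integral (cbox (- c) c) (\<lambda>y. u y s * L y s))" if "0 < s1" "s2 < T" for s1 s2
  proof (rule integral_nonneg)
    show "(\<lambda>s. integral (cbox (- c) c) (\<lambda>y. u y s * L y s)) integrable_on {s1..s2}"
      using that by (intro integrable_continuous_real continuous_on_subset[OF evolution(3)]) auto
    fix s assume s: "s \<in> {s1..s2}"
    then have s: "s \<in> {0<..<T}" using that by auto
    show "0 \<le> integral (cbox (- c) c) (\<lambda>y. u y s * L y s)"
      using s pos L0 by (intro integral_nonneg integrable_continuous continuous_on_subset[OF evolution(5)]) auto
  qed
  define C where "C = J T0 / m"
  have "C \<ge> 0" using J0[of T0] T0 m by (simp add: C_def)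
  moreover have "local_mass u (cball x (\<rho>/2)) s \<le> ennreal C" if s: "0 < s" "s \<le> T0" for s
  proof -
    have sT: "s \<in> {0<..<T}" using s T0 by auto
    have "J s \<le> J T0"
      using evolution_integral(2,3)[OF s T0(2) fP] e0[OF s(1) T0(2)] unfolding J_def by linarith
    then have JC: "J s / m \<le> C" using m by (simp add: C_def divide_right_mono)
    have "local_mass u (cball x (\<rho>/2)) s
       \<le> (\<integral>\<^sup>+y. ennreal (1 / m) * ennreal (u y s * P (R y) s) \<partial>lborel)"
    proof (rule nn_integral_mono)
      fix y
      show "ennreal (u y s) * indicator (cball x (\<rho>/2)) y \<le> ennreal (1 / m) * ennreal (u y s * P (R y) s)"
      proof (cases "y \<in> cball x (\<rho>/2)")
        case True
        have "u y s * m \<le> u y s * P (R y) s" using Pm[OF True s(1)] pos[OF sT] by (intro mult_left_mono) auto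
        then have "u y s \<le> 1 / m * (u y s * P (R y) s)" using m by (simp add: field_simps)
        then show ?thesis using True m by (simp add: ennreal_mult'[symmetric] ennreal_leI)
      qed auto
    qed
    also have "\<dots> = ennreal (1 / m) * (\<integral>\<^sup>+y. ennreal (u y s * P (R y) s) \<partial>lborel)"
    proof (rule nn_integral_cmult)
      have "(\<lambda>y. u y s * P (R y) s) \<in> borel_measurable borel"
        by (rule borel_measurable_continuous_onI[OF evolution(6)[OF sT]])
      then show "(\<lambda>y. ennreal (u y s * P (R y) s)) \<in> borel_measurable lborel" by simp
    qed
    also have "\<dots> = ennreal (1 / m) * ennreal (J s)"
      unfolding J_def using nn_integral_test[OF sT] pos[OF sT] P0 by simp
    also have "\<dots> = ennreal (J s / m)" using m by (simp add: ennreal_mult'[symmetric])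
    also have "\<dots> \<le> ennreal C" using JC by (rule ennreal_leI)
    finally show ?thesis .
  qed
  moreover have "source_mass u (cball x (\<rho>/2) \<times> {0<..T0}) \<le> ennreal C"
  proof (rule nn_integral_time_exhaust[OF _ _ T0(1)])
    fix s assume s: "0 < s" "s < T0"
    have Sm: "cball x (\<rho>/2) \<times> {s..T0} \<in> sets borel" by (intro borel_closed closed_Times) auto
    show "(\<lambda>z. ennreal (heat_op u (fst z) (snd z)) * indicator (cball x (\<rho>/2) \<times> {s..T0}) z) \<in> borel_measurable lborel"
    proof -
      have "cball x (\<rho>/2) \<times> {s..T0} \<subseteq> UNIV \<times> {0<..<T}" using s T0 by auto
      from C21_measurable(1)[OF u Sm this] show ?thesis by simp
    qed
    define G where "G = integral {s..T0} (\<lambda>s. integral (cbox (- c) c) (\<lambda>y. heat_op u y s * P (R y) s))"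
    have G: "G \<le> J T0"
      using evolution_integral(2)[OF s(1) _ T0(2) fP] e0[OF s(1) T0(2)] J0[of s] s T0 unfolding J_def G_def by simp
    have "source_mass u (cball x (\<rho>/2) \<times> {s..T0})
      \<le> (\<integral>\<^sup>+z. ennreal (1 / m) * (ennreal (heat_op u (fst z) (snd z) * P (R (fst z)) (snd z)) * indicator (UNIV \<times> {s..T0}) z) \<partial>lborel)"
    proof (rule nn_integral_mono)
      fix z :: "(real^'n) \<times> real"
      show "ennreal (heat_op u (fst z) (snd z)) * indicator (cball x (\<rho>/2) \<times> {s..T0}) z
        \<le> ennreal (1 / m) * (ennreal (heat_op u (fst z) (snd z) * P (R (fst z)) (snd z)) * indicator (UNIV \<times> {s..T0}) z)"
      proof (cases "z \<in> cball x (\<rho>/2) \<times> {s..T0}")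
        case True
        then obtain y r where z: "z = (y, r)" "y \<in> cball x (\<rho>/2)" "r \<in> {s..T0}" by auto
        have "0 \<le> heat_op u y r" using z s T0 \<rho> by (intro sup) auto
        then have "heat_op u y r * m \<le> heat_op u y r * P (R y) r" using Pm[OF z(2), of r] z s by (intro mult_left_mono) auto
        then have "heat_op u y r \<le> 1 / m * (heat_op u y r * P (R y) r)" using m by (simp add: field_simps)
        then show ?thesis using z m by (simp add: ennreal_mult'[symmetric] ennreal_leI)
      qed auto
    qed
    also have "\<dots> = ennreal (1 / m) * ennreal G"
    proof (subst nn_integral_cmult)
      have cc: "continuous_on (UNIV \<times> {s..T0}) (\<lambda>z. heat_op u (fst z) (snd z) * P (R (fst z)) (snd z))"
      proof -
        have "continuous_on (UNIV \<times> {s..T0}) (\<lambda>z::(real^'n) \<times> real. (snd z, fst z))" by (intro continuous_intros)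
        moreover have "(\<lambda>z::(real^'n) \<times> real. (snd z, fst z)) ` (UNIV \<times> {s..T0}) \<subseteq> {0<..<T} \<times> UNIV" using s T0 by auto
        ultimately show ?thesis using continuous_on_compose2[OF evolution(7)] by fastforce
      qed
      have "(\<lambda>z. indicator (UNIV \<times> {s..T0}) z *\<^sub>R (heat_op u (fst z) (snd z) * P (R (fst z)) (snd z))) \<in> borel_measurable borel"
        by (rule borel_measurable_continuous_on_indicator[OF _ cc]) (intro borel_closed closed_Times; simp)
      then have "(\<lambda>z. ennreal (indicator (UNIV \<times> {s..T0}) z *\<^sub>R (heat_op u (fst z) (snd z) * P (R (fst z)) (snd z)))) \<in> borel_measurable lborel"
        by simp
      also have "(\<lambda>z. ennreal (indicator (UNIV \<times> {s..T0}) z *\<^sub>R (heat_op u (fst z) (snd z) * P (R (fst z)) (snd z))))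
        = (\<lambda>z. ennreal (heat_op u (fst z) (snd z) * P (R (fst z)) (snd z)) * indicator (UNIV \<times> {s..T0}) z)"
        by (auto split: split_indicator)
      finally show "(\<lambda>z. ennreal (heat_op u (fst z) (snd z) * P (R (fst z)) (snd z)) * indicator (UNIV \<times> {s..T0}) z) \<in> borel_measurable lborel" .
      show "ennreal (1 / m) * (\<integral>\<^sup>+z. ennreal (heat_op u (fst z) (snd z) * P (R (fst z)) (snd z)) * indicator (UNIV \<times> {s..T0}) z \<partial>lborel) = ennreal (1 / m) * ennreal G"
        using evolution_integral(1)[OF s(1) _ T0(2) fP] s unfolding G_def by simp
    qed
    also have "\<dots> = ennreal (G / m)" using m by (simp add: ennreal_mult'[symmetric])
    also have "\<dots> \<le> ennreal C" using G m by (intro ennreal_leI) (simp add: C_def divide_right_mono)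
    finally show "source_mass u (cball x (\<rho>/2) \<times> {s..T0}) \<le> ennreal C" .
  qed
  ultimately show thesis by (rule that)
qed

text \<open>Two nested truncated cubes: h = 1 - q^3 with q = (1 - c w^3)_+ and w = (\<rho>^2 - r)_+.
  The value of c makes c w^3 reach 1 at r = \<rho>^2 / 4, where q becomes 0; the outer cube keeps h
  twice continuously differentiable there, the inner one does so at r = \<rho>^2.\<close>

lemma radial_cutoff:
  fixes \<rho> :: real
  assumes \<rho>: "\<rho> > 0"
  obtains h h1 h2 :: "real \<Rightarrow> real" and B where
    "\<And>r. (h has_real_derivative h1 r) (at r)" "\<And>r. (h1 has_real_derivative h2 r) (at r)"
    "continuous_on UNIV h2" "\<And>r. 0 \<le> h r" "\<And>r. h r \<le> 1"
    "\<And>r. r \<le> \<rho>\<^sup>2 / 4 \<Longrightarrow> h r = 1 \<and> h1 r = 0 \<and> h2 r = 0"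
    "\<And>r. r \<ge> \<rho>\<^sup>2 \<Longrightarrow> h r = 0 \<and> h1 r = 0 \<and> h2 r = 0"
    "\<And>r. \<bar>h1 r\<bar> \<le> B" "\<And>r. \<bar>h2 r\<bar> \<le> B"
proof -
  define c where "c = 1 / (3 / 4 * \<rho>\<^sup>2) ^ 3"
  have c: "c > 0" using \<rho> by (simp add: c_def)
  define w where "w = (\<lambda>r. max 0 (\<rho>\<^sup>2 - r))"
  define q where "q = (\<lambda>r. max 0 (1 - c * w r ^ 3))"
  define h where "h = (\<lambda>r. 1 - q r ^ 3)"
  define h1 where "h1 = (\<lambda>r. - 9 * c * (q r ^ 2 * w r ^ 2))"
  define h2 where "h2 = (\<lambda>r. - 9 * c * (6 * c * q r * w r ^ 4 - 2 * q r ^ 2 * w r))"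
  have w0: "0 \<le> w r" and q0: "0 \<le> q r" for r by (simp_all add: w_def q_def)
  have dw: "((\<lambda>r. w r ^ Suc (Suc k)) has_real_derivative - real (Suc (Suc k)) * w r ^ Suc k) (at r)" for k r
  proof -
    have "((\<lambda>r. \<rho>\<^sup>2 - r) has_real_derivative - 1) (at r)" by (auto intro!: derivative_eq_intros)
    note d = DERIV_chain2[where g = "\<lambda>r. \<rho>\<^sup>2 - r" and x = r, OF DERIV_pos_power[of k "\<rho>\<^sup>2 - r"] this]
    show ?thesis unfolding w_def by (rule DERIV_cong[OF d]) (simp add: algebra_simps)
  qed
  have dv: "((\<lambda>r. 1 - c * w r ^ 3) has_real_derivative 3 * c * w r ^ 2) (at r)" for r
    using DERIV_diff[OF DERIV_const DERIV_cmult[OF dw[of 1 r], of c], of 1] by (simp add: numeral_eq_Suc algebra_simps)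
  have dq: "((\<lambda>r. q r ^ Suc (Suc k)) has_real_derivative real (Suc (Suc k)) * q r ^ Suc k * (3 * c * w r ^ 2)) (at r)" for k r
    unfolding q_def
    by (rule DERIV_chain2[where g = "\<lambda>r. 1 - c * w r ^ 3" and x = r, OF DERIV_pos_power[of k "1 - c * w r ^ 3"] dv])
  have d1: "(h has_real_derivative h1 r) (at r)" for r
    unfolding h_def h1_def
    by (rule DERIV_cong[OF DERIV_diff[OF DERIV_const]]) (use dq[of 1 r] in \<open>simp add: numeral_eq_Suc\<close>, simp add: numeral_eq_Suc algebra_simps)
  have d2: "(h1 has_real_derivative h2 r) (at r)" for r
  proof -
    have "((\<lambda>r. q r ^ 2 * w r ^ 2) has_real_derivative
       (2 * q r * (3 * c * w r ^ 2)) * w r ^ 2 + (- 2 * w r) * q r ^ 2) (at r)"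
      using DERIV_mult[OF dq[of 0 r] dw[of 0 r]] by (simp add: numeral_eq_Suc)
    from DERIV_cmult[OF this, of "- 9 * c"] show ?thesis
      unfolding h1_def h2_def by (rule DERIV_cong) (simp add: algebra_simps power2_eq_square numeral_eq_Suc)
  qed
  have c2: "continuous_on S h2" and c1: "continuous_on S h1" for S
    unfolding h2_def h1_def q_def w_def by (intro continuous_intros)+
  have in0: "q r = 0" if "r \<le> \<rho>\<^sup>2 / 4" for r
  proof -
    have "(3 / 4 * \<rho>\<^sup>2) ^ 3 \<le> w r ^ 3" using that by (intro power_mono) (auto simp: w_def le_max_iff_disj)
    then have "1 \<le> c * w r ^ 3" using \<rho> by (simp add: c_def field_simps)
    then show ?thesis by (simp add: q_def)
  qed
  have out0: "w r = 0" if "r \<ge> \<rho>\<^sup>2" for r using that by (simp add: w_def)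
  have q1: "q r \<le> 1" for r using c w0[of r] by (simp add: q_def)
  obtain B1 where B1: "\<And>r. r \<in> {\<rho>\<^sup>2/4..\<rho>\<^sup>2} \<Longrightarrow> norm (h1 r) \<le> B1"
    using compact_imp_bounded[OF compact_continuous_image[OF c1 compact_Icc]] unfolding bounded_iff by blast
  obtain B2 where B2: "\<And>r. r \<in> {\<rho>\<^sup>2/4..\<rho>\<^sup>2} \<Longrightarrow> norm (h2 r) \<le> B2"
    using compact_imp_bounded[OF compact_continuous_image[OF c2 compact_Icc]] unfolding bounded_iff by blast
  have in': "h r = 1 \<and> h1 r = 0 \<and> h2 r = 0" if "r \<le> \<rho>\<^sup>2 / 4" for r
    using in0[OF that] by (simp add: h_def h1_def h2_def)
  have out': "h r = 0 \<and> h1 r = 0 \<and> h2 r = 0" if "r \<ge> \<rho>\<^sup>2" for r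
    using out0[OF that] by (simp add: h_def h1_def h2_def q_def)
  have b: "\<bar>h1 r\<bar> \<le> max 0 (max B1 B2)" "\<bar>h2 r\<bar> \<le> max 0 (max B1 B2)" for r
  proof -
    have "\<bar>h1 r\<bar> \<le> max 0 (max B1 B2) \<and> \<bar>h2 r\<bar> \<le> max 0 (max B1 B2)"
    proof (cases "r \<le> \<rho>\<^sup>2/4 \<or> r \<ge> \<rho>\<^sup>2")
      case True
      then have "h1 r = 0 \<and> h2 r = 0" using in' out' by blast
      then show ?thesis by simp
    next
      case False
      then have "r \<in> {\<rho>\<^sup>2/4..\<rho>\<^sup>2}" by simp
      from B1[OF this] B2[OF this] show ?thesis by simp linarith
    qed
    then show "\<bar>h1 r\<bar> \<le> max 0 (max B1 B2)" "\<bar>h2 r\<bar> \<le> max 0 (max B1 B2)" by auto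
  qed
  show thesis
    by (rule that[of h h1 h2, OF d1 d2 c2 _ _ in' out' b]) (use q0 q1 in \<open>auto simp: h_def power_le_one\<close>)
qed

text \<open>The test function is the heat kernel centred at (x, t), run backwards and multiplied by
  a cutoff. Since the kernel solves the backward heat equation, \<open>L\<close> contains only terms
  with derivatives of the cutoff. They live at distance between \<rho>/2 and \<rho> from x, where
  the kernel stays bounded up to time t. Their total effect is \<open>CB\<close>, and no constant
  depends on x, t or s0.\<close>

lemma supersolution_repr:
  fixes u :: "real^'n \<Rightarrow> real \<Rightarrow> real"
  assumes u: "C21 T u" and pos: "\<And>y s. s \<in> {0<..<T} \<Longrightarrow> 0 \<le> u y s"
    and sup: "\<And>y s. y \<in> cball x0 (2 * \<rho>) \<Longrightarrow> s \<in> {0<..<T} \<Longrightarrow> 0 \<le> heat_op u y s"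
    and \<rho>: "\<rho> > 0" and T0: "0 < T0" "T0 < T" and CA: "CA \<ge> 0"
    and mass: "\<And>s. 0 < s \<Longrightarrow> s \<le> T0 \<Longrightarrow> local_mass u (cball x0 (2 * \<rho>)) s \<le> ennreal CA"
  obtains c0 CB where "c0 > 0" "CB \<ge> 0"
    "\<And>x t s0. x \<in> cball x0 \<rho> \<Longrightarrow> 0 < s0 \<Longrightarrow> s0 < t \<Longrightarrow> t \<le> T0 \<Longrightarrow>
      ennreal (c0 * u x t) \<le> initial_term u (cball x0 (2 * \<rho>)) x s0 t
       + source_term u (cball x0 (2 * \<rho>)) x s0 t + ennreal CB"
proof -
  let ?n = "real CARD('n)"
  let ?B = "cball x0 (2 * \<rho>)"
  obtain h h1 h2 B where h: "\<And>r. (h has_real_derivative h1 r) (at r)" "\<And>r. (h1 has_real_derivative h2 r) (at r)"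
    "continuous_on UNIV h2" "\<And>r. 0 \<le> h r" "\<And>r. h r \<le> 1"
    "\<And>r. r \<le> \<rho>\<^sup>2 / 4 \<Longrightarrow> h r = 1 \<and> h1 r = 0 \<and> h2 r = 0"
    "\<And>r. r \<ge> \<rho>\<^sup>2 \<Longrightarrow> h r = 0 \<and> h1 r = 0 \<and> h2 r = 0"
    "\<And>r. \<bar>h1 r\<bar> \<le> B" "\<And>r. \<bar>h2 r\<bar> \<le> B"
    using radial_cutoff[OF \<rho>] by blast
  have B0: "B \<ge> 0" using h(8)[of 0] by linarith
  have ch: "continuous_on UNIV h" "continuous_on UNIV h1"
    by (rule DERIV_continuous_on, rule has_field_derivative_at_within, rule h)+
  \<comment> \<open>\<open>K1\<close> and \<open>K2\<close> bound the kernel and the kernel divided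
    by the elapsed time where the cutoff varies: there r \<ge> \<rho>^2 / 4, so the exponent r / (4
    \<tau>) is at least (\<rho>^2 / 16) / \<tau>.\<close>
  define K1 where "K1 = (?n / 2 / (\<rho>\<^sup>2 / 16)) powr (?n / 2)"
  define K2 where "K2 = ((?n / 2 + 1) / (\<rho>\<^sup>2 / 16)) powr (?n / 2 + 1)"
  define CL where "CL = K1 * (2 * ?n * B + 4 * \<rho>\<^sup>2 * B) + K2 * (2 * \<rho>\<^sup>2 * B)"
  have K0: "K1 \<ge> 0" "K2 \<ge> 0" by (simp_all add: K1_def K2_def)
  have CL0: "CL \<ge> 0" using K0 B0 by (simp add: CL_def)
  (* c0 u(x,t) only accounts for the mass of the kernel in a ball of radius sqrt tau;
     this avoids a sharp approximate-identity argument. *)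
  define c0 where "c0 = 1 / 2 * (4 * pi) powr (- ?n / 2) * exp (- 1 / 4) * unit_ball_vol ?n"
  have c0: "c0 > 0" by (simp add: c0_def)
  \<comment> \<open>Length of the time interval, times the bound on the absolute value of
    \<open>L\<close>, times the bound on the local mass.\<close>
  define CB where "CB = T0 * (CL * CA)"
  have CB0: "CB \<ge> 0" using CL0 CA T0 by (simp add: CB_def)
  have main: "ennreal (c0 * u x t) \<le> initial_term u ?B x s0 t
       + source_term u ?B x s0 t + ennreal CB"
    if x: "x \<in> cball x0 \<rho>" and s0: "0 < s0" "s0 < t" and t: "t \<le> T0" for x t s0
  proof (cases "u x t > 0")
    case False
    then have "c0 * u x t \<le> 0" using c0 by (simp add: mult_nonneg_nonpos)
    then show ?thesis by (simp add: ennreal_neg)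
  next
    case upos: True
    have sub: "cball x \<rho> \<subseteq> ?B"
    proof
      fix y assume "y \<in> cball x \<rho>"
      then show "y \<in> ?B" using x dist_triangle[of x0 y x] by simp
    qed
    obtain c where c: "cball x (\<rho> + 1) \<subseteq> cbox (- c) c"
      using bounded_subset_cbox_symmetric[OF bounded_cball] by blast
    define E where "E = (\<lambda>r s. (4 * pi * (t - s)) powr (- ?n / 2) * exp (- r / (4 * (t - s))))"
    define P where "P = (\<lambda>r s. h r * E r s)"
    define P1 where "P1 = (\<lambda>r s. h1 r * E r s - h r * E r s / (4 * (t - s)))"
    define P2 where "P2 = (\<lambda>r s. h2 r * E r s - h1 r * E r s / (2 * (t - s)) + h r * E r s / (16 * (t - s)\<^sup>2))"
    define Ps where "Ps = (\<lambda>r s. h r * (E r s * (?n / (2 * (t - s)) - r / (4 * (t - s)\<^sup>2))))"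
    have dEr: "((\<lambda>r. E r s) has_real_derivative - E r s / (4 * (t - s))) (at r)" if "s < t" for r s
    proof -
      have "((\<lambda>r. exp (- r / (4 * (t - s)))) has_real_derivative exp (- r / (4 * (t - s))) * (- 1 / (4 * (t - s)))) (at r)"
        by (intro DERIV_fun_exp DERIV_cdivide DERIV_minus DERIV_ident)
      from DERIV_cmult[OF this, of "(4 * pi * (t - s)) powr (- ?n / 2)"] show ?thesis
        unfolding E_def by (rule DERIV_cong) simp
    qed
    have dEs: "((\<lambda>s. E r s) has_real_derivative E r s * (?n / (2 * (t - s)) - r / (4 * (t - s)\<^sup>2))) (at s)" if "s < t" for r s
    proof -
      have p: "((\<lambda>s. (4 * pi * (t - s)) powr (- ?n / 2)) has_real_derivative
          (4 * pi * (t - s)) powr (- ?n / 2) * (?n / (2 * (t - s)))) (at s)"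
      proof -
        have "((\<lambda>s. 4 * pi * (t - s)) has_real_derivative - (4 * pi)) (at s)" by (auto intro!: derivative_eq_intros)
        from DERIV_fun_powr[OF this, of "- ?n / 2"] that
        have *: "((\<lambda>s. (4 * pi * (t - s)) powr (- ?n / 2)) has_real_derivative
          - ?n / 2 * (4 * pi * (t - s)) powr (- ?n / 2 - 1) * (- (4 * pi))) (at s)" by simp
        have "(4 * pi * (t - s)) powr (- ?n / 2 - 1) = (4 * pi * (t - s)) powr (- ?n / 2) / (4 * pi * (t - s))"
          using that by (subst powr_diff) simp
        moreover have "- k / 2 * (p / X) * (- c) = p * (k / 2 * c / X)" for k p X c :: real by simp
        ultimately have "- ?n / 2 * (4 * pi * (t - s)) powr (- ?n / 2 - 1) * (- (4 * pi))
           = (4 * pi * (t - s)) powr (- ?n / 2) * (?n / 2 * (4 * pi) / (4 * pi * (t - s)))" by (simp only:)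
        also have "?n / 2 * (4 * pi) / (4 * pi * (t - s)) = ?n / (2 * (t - s))" using that by (simp add: field_simps)
        finally show ?thesis by (rule DERIV_cong[OF *])
      qed
      have e: "((\<lambda>s. exp (- r / (4 * (t - s)))) has_real_derivative
          exp (- r / (4 * (t - s))) * (- r / (4 * (t - s)\<^sup>2))) (at s)"
      proof -
        have "((\<lambda>s. t - s) has_real_derivative - 1) (at s)" by (auto intro!: derivative_eq_intros)
        from DERIV_cmult[OF DERIV_inverse_fun[OF this], of "- r / 4"] that
        have "((\<lambda>s. - r / (4 * (t - s))) has_real_derivative - r / (4 * (t - s)\<^sup>2)) (at s)"
          by (simp add: field_simps power2_eq_square)
        then show ?thesis by (rule DERIV_fun_exp)
      qed
      show ?thesis unfolding E_def
        by (rule DERIV_cong[OF DERIV_mult[OF p e]]) (simp add: algebra_simps)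
    qed
    have cE: "continuous_on (UNIV \<times> {0<..<t}) (\<lambda>z. E (fst z) (snd z))"
      unfolding E_def by (intro continuous_intros) auto
    have chz: "continuous_on (UNIV \<times> {0<..<t}) (\<lambda>z. h (fst z))" "continuous_on (UNIV \<times> {0<..<t}) (\<lambda>z. h1 (fst z))"
      "continuous_on (UNIV \<times> {0<..<t}) (\<lambda>z. h2 (fst z))"
      by (rule continuous_on_compose2[OF ch(1)] continuous_on_compose2[OF ch(2)] continuous_on_compose2[OF h(3)], (intro continuous_intros, simp))+
    interpret radial_test u P P1 P2 Ps T 0 t \<rho> x "- c" c
    proof
      fix r s :: real assume s: "s \<in> {0<..<t}"
      then have st: "s < t" by simp
      show "((\<lambda>r. P r s) has_real_derivative P1 r s) (at r)"
        unfolding P_def P1_def by (rule DERIV_cong[OF DERIV_mult[OF h(1) dEr[OF st]]]) simp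
      have hE: "((\<lambda>r. h r * E r s) has_real_derivative h1 r * E r s + - E r s / (4 * (t - s)) * h r) (at r)"
        by (rule DERIV_mult[OF h(1) dEr[OF st]])
      have alg: "a2 * e + - e / (4 * \<tau>) * a1 - (a1 * e + - e / (4 * \<tau>) * a0) / (4 * \<tau>)
         = a2 * e - a1 * e / (2 * \<tau>) + a0 * e / (16 * \<tau>\<^sup>2)" if "\<tau> \<noteq> 0" for a0 a1 a2 e \<tau> :: real
        using that by (simp add: field_simps power2_eq_square)
      have "t - s \<noteq> 0" using st by simp
      show "((\<lambda>r. P1 r s) has_real_derivative P2 r s) (at r)"
        unfolding P1_def P2_def
        by (rule DERIV_cong[OF DERIV_diff[OF DERIV_mult[OF h(2) dEr[OF st]] DERIV_cdivide[OF hE]] alg[OF \<open>t - s \<noteq> 0\<close>]])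
      show "((\<lambda>s. P r s) has_real_derivative Ps r s) (at s)"
        unfolding P_def Ps_def by (rule DERIV_cmult[OF dEs[OF st]])
      show "\<rho>\<^sup>2 < r \<Longrightarrow> P r s = 0 \<and> P1 r s = 0" using h(7)[of r] by (simp add: P_def P1_def)
    next
      show "C21 T u" by (rule u)
      show "{0<..<t} \<subseteq> {0<..<T}" using t T0 by auto
      show "continuous_on (UNIV \<times> {0<..<t}) (\<lambda>(r, s). P r s)" "continuous_on (UNIV \<times> {0<..<t}) (\<lambda>(r, s). P1 r s)"
        "continuous_on (UNIV \<times> {0<..<t}) (\<lambda>(r, s). P2 r s)" "continuous_on (UNIV \<times> {0<..<t}) (\<lambda>(r, s). Ps r s)"
        unfolding split_beta P_def P1_def P2_def Ps_def by (intro continuous_intros cE chz; auto)+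
      show "cball x (\<rho> + 1) \<subseteq> cbox (- c) c" by (rule c)
      show "0 \<le> \<rho>" using \<rho> by simp
    qed
    have E0: "0 \<le> E r s" for r s by (simp add: E_def)
    have P0: "0 \<le> P r s" for r s by (simp add: P_def E0 h(4))
    have PE: "P r s \<le> E r s" for r s using mult_right_mono[OF h(5) E0, of r r s] by (simp add: P_def)
    have EK: "E (R y) s = heat_kernel (x - y) (t - s)" if "s < t" for y s
      using that by (simp add: E_def heat_kernel_def R_def norm_minus_commute)
    have Pout: "P (R y) s = 0" if "y \<notin> cball x \<rho>" for y s
      using R_outside[OF that] h(7) by (simp add: P_def)
    \<comment> \<open>All terms without a derivative of the cutoff cancel: this is the backward heat
      equation for \<open>E\<close>.\<close>
    have L: "L y s = E (R y) s * (2 * ?n * h1 (R y) + 4 * R y * h2 (R y)) - E (R y) s / (t - s) * (2 * R y * h1 (R y))" if "s < t" for y s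
    proof -
      define \<tau> where "\<tau> = t - s"
      have "\<tau> \<noteq> 0" using that by (simp add: \<tau>_def)
      then show ?thesis
        unfolding L_def unfolding Ps_def P1_def P2_def unfolding \<tau>_def[symmetric]
        by (simp add: field_simps power2_eq_square)
    qed
    have R0: "0 \<le> R y" for y by (simp add: R_def)
    have Lb: "\<bar>L y s\<bar> \<le> CL" if s: "s < t" for y s
    proof (cases "\<rho>\<^sup>2/4 \<le> R y \<and> R y \<le> \<rho>\<^sup>2")
      case False
      then have "h1 (R y) = 0 \<and> h2 (R y) = 0" using h(6)[of "R y"] h(7)[of "R y"] by linarith
      then show ?thesis using L[OF s] CL0 by simp
    next
      case True
      define \<tau> where "\<tau> = t - s"
      have \<tau>: "\<tau> > 0" using s by (simp add: \<tau>_def)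
      have "E (R y) s \<le> \<tau> powr (- (?n / 2)) * exp (- (\<rho>\<^sup>2/16) / \<tau>)"
      proof -
        have "(4 * pi * \<tau>) powr (- ?n / 2) \<le> \<tau> powr (- (?n / 2))"
          using \<tau> pi_ge_two by (simp only: minus_divide_left[symmetric]) (intro powr_mono2', auto)
        moreover have "exp (- R y / (4 * \<tau>)) \<le> exp (- (\<rho>\<^sup>2/16) / \<tau>)"
          using True \<tau> by (simp add: field_simps)
        ultimately show ?thesis unfolding E_def \<tau>_def[symmetric] by (intro mult_mono) auto
      qed
      note Eb = this
      have E1: "E (R y) s \<le> K1"
        using Eb powr_neg_times_exp_le[of "?n/2" "\<rho>\<^sup>2/16" \<tau>] \<tau> \<rho> unfolding K1_def by simp
      have "E (R y) s / \<tau> \<le> \<tau> powr (- (?n / 2)) * exp (- (\<rho>\<^sup>2/16) / \<tau>) / \<tau>"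
        using Eb \<tau> by (intro divide_right_mono) auto
      also have "\<dots> = \<tau> powr (- (?n / 2 + 1)) * exp (- (\<rho>\<^sup>2/16) / \<tau>)"
      proof -
        have "- (?n / 2 + 1) = - (?n / 2) - 1" by simp
        then have "\<tau> powr (- (?n / 2 + 1)) = \<tau> powr (- (?n / 2)) / \<tau>"
          using powr_diff[of \<tau> "- (?n / 2)" 1] \<tau> by (simp only: powr_one)
        then show ?thesis by (simp only:) simp
      qed
      also have "\<dots> \<le> K2" unfolding K2_def using \<tau> \<rho> by (intro powr_neg_times_exp_le) auto
      finally have E2: "E (R y) s / \<tau> \<le> K2" .
      have b1: "\<bar>2 * ?n * h1 (R y) + 4 * R y * h2 (R y)\<bar> \<le> 2 * ?n * B + 4 * \<rho>\<^sup>2 * B"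
      proof -
        have "\<bar>2 * ?n * h1 (R y) + 4 * R y * h2 (R y)\<bar> \<le> 2 * ?n * \<bar>h1 (R y)\<bar> + 4 * R y * \<bar>h2 (R y)\<bar>"
          using abs_triangle_ineq[of "2 * ?n * h1 (R y)" "4 * R y * h2 (R y)"] R0[of y] by (simp add: abs_mult)
        also have "\<dots> \<le> 2 * ?n * B + 4 * \<rho>\<^sup>2 * B"
          using True R0[of y] B0 h(8) h(9) by (intro add_mono mult_mono) auto
        finally show ?thesis .
      qed
      have b2: "\<bar>2 * R y * h1 (R y)\<bar> \<le> 2 * \<rho>\<^sup>2 * B"
        using True R0[of y] B0 h(8)[of "R y"] by (simp only: abs_mult) (intro mult_mono, auto)
      have "\<bar>L y s\<bar> \<le> E (R y) s * \<bar>2 * ?n * h1 (R y) + 4 * R y * h2 (R y)\<bar> + E (R y) s / \<tau> * \<bar>2 * R y * h1 (R y)\<bar>"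
        unfolding L[OF s] \<tau>_def[symmetric]
        using abs_triangle_ineq4[of "E (R y) s * (2 * ?n * h1 (R y) + 4 * R y * h2 (R y))" "E (R y) s / \<tau> * (2 * R y * h1 (R y))"] E0[of "R y" s] \<tau>
        by (simp only: abs_mult abs_divide abs_of_nonneg abs_of_pos)
      also have "\<dots> \<le> CL" unfolding CL_def
        using E1 E2 b1 b2 K0 E0[of "R y" s] \<tau> B0 by (intro add_mono mult_mono) auto
      finally show ?thesis .
    qed
    have Lout: "L y s = 0" if "y \<notin> cball x \<rho>" "s < t" for y s
      using R_outside[OF that(1)] h(7)[of "R y"] L[OF that(2)] by simp
    have tT: "s \<in> {0<..<T}" if "s \<in> {0<..<t}" for s using that t T0 by auto
    have fP: "0 \<le> heat_op u y s * P (R y) s" if "s \<in> {0<..<t}" for y s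
    proof (cases "y \<in> cball x \<rho>")
      case True then show ?thesis using sup[of y s] sub tT[OF that] P0 by auto
    next
      case False then show ?thesis using Pout by simp
    qed
    define e where "e = (\<lambda>s. integral (cbox (- c) c) (\<lambda>y. u y s * L y s))"
    have eb: "\<bar>e s\<bar> \<le> CL * CA" if s: "s \<in> {0<..<t}" for s
    proof -
      have ci: "continuous_on (cbox (- c) c) (\<lambda>y. u y s * L y s)"
        by (rule continuous_on_subset[OF evolution(5)[OF s]]) simp
      have cm: "continuous_on (cbox (- c) c) (\<lambda>y. \<bar>u y s * L y s\<bar>)" using ci by (rule continuous_on_rabs)
      have "\<bar>e s\<bar> \<le> integral (cbox (- c) c) (\<lambda>y. \<bar>u y s * L y s\<bar>)"
        unfolding e_def using integral_norm_bound_integral[OF integrable_continuous[OF ci] integrable_continuous[OF cm]] by simp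
      moreover have "ennreal (integral (cbox (- c) c) (\<lambda>y. \<bar>u y s * L y s\<bar>)) \<le> ennreal (CL * CA)"
      proof -
        have "ennreal (integral (cbox (- c) c) (\<lambda>y. \<bar>u y s * L y s\<bar>))
           = (\<integral>\<^sup>+y. ennreal (\<bar>u y s * L y s\<bar>) * indicator (cbox (- c) c) y \<partial>lborel)"
          by (rule nn_integral_cbox_continuous[symmetric, OF cm]) simp
        also have "\<dots> \<le> (\<integral>\<^sup>+y. ennreal CL * (ennreal (u y s) * indicator ?B y) \<partial>lborel)"
        proof (rule nn_integral_mono)
          fix y
          show "ennreal \<bar>u y s * L y s\<bar> * indicator (cbox (- c) c) y \<le> ennreal CL * (ennreal (u y s) * indicator ?B y)"
          proof (cases "y \<in> cball x \<rho>")
            case True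
            have "\<bar>u y s * L y s\<bar> \<le> CL * u y s"
              using Lb[of s y] pos[OF tT[OF s], of y] s mult_left_mono[of "\<bar>L y s\<bar>" CL "u y s"] by (simp add: abs_mult mult.commute)
            then have "ennreal \<bar>u y s * L y s\<bar> \<le> ennreal CL * ennreal (u y s)"
              using CL0 by (simp add: ennreal_mult'[symmetric] ennreal_leI)
            then show ?thesis using True sub by (auto split: split_indicator)
          next
            case False
            then show ?thesis using Lout[OF False, of s] s by simp
          qed
        qed
        also have "\<dots> = ennreal CL * local_mass u ?B s"
        proof (rule nn_integral_cmult)
          note [measurable] = C21_measurable_slice[OF u tT[OF s]]
          have [measurable]: "?B \<in> sets borel" by (rule borel_closed) simp
          show "(\<lambda>y. ennreal (u y s) * indicator ?B y) \<in> borel_measurable lborel" by measurable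
        qed
        also have "\<dots> \<le> ennreal CL * ennreal CA" using mass[of s] s t by (intro mult_left_mono) auto
        finally show ?thesis using CL0 CA by (simp add: ennreal_mult)
      qed
      ultimately show ?thesis using CL0 CA by (simp add: ennreal_le_iff)
    qed
    obtain \<delta> where \<delta>: "\<delta> > 0" and \<delta>u: "\<And>y s. s \<in> {0<..<T} \<Longrightarrow> dist (y, s) (x, t) < \<delta> \<Longrightarrow> u y s \<ge> u x t / 2"
    proof -
      have "(x, t) \<in> UNIV \<times> {0<..<T}" using s0 t T0 by auto
      from C21_continuous(1)[OF u, unfolded continuous_on_iff, rule_format, OF this, of "u x t / 2"] upos
      obtain \<delta> where "\<delta> > 0" "\<And>z. z \<in> UNIV \<times> {0<..<T} \<Longrightarrow> dist z (x, t) < \<delta> \<Longrightarrow> dist (case z of (x, t) \<Rightarrow> u x t) (u x t) < u x t / 2"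
        by auto
      then show thesis using that[of \<delta>] by (force simp: dist_real_def abs_if split: if_splits)
    qed
    \<comment> \<open>The kernel is singular at time t, so the test integral is evaluated at t -
      \<eta>^2, on the ball of radius \<eta>. The entry 1 gives \<eta>^2 \<le> \<eta>; \<rho>/2 puts
      the ball where the cutoff is 1; \<delta>/3 keeps \<eta> + \<eta>^2 below \<delta>, so that u
      is at least half of u(x,t) there; the last entry places t - \<eta>^2 after s0.\<close>
    define \<eta> where "\<eta> = min 1 (min (\<rho>/2) (min (\<delta>/3) (sqrt (t - s0) / 2)))"
    have \<eta>: "\<eta> > 0" "\<eta> \<le> 1" "\<eta> \<le> \<rho>/2" "\<eta> \<le> \<delta>/3" "\<eta> \<le> sqrt (t - s0) / 2"
      using \<rho> \<delta> s0 by (auto simp: \<eta>_def)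
    have \<eta>2: "\<eta>\<^sup>2 < t - s0" "\<eta>\<^sup>2 \<le> \<eta>"
    proof -
      have "\<eta>\<^sup>2 \<le> (sqrt (t - s0) / 2)\<^sup>2" using \<eta> by (intro power_mono) auto
      then show "\<eta>\<^sup>2 < t - s0" using s0 by (simp add: power_divide)
      show "\<eta>\<^sup>2 \<le> \<eta>" using \<eta> by (simp add: power2_eq_square mult_left_le)
    qed
    define s2 where "s2 = t - \<eta>\<^sup>2"
    have s2: "s0 < s2" "s2 < t" "0 < s2" using \<eta>2 \<eta> s0 by (auto simp: s2_def)
    then have s2I: "s2 \<in> {0<..<t}" by auto
    define J where "J = (\<lambda>s. integral (cbox (- c) c) (\<lambda>y. u y s * P (R y) s))"
    \<comment> \<open>The volume of the ball, of order \<eta>^n, cancels the height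
      (\<eta>^2)^(-n/2) of the kernel at age \<eta>^2; hence \<open>c0\<close> does not depend on
      \<eta>.\<close>
    have lower: "ennreal (c0 * u x t) \<le> ennreal (J s2)"
    proof -
      define m where "m = u x t / 2 * ((4 * pi * \<eta>\<^sup>2) powr (- ?n / 2) * exp (- 1 / 4))"
      have m0: "m \<ge> 0" using upos by (simp add: m_def)
      have "ennreal m * emeasure lborel (cball x \<eta>) = (\<integral>\<^sup>+y. ennreal m * indicator (cball x \<eta>) y \<partial>lborel)"
        by (simp add: nn_integral_cmult_indicator)
      also have "\<dots> \<le> (\<integral>\<^sup>+y. ennreal (u y s2 * P (R y) s2) \<partial>lborel)"
      proof (rule nn_integral_mono)
        fix y
        show "ennreal m * indicator (cball x \<eta>) y \<le> ennreal (u y s2 * P (R y) s2)"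
        proof (cases "y \<in> cball x \<eta>")
          case True
          have Ry: "R y \<le> \<eta>\<^sup>2" unfolding R_def using True by (intro power_mono) (auto simp: dist_norm norm_minus_commute)
          also have "\<dots> \<le> (\<rho>/2)\<^sup>2" using \<eta> by (intro power_mono) auto
          finally have "h (R y) = 1" using h(6)[of "R y"] by (simp add: power_divide)
          then have PP: "P (R y) s2 = (4 * pi * \<eta>\<^sup>2) powr (- ?n / 2) * exp (- R y / (4 * \<eta>\<^sup>2))"
            by (simp add: P_def E_def s2_def)
          have "exp (- 1 / 4) \<le> exp (- R y / (4 * \<eta>\<^sup>2))" using Ry \<eta> by (simp add: field_simps)
          then have PP': "(4 * pi * \<eta>\<^sup>2) powr (- ?n / 2) * exp (- 1 / 4) \<le> P (R y) s2"
            unfolding PP by (intro mult_left_mono) auto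
          have "dist (y, s2) (x, t) \<le> dist y x + dist s2 t"
            unfolding dist_prod_def by (simp add: sqrt_sum_squares_le_sum)
          also have "\<dots> \<le> \<eta> + \<eta>\<^sup>2" using True by (simp add: s2_def dist_commute dist_real_def)
          also have "\<dots> < \<delta>" using \<eta>2 \<eta> \<delta> by linarith
          finally have "u x t / 2 \<le> u y s2" using \<delta>u[of s2 y] tT[OF s2I] by simp
          then have "m \<le> u y s2 * P (R y) s2" unfolding m_def using PP' upos by (intro mult_mono) auto
          then show ?thesis using True by (simp add: ennreal_leI)
        qed simp
      qed
      also have "\<dots> = ennreal (J s2)" unfolding J_def
        using nn_integral_test[OF s2I] pos[OF tT[OF s2I]] P0 by simp
      also have "ennreal m * emeasure lborel (cball x \<eta>) = ennreal (c0 * u x t)"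
      proof -
        have "emeasure lborel (cball x \<eta>) = ennreal (unit_ball_vol ?n * \<eta> ^ CARD('n))"
          using emeasure_cball[of \<eta> x] \<eta> by simp
        then have "ennreal m * emeasure lborel (cball x \<eta>) = ennreal (m * (unit_ball_vol ?n * \<eta> ^ CARD('n)))"
          using m0 \<eta> by (simp add: ennreal_mult)
        also have "m * (unit_ball_vol ?n * \<eta> ^ CARD('n)) = c0 * u x t"
        proof -
          have "(4 * pi * \<eta>\<^sup>2) powr (- ?n / 2) = (4 * pi) powr (- ?n / 2) * (\<eta> powr 2) powr (- ?n / 2)"
            using \<eta> by (simp add: powr_mult powr_numeral)
          also have "(\<eta> powr 2) powr (- ?n / 2) = \<eta> powr (- ?n)" by (simp add: powr_powr)
          also have "\<dots> = 1 / \<eta> ^ CARD('n)" using \<eta> by (simp add: powr_minus powr_realpow field_simps)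
          finally show ?thesis using \<eta> by (simp add: m_def c0_def)
        qed
        finally show ?thesis .
      qed
      finally show ?thesis .
    qed
    define G where "G = integral {s0..s2} (\<lambda>s. integral (cbox (- c) c) (\<lambda>y. heat_op u y s * P (R y) s))"
    have s02: "s0 \<le> s2" using s2 by simp
    have J2: "J s2 = J s0 + G + integral {s0..s2} e" and G0: "G \<ge> 0"
      using evolution_integral(2,3)[OF s0(1) s02 s2(2) fP] unfolding J_def G_def e_def by auto
    have "integral {s0..s2} e \<le> CB"
    proof -
      have ie: "e integrable_on {s0..s2}" unfolding e_def
        using s0 s2 by (intro integrable_continuous_real continuous_on_subset[OF evolution(3)]) auto
      have "integral {s0..s2} e \<le> integral {s0..s2} (\<lambda>_. CL * CA)"
        using eb s0 s2 by (intro integral_le ie) (auto intro: order_trans[OF abs_ge_self])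
      also have "\<dots> = (s2 - s0) * (CL * CA)" using s2 by simp
      also have "\<dots> \<le> CB" unfolding CB_def using s0 s2 t CL0 CA by (intro mult_right_mono) auto
      finally show ?thesis .
    qed
    then have "J s2 \<le> J s0 + G + CB" using J2 by linarith
    moreover have J00: "J s0 \<ge> 0" unfolding J_def
      using s0 pos[OF tT, of s0] P0
      by (intro integral_nonneg integrable_continuous continuous_on_subset[OF evolution(6)]) auto
    ultimately have "ennreal (J s2) \<le> ennreal (J s0) + ennreal G + ennreal CB"
      using G0 CB0 by (simp add: ennreal_plus[symmetric] ennreal_leI del: ennreal_plus)
    also have "ennreal (J s0) \<le> initial_term u ?B x s0 t"
    proof -
      have s0I: "s0 \<in> {0<..<t}" using s0 by auto
      have "ennreal (J s0) = (\<integral>\<^sup>+y. ennreal (u y s0 * P (R y) s0) \<partial>lborel)"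
        unfolding J_def using nn_integral_test[OF s0I] pos[OF tT[OF s0I]] P0 by simp
      also have "\<dots> \<le> initial_term u ?B x s0 t"
      proof (rule nn_integral_mono)
        fix y
        show "ennreal (u y s0 * P (R y) s0) \<le> ennreal (u y s0 * heat_kernel (x - y) (t - s0)) * indicator ?B y"
        proof (cases "y \<in> cball x \<rho>")
          case True
          then have "y \<in> ?B" using sub by auto
          then show ?thesis using PE[of "R y" s0] EK[OF s0(2), of y] pos[OF tT[OF s0I], of y]
            by (auto intro!: ennreal_leI mult_left_mono)
        qed (simp add: Pout)
      qed
      finally show ?thesis .
    qed
    also have "ennreal G \<le> source_term u ?B x s0 t"
    proof -
      have "ennreal G = (\<integral>\<^sup>+z. ennreal (heat_op u (fst z) (snd z) * P (R (fst z)) (snd z)) * indicator (UNIV \<times> {s0..s2}) z \<partial>lborel)"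
        using evolution_integral(1)[OF s0(1) s02 s2(2) fP] unfolding G_def by simp
      also have "\<dots> \<le> source_term u ?B x s0 t"
      proof (rule nn_integral_mono)
        fix z :: "(real^'n) \<times> real"
        obtain y s where z: "z = (y, s)" by (cases z)
        show "ennreal (heat_op u (fst z) (snd z) * P (R (fst z)) (snd z)) * indicator (UNIV \<times> {s0..s2}) z
          \<le> ennreal (heat_op u (fst z) (snd z) * heat_kernel (x - fst z) (t - snd z)) * indicator (?B \<times> {s0..<t}) z"
        proof (cases "y \<in> cball x \<rho> \<and> s \<in> {s0..s2}")
          case True
          then have yB: "y \<in> ?B" and s: "s0 \<le> s" "s < t" "s \<in> {0<..<t}" using sub s0 s2 by auto
          have "heat_op u y s * P (R y) s \<le> heat_op u y s * heat_kernel (x - y) (t - s)"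
            using PE[of "R y" s] EK[OF s(2), of y] sup[OF yB tT[OF s(3)]] by (auto intro!: mult_left_mono)
          then show ?thesis using True yB s by (simp add: z ennreal_leI)
        qed (auto simp: z Pout)
      qed
      finally show ?thesis .
    qed
    finally show ?thesis using lower by (auto intro: order_trans add_mono)
  qed
  show thesis by (rule that[OF c0 CB0 main])
qed

section \<open>Local integrability and the nonlocal factor\<close>

text \<open>Integration in space leaves a multiple of \<tau> powr (n/2 (1 - p)), integrable at 0
  because p < (n+2)/n. The first bound integrates over the observation point, the second over the
  source point. Time is restricted because the power need not be integrable at infinity.\<close>

lemma heat_kernel_powr_space_time:
  assumes p: "0 < p" "p < (real CARD('n) + 2) / real CARD('n)" and T0: "T0 > 0"
  obtains K where "K \<ge> 0"
    "\<And>(y::real^'n) s. (\<integral>\<^sup>+z. ennreal (heat_kernel (fst z - y) (snd z - s) powr p) * indicator (UNIV \<times> {..s + T0}) z \<partial>lborel) \<le> ennreal K"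
    "\<And>(y::real^'n) s. (\<integral>\<^sup>+z. ennreal (heat_kernel (y - fst z) (s - snd z) powr p) * indicator (UNIV \<times> {s - T0..}) z \<partial>lborel) \<le> ennreal K"
proof -
  let ?n = "real CARD('n)"
  define a where "a = ?n / 2 * (1 - p)"
  have a: "a > - 1" using p by (simp add: a_def field_simps)
  define C where "C = (4 * pi) powr a * p powr (- ?n / 2)"
  have C0: "C \<ge> 0" by (simp add: C_def)
  have sp: "(\<integral>\<^sup>+x. ennreal (heat_kernel (x - y) \<tau> powr p) \<partial>lborel) \<le> ennreal C * (ennreal (\<tau> powr a) * indicator {0<..} \<tau>)" for y :: "real^'n" and \<tau>
  proof (cases "\<tau> > 0")
    case True
    have "(\<integral>\<^sup>+x. ennreal (heat_kernel (x - y) \<tau> powr p) \<partial>lborel) = (\<integral>\<^sup>+x. ennreal (heat_kernel (y - x) \<tau> powr p) \<partial>lborel)"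
      by (simp add: heat_kernel_commute)
    also have "\<dots> = ennreal ((4 * pi * \<tau>) powr a * p powr (- ?n / 2))"
      using nn_integral_heat_kernel_powr[OF True p(1), of y] by (simp add: a_def)
    also have "(4 * pi * \<tau>) powr a * p powr (- ?n / 2) = C * \<tau> powr a"
      using True by (simp add: C_def powr_mult)
    finally show ?thesis using True C0 by (simp add: ennreal_mult)
  next
    case False
    then show ?thesis by (simp add: heat_kernel_def)
  qed
  \<comment> \<open>Any length beyond T0 would do: the closed range of elapsed times up to T0 has to
    fit into an open interval.\<close>
  define T1 where "T1 = 2 * T0"
  define K where "K = C * (T1 powr (a + 1) / (a + 1))"
  have K0: "K \<ge> 0" using C0 a by (simp add: K_def)
  have tm: "(\<integral>\<^sup>+\<tau>. ennreal C * (ennreal (\<tau> powr a) * indicator {0<..<T1} \<tau>) \<partial>lborel) \<le> ennreal K"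
  proof -
    have "(\<integral>\<^sup>+\<tau>. ennreal C * (ennreal (\<tau> powr a) * indicator {0<..<T1} \<tau>) \<partial>lborel)
       = ennreal C * (\<integral>\<^sup>+\<tau>. ennreal (\<tau> powr a) * indicator {0<..<T1} \<tau> \<partial>lborel)"
      by (rule nn_integral_cmult) measurable
    also have "\<dots> \<le> ennreal C * ennreal (T1 powr (a + 1) / (a + 1))"
      using nn_integral_powr_from_0[OF a, of T1] T0 by (intro mult_left_mono) (auto simp: T1_def)
    finally show ?thesis unfolding K_def using C0 a by (subst ennreal_mult) auto
  qed
  have 1: "(\<integral>\<^sup>+z. ennreal (heat_kernel (fst z - y) (snd z - s) powr p) * indicator (UNIV \<times> {..s + T0}) z \<partial>lborel) \<le> ennreal K"
    for y :: "real^'n" and s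
  proof -
    have [measurable]: "(UNIV :: (real^'n) set) \<times> {..s + T0} \<in> sets (borel \<Otimes>\<^sub>M borel)" by measurable
    have "(\<integral>\<^sup>+z. ennreal (heat_kernel (fst z - y) (snd z - s) powr p) * indicator (UNIV \<times> {..s + T0}) z \<partial>lborel)
      = (\<integral>\<^sup>+t. \<integral>\<^sup>+x. ennreal (heat_kernel (x - y) (t - s) powr p) * indicator (UNIV \<times> {..s + T0}) (x, t) \<partial>lborel \<partial>lborel)"
      unfolding lborel_prod[symmetric]
      by (subst lborel_pair.nn_integral_snd[symmetric]) simp_all
    also have "\<dots> \<le> (\<integral>\<^sup>+t. ennreal C * (ennreal ((t - s) powr a) * indicator {0<..<T1} (t - s)) \<partial>lborel)"
    proof (rule nn_integral_mono)
      fix t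
      show "(\<integral>\<^sup>+x. ennreal (heat_kernel (x - y) (t - s) powr p) * indicator (UNIV \<times> {..s + T0}) (x, t) \<partial>lborel)
         \<le> ennreal C * (ennreal ((t - s) powr a) * indicator {0<..<T1} (t - s))"
        using sp[of y "t - s"] T0 by (cases "t \<le> s + T0") (auto simp: indicator_def T1_def split: if_splits)
    qed
    also have "\<dots> = (\<integral>\<^sup>+\<tau>. ennreal C * (ennreal (\<tau> powr a) * indicator {0<..<T1} \<tau>) \<partial>lborel)"
      using nn_integral_real_affine[of "\<lambda>\<tau>. ennreal C * (ennreal (\<tau> powr a) * indicator {0<..<T1} \<tau>)" 1 "- s"] by simp
    finally show ?thesis using tm by (rule order_trans)
  qed
  have 2: "(\<integral>\<^sup>+z. ennreal (heat_kernel (y - fst z) (s - snd z) powr p) * indicator (UNIV \<times> {s - T0..}) z \<partial>lborel) \<le> ennreal K"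
    for y :: "real^'n" and s
  proof -
    have [measurable]: "(UNIV :: (real^'n) set) \<times> {s - T0..} \<in> sets (borel \<Otimes>\<^sub>M borel)" by measurable
    have "(\<integral>\<^sup>+z. ennreal (heat_kernel (y - fst z) (s - snd z) powr p) * indicator (UNIV \<times> {s - T0..}) z \<partial>lborel)
      = (\<integral>\<^sup>+t. \<integral>\<^sup>+x. ennreal (heat_kernel (y - x) (s - t) powr p) * indicator (UNIV \<times> {s - T0..}) (x, t) \<partial>lborel \<partial>lborel)"
      unfolding lborel_prod[symmetric]
      by (subst lborel_pair.nn_integral_snd[symmetric]) simp_all
    also have "\<dots> \<le> (\<integral>\<^sup>+t. ennreal C * (ennreal ((s - t) powr a) * indicator {0<..<T1} (s - t)) \<partial>lborel)"
    proof (rule nn_integral_mono)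
      fix t
      show "(\<integral>\<^sup>+x. ennreal (heat_kernel (y - x) (s - t) powr p) * indicator (UNIV \<times> {s - T0..}) (x, t) \<partial>lborel)
         \<le> ennreal C * (ennreal ((s - t) powr a) * indicator {0<..<T1} (s - t))"
        using sp[of y "s - t"] T0 
        by (cases "t \<ge> s - T0") (auto simp: indicator_def T1_def heat_kernel_commute[of y] split: if_splits)
    qed
    also have "\<dots> = (\<integral>\<^sup>+\<tau>. ennreal C * (ennreal (\<tau> powr a) * indicator {0<..<T1} \<tau>) \<partial>lborel)"
      using nn_integral_real_affine[of "\<lambda>\<tau>. ennreal C * (ennreal (\<tau> powr a) * indicator {0<..<T1} \<tau>)" "- 1" s] by simp
    finally show ?thesis using tm by (rule order_trans)
  qed
  show thesis by (rule that[OF K0 1 2])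
qed

lemma borel_measurable_fst_snd:
  fixes f :: "'a \<Rightarrow> 'b::second_countable_topology \<times> 'c::second_countable_topology"
  assumes "f \<in> borel_measurable M"
  shows "(\<lambda>x. fst (f x)) \<in> borel_measurable M" "(\<lambda>x. snd (f x)) \<in> borel_measurable M"
  by (rule measurable_compose[OF assms borel_measurable_continuous_onI]; intro continuous_intros)+

text \<open>Splitting at height \<kappa>: above it, (\<Phi> / \<kappa>) powr (p - 1) is at least 1.
  With \<kappa> free to vary from point to point, this takes the place of a convolution
  inequality.\<close>

lemma le_split_powr:
  fixes \<kappa> \<Phi> p :: real
  assumes "p \<ge> 1" "\<kappa> > 0" "\<Phi> \<ge> 0"
  shows "\<Phi> \<le> \<kappa> + \<kappa> powr (1 - p) * \<Phi> powr p"
proof (cases "\<Phi> \<le> \<kappa>")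
  case True
  then show ?thesis by (simp add: add_increasing2)
next
  case False
  then have \<Phi>: "\<Phi> > 0" "\<kappa> \<le> \<Phi>" using assms by auto
  have "1 \<le> (\<Phi> / \<kappa>) powr (p - 1)" using \<Phi> assms by (intro ge_one_powr_ge_zero) auto
  then have "\<Phi> * 1 \<le> \<Phi> * (\<Phi> / \<kappa>) powr (p - 1)" using \<Phi> by (intro mult_left_mono) auto
  also have "\<dots> = \<Phi> powr 1 * \<Phi> powr (p - 1) * \<kappa> powr (1 - p)"
    using \<Phi> assms by (simp add: powr_divide powr_minus_divide[of \<kappa> "p - 1", simplified])
  also have "\<Phi> powr 1 * \<Phi> powr (p - 1) = \<Phi> powr p" by (simp only: powr_add[symmetric]) simp
  finally show ?thesis using assms by (simp add: mult.commute)
qed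

text \<open>The kernel is split at a height proportional to u(x,t). The masses being at most
  \<open>CA\<close>, the low part contributes at most half of c0 u(x,t) and is absorbed on the left.
  What remains bounds u^p by integrals of the p-th power of the kernel against finite measures, and
  Tonelli makes these integrable over bounded time intervals.\<close>

lemma supersolution_Lp:
  fixes u :: "real^'n \<Rightarrow> real \<Rightarrow> real"
  assumes u: "C21 T u" and pos: "\<And>y s. s \<in> {0<..<T} \<Longrightarrow> 0 \<le> u y s"
    and T0: "0 < T0" "T0 < T" and CA: "CA \<ge> 0" and B: "closed B"
    and mass: "\<And>s. 0 < s \<Longrightarrow> s \<le> T0 \<Longrightarrow> local_mass u B s \<le> ennreal CA"
    and fmass: "source_mass u (B \<times> {0<..T0}) \<le> ennreal CA"
    and c0: "c0 > 0" and CB: "CB \<ge> 0"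
    and repr: "\<And>x t s0. x \<in> B' \<Longrightarrow> 0 < s0 \<Longrightarrow> s0 < t \<Longrightarrow> t \<le> T0 \<Longrightarrow>
      ennreal (c0 * u x t) \<le> initial_term u B x s0 t
       + source_term u B x s0 t + ennreal CB"
    and p: "1 \<le> p" "p < (real CARD('n) + 2) / real CARD('n)"
    and B': "closed B'" "bounded B'"
  obtains Cp where "Cp \<ge> 0" "(\<integral>\<^sup>+z. ennreal (u (fst z) (snd z) powr p) * indicator (B' \<times> {0<..T0}) z \<partial>lborel) \<le> ennreal Cp"
proof -
  note [measurable (raw)] = borel_measurable_fst_snd
  have p0: "0 < p" using p by simp
  obtain K where K: "K \<ge> 0"
    "\<And>(y::real^'n) s. (\<integral>\<^sup>+z. ennreal (heat_kernel (fst z - y) (snd z - s) powr p) * indicator (UNIV \<times> {..s + T0}) z \<partial>lborel) \<le> ennreal K"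
    "\<And>(y::real^'n) s. (\<integral>\<^sup>+z. ennreal (heat_kernel (y - fst z) (s - snd z) powr p) * indicator (UNIV \<times> {s - T0..}) z \<partial>lborel) \<le> ennreal K"
    by (rule heat_kernel_powr_space_time[OF p0 p(2) T0(1)], rule that)
  define F where "F = (\<lambda>z. ennreal (heat_op u (fst z) (snd z)) * indicator (B \<times> {0<..T0}) z)"
  have F[measurable]: "F \<in> borel_measurable borel"
    unfolding F_def using T0 by (intro C21_measurable(1)[OF u] closed_times_Ioc_sets B) auto
  \<comment> \<open>The factor that arises when the absorbed inequality c0 u / 4 \<le>
    \<kappa>^(1-p) Y is multiplied by \<kappa>^(p-1); the summand 1 keeps the denominator
    positive.\<close>
  define c3 where "c3 = c0 / 4 * (c0 / (4 * (CA + 1))) powr (p - 1)"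
  have c3: "c3 > 0" using c0 CA by (simp add: c3_def)
  \<comment> \<open>Where u is at most 4 CB / c0 the error \<open>CB\<close> cannot be absorbed;
    there u^p is bounded by \<open>M\<close> on a set of finite measure.\<close>
  define M where "M = (4 * CB / c0) powr p"
  have M0: "M \<ge> 0" by (simp add: M_def)
  define V where "V = measure lborel (B' \<times> {0<..T0})"
  define Cp where "Cp = M * V + 1 / c3 * (2 * (CA * K))"
  have B's: "B' \<times> {0<..T0} \<in> sets borel"
    by (rule closed_times_Ioc_sets[OF B'(1)])
  have "bounded (B' \<times> {0<..T0})" using B' by (intro bounded_Times) auto
  then have "emeasure lborel (B' \<times> {0<..T0}) < \<infinity>" by (rule emeasure_bounded_finite)
  then have V: "emeasure lborel (B' \<times> {0<..T0}) = ennreal V"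
    unfolding V_def by (intro emeasure_eq_ennreal_measure) auto
  have Cp0: "Cp \<ge> 0" using M0 c3 CA K(1) by (simp add: Cp_def V_def)
  moreover have "(\<integral>\<^sup>+z. ennreal (u (fst z) (snd z) powr p) * indicator (B' \<times> {0<..T0}) z \<partial>lborel) \<le> ennreal Cp"
  proof (rule nn_integral_time_exhaust[OF _ _ T0(1)])
    fix s assume s: "0 < s" "s < T0"
    have S: "B' \<times> {s..T0} \<in> sets borel" by (intro borel_closed closed_Times B') auto
    have um: "(\<lambda>z. indicator (B' \<times> {s..T0}) z *\<^sub>R u (fst z) (snd z)) \<in> borel_measurable borel"
      using T0 s by (intro C21_measurable(2)[OF u S]) auto
    have "(\<lambda>z. ennreal ((indicator (B' \<times> {s..T0}) z *\<^sub>R u (fst z) (snd z)) powr p)) \<in> borel_measurable borel"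
      using um by measurable
    also have "(\<lambda>z. ennreal ((indicator (B' \<times> {s..T0}) z *\<^sub>R u (fst z) (snd z)) powr p))
      = (\<lambda>z. ennreal (u (fst z) (snd z) powr p) * indicator (B' \<times> {s..T0}) z)"
      using p0 by (auto split: split_indicator)
    finally show "(\<lambda>z. ennreal (u (fst z) (snd z) powr p) * indicator (B' \<times> {s..T0}) z) \<in> borel_measurable lborel" by simp
    \<comment> \<open>Any initial time strictly between 0 and s would serve; the mass bound is
      uniform in it.\<close>
    define s0 where "s0 = s / 2"
    have s0: "0 < s0" "s0 < s" "s0 \<le> T0" using s by (auto simp: s0_def)
    define g where "g = (\<lambda>y. ennreal (u y s0) * indicator B y)"
    have g[measurable]: "g \<in> borel_measurable borel"
    proof -
      have [measurable]: "(\<lambda>y. u y s0) \<in> borel_measurable borel"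
        using s0 T0 by (intro C21_measurable_slice[OF u]) auto
      have [measurable]: "B \<in> sets borel" by (rule borel_closed) (rule B)
      show ?thesis unfolding g_def by measurable
    qed
    define Y1 where "Y1 = (\<lambda>w. \<integral>\<^sup>+y. g y * ennreal (heat_kernel (fst w - y) (snd w - s0) powr p) \<partial>lborel)"
    define Y2 where "Y2 = (\<lambda>w. \<integral>\<^sup>+z. F z * ennreal (heat_kernel (fst w - fst z) (snd w - snd z) powr p) \<partial>lborel)"
    have G1: "(\<integral>\<^sup>+y. g y \<partial>lborel) \<le> ennreal CA" unfolding g_def using mass[OF s0(1,3)] .
    have G2: "(\<integral>\<^sup>+z. F z \<partial>lborel) \<le> ennreal CA" unfolding F_def using fmass .
    have ptw: "ennreal (u x t powr p) \<le> ennreal M + ennreal (1 / c3) * (Y1 (x, t) + Y2 (x, t))"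
      if x: "x \<in> B'" and t: "t \<in> {s..T0}" for x t
    proof (cases "u x t \<le> 4 * CB / c0")
      case True
      have "u x t powr p \<le> M" unfolding M_def using True pos[of t x] t s T0 p0 by (intro powr_mono2) auto
      then show ?thesis by (intro add_increasing2) (auto intro: ennreal_leI)
    next
      case False
      then have ub: "u x t > 4 * CB / c0" "u x t > 0" 
        using CB c0 divide_nonneg_pos[of "4 * CB" c0] by linarith+
      \<comment> \<open>Chosen so that the low parts of both terms, 2 \<kappa> CA in total, stay
        below c0 u(x,t) / 2.\<close>
      define \<kappa> where "\<kappa> = c0 * u x t / (4 * (CA + 1))"
      have \<kappa>: "\<kappa> > 0" using c0 CA ub by (simp add: \<kappa>_def)
      have ks: "ennreal (heat_kernel v \<tau>) \<le> ennreal \<kappa> + ennreal (\<kappa> powr (1 - p)) * ennreal (heat_kernel v \<tau> powr p)" for v :: "real^'n" and \<tau>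
        using le_split_powr[OF p(1) \<kappa> heat_kernel_nonneg[of v \<tau>]] \<kappa>
        by (simp add: ennreal_mult[symmetric] ennreal_plus[symmetric] ennreal_leI del: ennreal_plus)
      have X1: "initial_term u B x s0 t
         \<le> ennreal (\<kappa> * CA) + ennreal (\<kappa> powr (1 - p)) * Y1 (x, t)"
      proof -
        have "initial_term u B x s0 t
          = (\<integral>\<^sup>+y. g y * ennreal (heat_kernel (x - y) (t - s0)) \<partial>lborel)"
          by (intro nn_integral_cong) (simp add: g_def ennreal_mult'' heat_kernel_nonneg mult_ac)
        also have "\<dots> \<le> (\<integral>\<^sup>+y. ennreal \<kappa> * g y + ennreal (\<kappa> powr (1 - p)) * (g y * ennreal (heat_kernel (x - y) (t - s0) powr p)) \<partial>lborel)"
          by (intro nn_integral_mono order_trans[OF mult_left_mono[OF ks]]) (simp_all add: algebra_simps)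
        also have "\<dots> = ennreal \<kappa> * (\<integral>\<^sup>+y. g y \<partial>lborel) + ennreal (\<kappa> powr (1 - p)) * Y1 (x, t)"
          unfolding Y1_def by (subst nn_integral_add) (simp_all add: nn_integral_cmult)
        also have "\<dots> \<le> ennreal \<kappa> * ennreal CA + ennreal (\<kappa> powr (1 - p)) * Y1 (x, t)"
          using G1 by (intro add_right_mono mult_left_mono) auto
        finally show ?thesis using \<kappa> CA by (simp add: ennreal_mult)
      qed
      have X2: "source_term u B x s0 t
         \<le> ennreal (\<kappa> * CA) + ennreal (\<kappa> powr (1 - p)) * Y2 (x, t)"
      proof -
        have "source_term u B x s0 t
          \<le> (\<integral>\<^sup>+z. F z * ennreal (heat_kernel (x - fst z) (t - snd z)) \<partial>lborel)"
          using s0 t by (intro nn_integral_mono) (auto simp: F_def ennreal_mult'' heat_kernel_nonneg split: split_indicator)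
        also have "\<dots> \<le> (\<integral>\<^sup>+z. ennreal \<kappa> * F z + ennreal (\<kappa> powr (1 - p)) * (F z * ennreal (heat_kernel (x - fst z) (t - snd z) powr p)) \<partial>lborel)"
          by (intro nn_integral_mono order_trans[OF mult_left_mono[OF ks]]) (simp_all add: algebra_simps)
        also have "\<dots> = ennreal \<kappa> * (\<integral>\<^sup>+z. F z \<partial>lborel) + ennreal (\<kappa> powr (1 - p)) * Y2 (x, t)"
          unfolding Y2_def by (subst nn_integral_add) (simp_all add: nn_integral_cmult)
        also have "\<dots> \<le> ennreal \<kappa> * ennreal CA + ennreal (\<kappa> powr (1 - p)) * Y2 (x, t)"
          using G2 by (intro add_right_mono mult_left_mono) auto
        finally show ?thesis using \<kappa> CA by (simp add: ennreal_mult)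
      qed
      show ?thesis
      proof (cases "Y1 (x, t) + Y2 (x, t) = top")
        case True
        show ?thesis unfolding True using c3 by (simp add: ennreal_mult_top)
      next
        case False
        then obtain Y where Y: "Y1 (x, t) + Y2 (x, t) = ennreal Y" "Y \<ge> 0" by (cases "Y1 (x, t) + Y2 (x, t)") auto
        have "ennreal (c0 * u x t) \<le> (ennreal (\<kappa> * CA) + ennreal (\<kappa> powr (1 - p)) * Y1 (x, t))
            + (ennreal (\<kappa> * CA) + ennreal (\<kappa> powr (1 - p)) * Y2 (x, t)) + ennreal CB"
          using repr[OF x s0(1), of t] t s0 by (intro order_trans[OF _ add_right_mono[OF add_mono[OF X1 X2]]]) auto
        also have "\<dots> = ennreal (\<kappa> * CA + \<kappa> * CA + CB) + ennreal (\<kappa> powr (1 - p)) * (Y1 (x, t) + Y2 (x, t))"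
        proof -
          have "0 \<le> \<kappa> * CA" using \<kappa> CA by simp
          then have "ennreal (\<kappa> * CA + \<kappa> * CA + CB) = ennreal (\<kappa> * CA) + ennreal (\<kappa> * CA) + ennreal CB"
            using ennreal_plus[of "\<kappa> * CA" "\<kappa> * CA"] ennreal_plus[of "\<kappa> * CA + \<kappa> * CA" CB] CB by (simp only: add_nonneg_nonneg)
          then show ?thesis by (simp only: distrib_left add_ac)
        qed
        also have "\<dots> = ennreal (\<kappa> * CA + \<kappa> * CA + CB + \<kappa> powr (1 - p) * Y)"
          using Y \<kappa> CA CB by (simp add: ennreal_mult[symmetric] ennreal_plus[symmetric] del: ennreal_plus)
        finally have le: "c0 * u x t \<le> 2 * (\<kappa> * CA) + CB + \<kappa> powr (1 - p) * Y"
          using Y \<kappa> CA CB by (simp add: ennreal_le_iff mult.commute del: ennreal_plus)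
        have "2 * (\<kappa> * CA) \<le> c0 * u x t / 2"
        proof -
          have "2 * (\<kappa> * CA) \<le> 2 * (\<kappa> * (CA + 1))" using \<kappa> by simp
          also have "\<dots> = c0 * u x t / 2" using CA by (simp add: \<kappa>_def field_simps)
          finally show ?thesis .
        qed
        moreover have "CB \<le> c0 * u x t / 4" using ub c0 by (simp add: field_simps)
        ultimately have "c0 * u x t / 4 \<le> \<kappa> powr (1 - p) * Y" using le by linarith
        then have "\<kappa> powr (p - 1) * (c0 * u x t / 4) \<le> \<kappa> powr (p - 1) * (\<kappa> powr (1 - p) * Y)" by (intro mult_left_mono) auto
        also have "\<dots> = Y" using \<kappa> by (simp add: mult.assoc[symmetric] powr_add[symmetric])
        also have "\<kappa> powr (p - 1) * (c0 * u x t / 4) = c3 * u x t powr p"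
        proof -
          have "\<kappa> powr (p - 1) = (c0 / (4 * (CA + 1))) powr (p - 1) * u x t powr (p - 1)"
            unfolding \<kappa>_def using c0 CA ub by (subst powr_mult[symmetric]) auto
          moreover have "u x t powr (p - 1) * u x t = u x t powr p"
            using ub powr_add[of "u x t" "p - 1" 1] by simp
          ultimately show ?thesis by (simp add: c3_def algebra_simps)
        qed
        finally have "u x t powr p \<le> 1 / c3 * Y" using c3 by (simp add: field_simps)
        then have "ennreal (u x t powr p) \<le> ennreal (1 / c3) * ennreal Y" using Y c3 by (simp add: ennreal_mult[symmetric] ennreal_leI)
        then show ?thesis unfolding Y(1) by (rule add_increasing[rotated]) simp
      qed
    qed
    \<comment> \<open>For a source at positive time, points of \<open>W\<close> have age below T0,
      which is what the kernel estimate requires.\<close>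
    define W where "W = (UNIV :: (real^'n) set) \<times> {..T0}"
    have W[measurable]: "W \<in> sets borel" unfolding W_def by (intro borel_closed closed_Times) auto
    have [measurable]: "Y1 \<in> borel_measurable borel" unfolding Y1_def by measurable
    have [measurable]: "Y2 \<in> borel_measurable borel" unfolding Y2_def by measurable
    have I1: "(\<integral>\<^sup>+w. Y1 w * indicator W w \<partial>lborel) \<le> ennreal (CA * K)"
    proof -
      have "(\<integral>\<^sup>+w. Y1 w * indicator W w \<partial>lborel)
        = (\<integral>\<^sup>+w. \<integral>\<^sup>+y. g y * ennreal (heat_kernel (fst w - y) (snd w - s0) powr p) * indicator W w \<partial>lborel \<partial>lborel)"
        unfolding Y1_def by (intro nn_integral_cong nn_integral_multc[symmetric]) measurable
      also have "\<dots> = (\<integral>\<^sup>+y. \<integral>\<^sup>+w. g y * ennreal (heat_kernel (fst w - y) (snd w - s0) powr p) * indicator W w \<partial>lborel \<partial>lborel)"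
        by (rule lborel_pair.Fubini') measurable
      also have "\<dots> \<le> (\<integral>\<^sup>+y. g y * ennreal K \<partial>lborel)"
      proof (rule nn_integral_mono)
        fix y
        have "(\<integral>\<^sup>+w. g y * ennreal (heat_kernel (fst w - y) (snd w - s0) powr p) * indicator W w \<partial>lborel)
          = g y * (\<integral>\<^sup>+w. ennreal (heat_kernel (fst w - y) (snd w - s0) powr p) * indicator W w \<partial>lborel)"
          unfolding mult.assoc by (rule nn_integral_cmult) measurable
        also have "\<dots> \<le> g y * (\<integral>\<^sup>+w. ennreal (heat_kernel (fst w - y) (snd w - s0) powr p) * indicator (UNIV \<times> {..s0 + T0}) w \<partial>lborel)"
          using s0 by (intro mult_left_mono nn_integral_mono) (auto simp: W_def split: split_indicator)
        also have "\<dots> \<le> g y * ennreal K" by (intro mult_left_mono K) simp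
        finally show "(\<integral>\<^sup>+w. g y * ennreal (heat_kernel (fst w - y) (snd w - s0) powr p) * indicator W w \<partial>lborel) \<le> g y * ennreal K" .
      qed
      also have "\<dots> = (\<integral>\<^sup>+y. g y \<partial>lborel) * ennreal K" by (rule nn_integral_multc) simp
      also have "\<dots> \<le> ennreal CA * ennreal K" using G1 by (rule mult_right_mono) simp
      finally show ?thesis using CA K(1) by (simp add: ennreal_mult)
    qed
    have I2: "(\<integral>\<^sup>+w. Y2 w * indicator W w \<partial>lborel) \<le> ennreal (CA * K)"
    proof -
      have "(\<integral>\<^sup>+w. Y2 w * indicator W w \<partial>lborel)
        = (\<integral>\<^sup>+w. \<integral>\<^sup>+z. F z * ennreal (heat_kernel (fst w - fst z) (snd w - snd z) powr p) * indicator W w \<partial>lborel \<partial>lborel)"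
        unfolding Y2_def by (intro nn_integral_cong nn_integral_multc[symmetric]) measurable
      also have "\<dots> = (\<integral>\<^sup>+z. \<integral>\<^sup>+w. F z * ennreal (heat_kernel (fst w - fst z) (snd w - snd z) powr p) * indicator W w \<partial>lborel \<partial>lborel)"
        by (rule lborel_pair.Fubini') measurable
      also have "\<dots> \<le> (\<integral>\<^sup>+z. F z * ennreal K \<partial>lborel)"
      proof (rule nn_integral_mono)
        fix z
        have "(\<integral>\<^sup>+w. F z * ennreal (heat_kernel (fst w - fst z) (snd w - snd z) powr p) * indicator W w \<partial>lborel)
          = F z * (\<integral>\<^sup>+w. ennreal (heat_kernel (fst w - fst z) (snd w - snd z) powr p) * indicator W w \<partial>lborel)"
          unfolding mult.assoc by (rule nn_integral_cmult) measurable
        also have "\<dots> \<le> F z * ennreal K"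
        proof (cases "snd z > 0")
          case True
          have "(\<integral>\<^sup>+w. ennreal (heat_kernel (fst w - fst z) (snd w - snd z) powr p) * indicator W w \<partial>lborel)
            \<le> (\<integral>\<^sup>+w. ennreal (heat_kernel (fst w - fst z) (snd w - snd z) powr p) * indicator (UNIV \<times> {..snd z + T0}) w \<partial>lborel)"
            using True by (intro nn_integral_mono) (auto simp: W_def split: split_indicator)
          also have "\<dots> \<le> ennreal K" by (rule K)
          finally show ?thesis by (intro mult_left_mono) auto
        next
          case False
          then have "F z = 0" by (auto simp: F_def split: split_indicator)
          then show ?thesis by simp
        qed
        finally show "(\<integral>\<^sup>+w. F z * ennreal (heat_kernel (fst w - fst z) (snd w - snd z) powr p) * indicator W w \<partial>lborel) \<le> F z * ennreal K" .
      qed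
      also have "\<dots> = (\<integral>\<^sup>+z. F z \<partial>lborel) * ennreal K" by (rule nn_integral_multc) simp
      also have "\<dots> \<le> ennreal CA * ennreal K" using G2 by (rule mult_right_mono) simp
      finally show ?thesis using CA K(1) by (simp add: ennreal_mult)
    qed
    have "(\<integral>\<^sup>+z. ennreal (u (fst z) (snd z) powr p) * indicator (B' \<times> {s..T0}) z \<partial>lborel)
      \<le> (\<integral>\<^sup>+w. ennreal M * indicator (B' \<times> {0<..T0}) w + ennreal (1 / c3) * (Y1 w * indicator W w + Y2 w * indicator W w) \<partial>lborel)"
    proof (rule nn_integral_mono)
      fix z :: "(real^'n) \<times> real"
      show "ennreal (u (fst z) (snd z) powr p) * indicator (B' \<times> {s..T0}) z
        \<le> ennreal M * indicator (B' \<times> {0<..T0}) z + ennreal (1 / c3) * (Y1 z * indicator W z + Y2 z * indicator W z)"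
        using ptw[of "fst z" "snd z"] s by (cases "z \<in> B' \<times> {s..T0}") (auto simp: W_def)
    qed
    also have "\<dots> = ennreal M * emeasure lborel (B' \<times> {0<..T0}) + ennreal (1 / c3) * ((\<integral>\<^sup>+w. Y1 w * indicator W w \<partial>lborel) + (\<integral>\<^sup>+w. Y2 w * indicator W w \<partial>lborel))"
      using B's by (simp add: nn_integral_add nn_integral_cmult)
    also have "\<dots> \<le> ennreal M * ennreal V + ennreal (1 / c3) * (ennreal (CA * K) + ennreal (CA * K))"
      unfolding V by (intro add_mono mult_left_mono I1 I2) auto
    also have "\<dots> = ennreal Cp"
    proof -
      have a: "0 \<le> CA * K" "0 \<le> M * V" "0 \<le> 1 / c3" using M0 c3 CA K(1) by (auto simp: V_def)
      have "ennreal (CA * K) + ennreal (CA * K) = ennreal (2 * (CA * K))"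
        unfolding mult_2 by (rule ennreal_plus[OF a(1) a(1), symmetric])
      moreover have "ennreal M * ennreal V = ennreal (M * V)" using M0 by (simp add: ennreal_mult V_def)
      moreover have "ennreal (1 / c3) * ennreal (2 * (CA * K)) = ennreal (1 / c3 * (2 * (CA * K)))"
        using a by (intro ennreal_mult[symmetric]) auto
      ultimately show ?thesis unfolding Cp_def using a by (subst ennreal_plus) auto
    qed
    finally show "(\<integral>\<^sup>+z. ennreal (u (fst z) (snd z) powr p) * indicator (B' \<times> {s..T0}) z \<partial>lborel) \<le> ennreal Cp" .
  qed
  ultimately show thesis by (rule that)
qed

text \<open>Young's inequality with its weights 1 - \<theta> and \<theta> bounded by 1.\<close>

lemma mult_le_powr_add:
  fixes a b \<theta> :: real
  assumes "a \<ge> 0" "b \<ge> 0" "0 < \<theta>" "\<theta> < 1"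
  shows "a * b \<le> a powr (1 / (1 - \<theta>)) + b powr (1 / \<theta>)"
proof -
  have "a * b \<le> a powr (1 / (1 - \<theta>)) / (1 / (1 - \<theta>)) + b powr (1 / \<theta>) / (1 / \<theta>)"
    using assms by (intro Youngs_inequality) (auto simp: field_simps)
  also have "\<dots> = (1 - \<theta>) * a powr (1 / (1 - \<theta>)) + \<theta> * b powr (1 / \<theta>)" by simp
  also have "\<dots> \<le> 1 * a powr (1 / (1 - \<theta>)) + 1 * b powr (1 / \<theta>)"
    using assms by (intro add_mono mult_right_mono) auto
  finally show ?thesis by simp
qed

text \<open>Inside the ball, Young's inequality separates kernel and solution into two integrable
  powers; outside, the kernel is bounded because the distance to x is at least \<rho>/2, and the
  global integrability of u^lam takes over.\<close>

lemma nonlocal_bounded: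
  fixes u :: "real^'n \<Rightarrow> real \<Rightarrow> real"
  assumes u: "C21 T u" and pos: "\<And>y s. s \<in> {0<..<T} \<Longrightarrow> 0 \<le> u y s"
    and T0: "0 < T0" "T0 < T" and \<rho>: "\<rho> > 0"
    and \<alpha>: "0 < \<alpha>" "\<alpha> < real CARD('n) + 2"
    and lam: "0 < lam" "lam < (real CARD('n) + 2 - \<alpha>) / real CARD('n)"
    and Lp: "\<And>p. 1 \<le> p \<Longrightarrow> p < (real CARD('n) + 2) / real CARD('n) \<Longrightarrow>
       \<exists>Cp\<ge>0. (\<integral>\<^sup>+z. ennreal (u (fst z) (snd z) powr p) * indicator (cball x0 \<rho> \<times> {0<..T0}) z \<partial>lborel) \<le> ennreal Cp"
    and Ll: "set_integrable lborel (UNIV \<times> {0<..<T}) (\<lambda>z. \<bar>u (fst z) (snd z)\<bar> powr lam)"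
  obtains CI where "CI \<ge> 0"
    "\<And>x t. x \<in> cball x0 (\<rho>/2) \<Longrightarrow> 0 < t \<Longrightarrow> t \<le> T0 \<Longrightarrow> nonlocal T \<alpha> lam u x t \<le> ennreal CI"
proof -
  let ?n = "real CARD('n)"
  have n: "?n > 0" by simp
  \<comment> \<open>Young's inequality turns the kernel exponent \<alpha>/n into \<alpha>/n times p
    / (p - lam), which for p > lam is below (n+2)/n exactly if p > \<open>l\<close>. The range of
    lam gives \<open>l\<close> < (n+2)/n and so leaves room for p.\<close>
  define l where "l = lam * (?n + 2) / (?n + 2 - \<alpha>)"
  have ll: "l < (?n + 2) / ?n" "lam < l"
  proof -
    have h: "lam * ?n < ?n + 2 - \<alpha>" using lam(2) n by (simp add: pos_less_divide_eq)
    have "l * ?n = lam * ?n * ((?n + 2) / (?n + 2 - \<alpha>))" by (simp add: l_def)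
    also have "\<dots> < (?n + 2 - \<alpha>) * ((?n + 2) / (?n + 2 - \<alpha>))" using h \<alpha> by (intro mult_strict_right_mono) auto
    also have "\<dots> = ?n + 2" using \<alpha> by simp
    finally show "l < (?n + 2) / ?n" by (simp add: pos_less_divide_eq)
    have "1 < (?n + 2) / (?n + 2 - \<alpha>)" using \<alpha> by simp
    then have "lam * 1 < lam * ((?n + 2) / (?n + 2 - \<alpha>))" using lam by (intro mult_strict_left_mono) auto
    then show "lam < l" by (simp add: l_def)
  qed
  define m where "m = (?n + 2) / ?n"
  define p where "p = (max 1 l + m) / 2"
  have n1: "1 < (?n + 2) / ?n" using n by (simp add: field_simps)
  have p: "1 \<le> p" "p < (?n + 2) / ?n" "l < p" "lam < p"
    using ll n1 unfolding p_def m_def[symmetric] by (auto simp: max_def)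
  define \<theta> where "\<theta> = lam / p"
  have \<theta>: "0 < \<theta>" "\<theta> < 1" using p lam by (auto simp: \<theta>_def)
  define q where "q = \<alpha> / ?n * (1 / (1 - \<theta>))"
  have q: "0 < q" "q < (?n + 2) / ?n"
  proof -
    show "0 < q" using \<alpha> n \<theta> by (simp add: q_def)
    have "lam * (?n + 2) < p * (?n + 2 - \<alpha>)" using p(3) \<alpha> by (simp add: l_def field_simps)
    then have "\<alpha> * p < (?n + 2) * (p - lam)" by (simp add: algebra_simps)
    then have "\<alpha> < (?n + 2) * (1 - \<theta>)" using p by (simp add: \<theta>_def field_simps)
    then have "\<alpha> / (1 - \<theta>) < ?n + 2" using \<theta> by (simp add: field_simps)
    then have "\<alpha> / (1 - \<theta>) / ?n < (?n + 2) / ?n" using n by (intro divide_strict_right_mono)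
    then show "q < (?n + 2) / ?n" by (simp add: q_def mult.commute)
  qed
  obtain K where K: "K \<ge> 0"
    "\<And>(y::real^'n) s. (\<integral>\<^sup>+z. ennreal (heat_kernel (fst z - y) (snd z - s) powr q) * indicator (UNIV \<times> {..s + T0}) z \<partial>lborel) \<le> ennreal K"
    "\<And>(y::real^'n) s. (\<integral>\<^sup>+z. ennreal (heat_kernel (y - fst z) (s - snd z) powr q) * indicator (UNIV \<times> {s - T0..}) z \<partial>lborel) \<le> ennreal K"
    by (rule heat_kernel_powr_space_time[OF q T0(1)], rule that)
  obtain Cp where Cp: "Cp \<ge> 0"
    "(\<integral>\<^sup>+z. ennreal (u (fst z) (snd z) powr p) * indicator (cball x0 \<rho> \<times> {0<..T0}) z \<partial>lborel) \<le> ennreal Cp"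
    using Lp[OF p(1,2)] by blast
  define w where "w = (\<lambda>z. indicator (UNIV \<times> {0<..<T}) z *\<^sub>R \<bar>u (fst z) (snd z)\<bar> powr lam)"
  have wi: "integrable lborel w" using Ll unfolding set_integrable_def w_def .
  have w0: "0 \<le> w z" for z by (simp add: w_def)
  define U where "U = integral\<^sup>L lborel w"
  have U0: "U \<ge> 0" unfolding U_def by (rule integral_nonneg_AE) (simp add: w0)
  have U: "(\<integral>\<^sup>+z. ennreal (w z) \<partial>lborel) = ennreal U"
    unfolding U_def by (rule nn_integral_eq_integral[OF wi]) (simp add: w0)
  \<comment> \<open>Bounds the kernel power at distance at least \<rho>/2, at all times.\<close>
  define D where "D = ((2 * ?n) powr (?n / 2) * (\<rho>/2) powr (- ?n)) powr (\<alpha> / ?n)"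
  have D0: "D \<ge> 0" by (simp add: D_def)
  define CI where "CI = K + Cp + D * U"
  have "CI \<ge> 0" using K(1) Cp(1) D0 U0 by (simp add: CI_def)
  moreover have "nonlocal T \<alpha> lam u x t \<le> ennreal CI" if x: "x \<in> cball x0 (\<rho>/2)" and t: "0 < t" "t \<le> T0" for x t
  proof -
    define g1 where "g1 = (\<lambda>z. ennreal (heat_kernel (x - fst z) (t - snd z) powr q) * indicator (UNIV \<times> {t - T0..}) z)"
    define g2 where "g2 = (\<lambda>z. ennreal (u (fst z) (snd z) powr p) * indicator (cball x0 \<rho> \<times> {0<..T0}) z)"
    define g3 where "g3 = (\<lambda>z. ennreal D * ennreal (w z))"
    have g1m: "g1 \<in> borel_measurable lborel"
    proof -
      note [measurable (raw)] = borel_measurable_fst_snd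
      have [measurable]: "(UNIV :: (real^'n) set) \<times> {t - T0..} \<in> sets borel" by (intro borel_closed closed_Times) auto
      show ?thesis unfolding g1_def by measurable
    qed
    have g2m: "g2 \<in> borel_measurable lborel"
    proof -
      have S: "cball x0 \<rho> \<times> {0<..T0} \<in> sets borel"
        by (rule closed_times_Ioc_sets) simp
      have um: "(\<lambda>z. indicator (cball x0 \<rho> \<times> {0<..T0}) z *\<^sub>R u (fst z) (snd z)) \<in> borel_measurable borel"
        using T0 by (intro C21_measurable(2)[OF u S]) auto
      have "(\<lambda>z. ennreal ((indicator (cball x0 \<rho> \<times> {0<..T0}) z *\<^sub>R u (fst z) (snd z)) powr p)) \<in> borel_measurable borel"
        using um by measurable
      also have "(\<lambda>z. ennreal ((indicator (cball x0 \<rho> \<times> {0<..T0}) z *\<^sub>R u (fst z) (snd z)) powr p)) = g2"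
        using p by (auto simp: g2_def split: split_indicator)
      finally show ?thesis by simp
    qed
    have g3m: "g3 \<in> borel_measurable lborel"
      unfolding g3_def using borel_measurable_integrable[OF wi] by measurable
    have "nonlocal T \<alpha> lam u x t \<le> (\<integral>\<^sup>+z. g1 z + g2 z + g3 z \<partial>lborel)"
      unfolding nonlocal_def
    proof (rule nn_integral_mono)
      fix z :: "(real^'n) \<times> real"
      obtain y s where z: "z = (y, s)" by (cases z)
      show "indicator (UNIV \<times> {0<..<T}) z * ennreal (heat_kernel (x - fst z) (t - snd z) powr (\<alpha> / ?n) * u (fst z) (snd z) powr lam)
         \<le> g1 z + g2 z + g3 z"
      proof (cases "0 < s \<and> s < t")
        case False
        then have "indicator (UNIV \<times> {0<..<T}) z * ennreal (heat_kernel (x - fst z) (t - snd z) powr (\<alpha> / ?n) * u (fst z) (snd z) powr lam) = 0"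
          by (auto simp: z heat_kernel_def split: split_indicator)
        then show ?thesis by (simp only: zero_le)
      next
        case True
        then have s: "s \<in> {0<..<T}" "s \<le> T0" "t - T0 \<le> s" using t T0 by auto
        have u0: "0 \<le> u y s" by (rule pos[OF s(1)])
        show ?thesis
        proof (cases "y \<in> cball x0 \<rho>")
          case yB: True
          have "heat_kernel (x - y) (t - s) powr (\<alpha> / ?n) * u y s powr lam
            \<le> (heat_kernel (x - y) (t - s) powr (\<alpha> / ?n)) powr (1 / (1 - \<theta>)) + (u y s powr lam) powr (1 / \<theta>)"
            using \<theta> by (intro mult_le_powr_add) auto
          also have "\<dots> = heat_kernel (x - y) (t - s) powr q + u y s powr p"
            using lam p by (simp add: powr_powr q_def \<theta>_def)
          finally have "ennreal (heat_kernel (x - y) (t - s) powr (\<alpha> / ?n) * u y s powr lam) \<le> g1 z + g2 z"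
            using s True yB by (simp add: g1_def g2_def z ennreal_plus[symmetric] ennreal_leI del: ennreal_plus)
          then show ?thesis using s by (simp add: z add_increasing2)
        next
          case yB: False
          have d: "\<rho>/2 \<le> norm (x - y)"
            using yB x dist_triangle[of x0 y x] by (simp add: dist_norm norm_minus_commute)
          have "x - y \<noteq> 0" using d \<rho> by auto
          from heat_kernel_le_norm[OF this, of "t - s"] True
          have "heat_kernel (x - y) (t - s) \<le> (2 * ?n) powr (?n / 2) * norm (x - y) powr (- ?n)" by simp
          also have "\<dots> \<le> (2 * ?n) powr (?n / 2) * (\<rho>/2) powr (- ?n)"
            using d \<rho> by (intro mult_left_mono powr_mono2') auto
          finally have "heat_kernel (x - y) (t - s) powr (\<alpha> / ?n) \<le> D"
            unfolding D_def using \<alpha> by (intro powr_mono2 heat_kernel_nonneg) auto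
          then have "heat_kernel (x - y) (t - s) powr (\<alpha> / ?n) * u y s powr lam \<le> D * u y s powr lam"
            by (intro mult_right_mono) auto
          then have "ennreal (heat_kernel (x - y) (t - s) powr (\<alpha> / ?n) * u y s powr lam) \<le> g3 z"
            using s u0 D0 by (simp add: g3_def w_def z ennreal_mult[symmetric] ennreal_leI)
          then show ?thesis using s by (simp add: z add_increasing)
        qed
      qed
    qed
    also have "\<dots> = (\<integral>\<^sup>+z. g1 z \<partial>lborel) + (\<integral>\<^sup>+z. g2 z \<partial>lborel) + (\<integral>\<^sup>+z. g3 z \<partial>lborel)"
      using g1m g2m g3m by (simp add: nn_integral_add)
    also have "(\<integral>\<^sup>+z. g3 z \<partial>lborel) = ennreal (D * U)"
      unfolding g3_def using borel_measurable_integrable[OF wi] D0 U0 by (simp add: nn_integral_cmult U ennreal_mult)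
    also have "(\<integral>\<^sup>+z. g1 z \<partial>lborel) + (\<integral>\<^sup>+z. g2 z \<partial>lborel) + ennreal (D * U) \<le> ennreal K + ennreal Cp + ennreal (D * U)"
      unfolding g1_def g2_def by (intro add_mono K(3) Cp(2)) simp
    also have "\<dots> = ennreal CI"
      unfolding CI_def using K(1) Cp(1) D0 U0 by (simp add: ennreal_plus)
    finally show ?thesis .
  qed
  ultimately show thesis by (rule that)
qed

text \<open>The slabs decrease to the empty set because time 0 is excluded; dominated convergence
  applies with F itself as the majorant.\<close>

lemma nn_integral_small_time:
  fixes F :: "'a::euclidean_space \<times> real \<Rightarrow> ennreal"
  assumes F: "F \<in> borel_measurable borel" "(\<integral>\<^sup>+z. F z \<partial>lborel) < \<infinity>" and \<epsilon>: "\<epsilon> > 0" and T0: "T0 > 0"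
  obtains T1 where "0 < T1" "T1 \<le> T0" "(\<integral>\<^sup>+z. F z * indicator (UNIV \<times> {0<..T1}) z \<partial>lborel) < ennreal \<epsilon>"
proof -
  define S where "S = (\<lambda>k::nat. (UNIV::'a set) \<times> {0<..T0 / (real k + 1)})"
  have S: "S k \<in> sets borel" for k
    unfolding S_def borel_prod[symmetric] by (rule pair_measureI) auto
  have "(\<lambda>k. \<integral>\<^sup>+z. F z * indicator (S k) z \<partial>lborel) \<longlonglongrightarrow> (\<integral>\<^sup>+(z::'a \<times> real). 0 \<partial>lborel)"
  proof (rule nn_integral_dominated_convergence[where w = F])
    show "(\<lambda>z. F z * indicator (S k) z) \<in> borel_measurable lborel" for k using F S by simp
    show "AE z in lborel. (\<lambda>k. F z * indicator (S k) z) \<longlonglongrightarrow> 0"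
    proof (rule AE_I2)
      fix z :: "'a \<times> real"
      have "eventually (\<lambda>k. F z * indicator (S k) z = 0) sequentially"
      proof (cases "snd z > 0")
        case True
        obtain k0 :: nat where k0: "T0 / snd z < real k0" using reals_Archimedean2 by blast
        show ?thesis
        proof (rule eventually_sequentiallyI[of k0])
          fix k assume "k0 \<le> k"
          then have "T0 / snd z < real k + 1" using k0 by linarith
          then have "T0 / (real k + 1) < snd z" using True by (simp add: field_simps)
          then have "z \<notin> S k" by (auto simp: S_def)
          then show "F z * indicator (S k) z = 0" by simp
        qed
      qed (cases z, auto simp: S_def)
      then show "(\<lambda>k. F z * indicator (S k) z) \<longlonglongrightarrow> 0" by (rule tendsto_eventually)
    qed
  qed (use F in \<open>auto split: split_indicator\<close>)
  then have "(\<lambda>k. \<integral>\<^sup>+z. F z * indicator (S k) z \<partial>lborel) \<longlonglongrightarrow> 0" by simp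
  from order_tendstoD(2)[OF this, of "ennreal \<epsilon>"] \<epsilon>
  obtain k where "(\<integral>\<^sup>+z. F z * indicator (S k) z \<partial>lborel) < ennreal \<epsilon>"
    by (auto simp: eventually_sequentially)
  moreover have "0 < T0 / (real k + 1)" "T0 / (real k + 1) \<le> T0" using T0 by (auto simp: field_simps)
  ultimately show thesis using that[of "T0 / (real k + 1)"] unfolding S_def by blast
qed

section \<open>The pointwise bound\<close>

lemma powr_neg_half_square:
  fixes d :: real
  assumes "d > 0"
  shows "(d\<^sup>2) powr (- real n / 2) = 1 / d ^ n"
proof -
  have "(d\<^sup>2) powr (- real n / 2) = (d powr 2) powr (- real n / 2)" using assms by (simp add: powr_numeral)
  also have "\<dots> = d powr (- real n)" by (simp add: powr_powr)
  also have "\<dots> = 1 / d ^ n" using assms by (simp add: powr_minus powr_realpow field_simps)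
  finally show ?thesis .
qed

text \<open>At the maximum point (y0, t0) of u d^n let A be the maximum and M = u(y0, t0), so that
  d^(-n) = M / A. In Duhamel's bound the initial term and the kernel at distance d/2 cost a multiple
  of M / A, the source of age at least \<delta> M^(-2/n) costs \<epsilon> times a multiple of M, and
  the recent nearby source a multiple of \<delta> M. With suitable constants, large A leaves only M
  \<le> 2 CB / c0.\<close>

lemma supersolution_pointwise:
  fixes u :: "real^'n \<Rightarrow> real \<Rightarrow> real"
  assumes u: "C21 T u" and pos: "\<And>y s. s \<in> {0<..<T} \<Longrightarrow> 0 \<le> u y s"
    and sup: "\<And>y s. y \<in> B \<Longrightarrow> s \<in> {0<..<T} \<Longrightarrow> 0 \<le> heat_op u y s"
    and T0: "0 < T0" "T0 < T" and CA: "CA \<ge> 0" and B: "closed B"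
    and mass: "\<And>s. 0 < s \<Longrightarrow> s \<le> T0 \<Longrightarrow> local_mass u B s \<le> ennreal CA"
    and fmass: "source_mass u (B \<times> {0<..T0}) \<le> ennreal CA"
    and c0: "c0 > 0" and CB: "CB \<ge> 0" and r: "r > 0"
    and repr: "\<And>x t s0. x \<in> cball x0 r \<Longrightarrow> 0 < s0 \<Longrightarrow> s0 < t \<Longrightarrow> t \<le> T0 \<Longrightarrow>
      ennreal (c0 * u x t) \<le> initial_term u B x s0 t
       + source_term u B x s0 t + ennreal CB"
    and CI: "CI \<ge> 0"
    and f: "\<And>x t. x \<in> cball x0 r \<Longrightarrow> 0 < t \<Longrightarrow> t \<le> T0 \<Longrightarrow> heat_op u x t \<le> CI * u x t powr ((real CARD('n) + 2) / real CARD('n))"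
  obtains C T1 where "C \<ge> 0" "T1 > 0" "T1 < T"
    "\<And>x t. x \<in> cball x0 (r/2) \<Longrightarrow> 0 < t \<Longrightarrow> t \<le> T1 \<Longrightarrow> u x t \<le> C * t powr (- real CARD('n) / 2)"
proof -
  let ?n = "real CARD('n)"
  let ?N = "CARD('n)"
  have n: "?n > 0" by simp
  \<comment> \<open>Makes the recent part of the source cost at most c0 M / 8; the power of 2 is
    (2^n)^((n+2)/n).\<close>
  define \<delta> where "\<delta> = c0 / (8 * ((CI + 1) * 2 ^ (?N + 2)))"
  have \<delta>: "\<delta> > 0" using c0 CI by (simp add: \<delta>_def)
  \<comment> \<open>Balances the height \<delta>^(-n/2) M of the kernel at age \<delta> M^(-2/n), so
    that the older source also costs at most c0 M / 8.\<close>
  define \<epsilon> where "\<epsilon> = c0 / 8 * \<delta> powr (?n / 2)"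
  have \<epsilon>: "\<epsilon> > 0" using c0 \<delta> by (simp add: \<epsilon>_def)
  define Cn where "Cn = (2 * ?n) powr (?n / 2)"
  have Cn: "Cn \<ge> 0" by (simp add: Cn_def)
  \<comment> \<open>For A above this value the terms carrying the factor M / A sum up to at most c0
    M / 8.\<close>
  define A0 where "A0 = 8 * 2 ^ ?N * (CA + \<epsilon> * Cn) / c0 + 1"
  have A0: "A0 > 0" using c0 CA \<epsilon> Cn by (auto simp: A0_def intro!: add_nonneg_pos divide_nonneg_pos)
  \<comment> \<open>The second entry is what M \<le> 2 CB / c0 allows for A, since d \<le>
    r.\<close>
  define Am where "Am = max A0 (2 * CB / c0 * r ^ ?N)"
  have Am: "Am > 0" using A0 by (simp add: Am_def)
  define F where "F = (\<lambda>z. ennreal (heat_op u (fst z) (snd z)) * indicator (B \<times> {0<..T0}) z)"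
  have F[measurable]: "F \<in> borel_measurable borel"
    unfolding F_def using T0 by (intro C21_measurable(1)[OF u] closed_times_Ioc_sets B) auto
  have "(\<integral>\<^sup>+z. F z \<partial>lborel) < \<infinity>" using fmass unfolding F_def by (rule le_less_trans) simp
  then obtain T1 where T1: "0 < T1" "T1 \<le> T0" "(\<integral>\<^sup>+z. F z * indicator (UNIV \<times> {0<..T1}) z \<partial>lborel) < ennreal \<epsilon>"
    using nn_integral_small_time[OF F _ \<epsilon> T0(1)] by blast
  define F1 where "F1 = (\<lambda>z. F z * indicator (UNIV \<times> {0<..T1}) z)"
  have F1m[measurable]: "F1 \<in> borel_measurable borel"
  proof -
    have [measurable]: "(UNIV::(real^'n) set) \<times> {0<..T1} \<in> sets borel"
      unfolding borel_prod[symmetric] by (rule pair_measureI) auto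
    show ?thesis unfolding F1_def by measurable
  qed
  have F1: "(\<integral>\<^sup>+z. F1 z \<partial>lborel) \<le> ennreal \<epsilon>" using T1(3) unfolding F1_def by simp

  \<comment> \<open>The time origin is moved to \<tau> > 0 so that the maximum is taken over a
    compact set on which u is continuous; \<open>Am\<close> does not depend on \<tau>.\<close>
  have bound: "u x t * (min (sqrt (t - \<tau>)) (r - dist x x0)) ^ ?N \<le> Am"
    if \<tau>: "0 < \<tau>" "\<tau> < T1" and xt: "x \<in> cball x0 r" "\<tau> \<le> t" "t \<le> T1" for x t \<tau>
  proof -
    define dd where "dd = (\<lambda>z. min (sqrt (snd z - \<tau>)) (r - dist (fst z) x0))"
    define S where "S = cball x0 r \<times> {\<tau>..T1}"
    have cS: "compact S" unfolding S_def by (intro compact_Times) auto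
    have dd0: "0 \<le> dd z" if "z \<in> S" for z using that by (auto simp: dd_def S_def dist_commute)
    have cont: "continuous_on S (\<lambda>z. u (fst z) (snd z) * dd z ^ ?N)"
    proof (rule continuous_on_mult)
      show "continuous_on S (\<lambda>z. u (fst z) (snd z))"
        using C21_continuous(1)[OF u] \<tau> T1 T0 by (auto simp: split_beta S_def intro: continuous_on_subset)
      show "continuous_on S (\<lambda>z. dd z ^ ?N)" unfolding dd_def by (intro continuous_intros)
    qed
    have "(x, t) \<in> S" using xt by (simp add: S_def)
    then have "S \<noteq> {}" by blast
    from continuous_attains_sup[OF cS this cont] obtain z0 where z0: "z0 \<in> S"
      "\<And>z. z \<in> S \<Longrightarrow> u (fst z) (snd z) * dd z ^ ?N \<le> u (fst z0) (snd z0) * dd z0 ^ ?N" by blast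
    obtain y0 t0 where yt: "z0 = (y0, t0)" by (cases z0)
    have y0: "y0 \<in> cball x0 r" "\<tau> \<le> t0" "t0 \<le> T1" using z0(1) by (auto simp: yt S_def)
    define M where "M = u y0 t0"
    define d where "d = dd z0"
    define A where "A = M * d ^ ?N"
    have Amax: "u y s * dd (y, s) ^ ?N \<le> A" if "(y, s) \<in> S" for y s
      using z0(2)[OF that] by (simp add: A_def M_def d_def yt)
    have "A \<le> Am"
    proof (rule ccontr)
      assume nA: "\<not> A \<le> Am"
      then have AA0: "A > A0" "A > 0" using A0 by (auto simp: Am_def)
      have d0: "d \<ge> 0" using dd0[OF z0(1)] by (simp add: d_def)
      have d: "d > 0" using AA0 d0 by (cases "d = 0") (auto simp: A_def power_0_left)
      have M: "M > 0" using AA0 d by (simp add: A_def zero_less_mult_iff)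
      have dt': "d \<le> sqrt (t0 - \<tau>)" "d \<le> r - dist y0 x0"
        by (auto simp: d_def dd_def yt)
      then have dt: "d \<le> sqrt (t0 - \<tau>)" "d \<le> r - dist y0 x0" "d \<le> r"
        using zero_le_dist[of y0 x0] by linarith+
      have d2: "d\<^sup>2 \<le> t0 - \<tau>"
      proof -
        have "d\<^sup>2 \<le> (sqrt (t0 - \<tau>))\<^sup>2" using dt d by (intro power_mono) auto
        then show ?thesis using y0 by simp
      qed
      define s0 where "s0 = t0 - (d/2)\<^sup>2"
      have s0: "\<tau> \<le> s0" "s0 < t0" "0 < s0" "t0 - s0 = (d/2)\<^sup>2"
      proof -
        have "(d/2)\<^sup>2 \<le> d\<^sup>2" "0 < (d/2)\<^sup>2" using d by (auto simp: power_divide)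
        with d2 \<tau> show "\<tau> \<le> s0" "s0 < t0" "0 < s0" "t0 - s0 = (d/2)\<^sup>2" unfolding s0_def by linarith+
      qed
      \<comment> \<open>On the half-size backward cylinder the distance function is at least d/2,
        and maximality gives the factor 2^n.\<close>
      have cyl: "u y s \<le> 2 ^ ?N * M" if "dist y y0 < d/2" "s0 \<le> s" "s \<le> t0" for y s
      proof -
        have ds: "d/2 \<le> sqrt (s - \<tau>)"
        proof (rule real_le_rsqrt)
          have "(d/2)\<^sup>2 \<le> d\<^sup>2 - (d/2)\<^sup>2" using zero_le_power2[of d] by (simp add: power_divide)
          also have "\<dots> \<le> s - \<tau>" using d2 that by (simp add: s0_def)
          finally show "(d/2)\<^sup>2 \<le> s - \<tau>" .
        qed
        have dy: "d/2 \<le> r - dist y x0" using dt that dist_triangle[of y x0 y0] by simp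
        have inS: "(y, s) \<in> S" using that s0 y0 dy d by (auto simp: S_def dist_commute)
        have "(d/2) ^ ?N \<le> dd (y, s) ^ ?N" using ds dy d by (intro power_mono) (auto simp: dd_def)
        moreover have "0 \<le> u y s" using that s0 \<tau> y0 T1 T0 by (intro pos) auto
        ultimately have "u y s * (d/2) ^ ?N \<le> u y s * dd (y, s) ^ ?N" by (intro mult_left_mono)
        also have "\<dots> \<le> M * d ^ ?N" using Amax[OF inS] by (simp add: A_def)
        finally show ?thesis using d by (simp add: power_divide field_simps)
      qed
      \<comment> \<open>M^(-2/n) is the age at which the kernel has height of order M; on this time
        scale the surplus M^(2/n) of the critical power is compensated exactly.\<close>
      define \<delta>' where "\<delta>' = \<delta> * M powr (- 2 / ?n)"
      have \<delta>': "\<delta>' > 0" using \<delta> M by (simp add: \<delta>'_def)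
      have MA: "1 / d ^ ?N = M / A" using M d by (simp add: A_def)
      have pd: "((d/2)\<^sup>2) powr (- ?n / 2) = 2 ^ ?N * (M / A)"
      proof -
        have "((d/2)\<^sup>2) powr (- ?n / 2) = 1 / (d/2) ^ ?N" using powr_neg_half_square[of "d/2" ?N] d by simp
        also have "\<dots> = 2 ^ ?N * (1 / d ^ ?N)" by (simp add: power_divide)
        finally show ?thesis unfolding MA .
      qed
      have p\<delta>: "\<delta>' powr (- ?n / 2) = \<delta> powr (- ?n / 2) * M"
        using \<delta> M n by (simp add: \<delta>'_def powr_mult powr_powr)
      \<comment> \<open>\<open>k1\<close> bounds the kernel outside the recent nearby region,
        through its age or through the distance d/2; \<open>k2\<close> bounds the source inside that
        region.\<close>
      define k1 where "k1 = \<delta> powr (- ?n / 2) * M + Cn * (2 ^ ?N * (M / A))"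
      define k2 where "k2 = CI * (2 ^ ?N * M) powr ((?n + 2) / ?n)"
      have k0: "k1 \<ge> 0" "k2 \<ge> 0" using Cn M AA0 CI by (auto simp: k1_def k2_def)
      have X1: "initial_term u B y0 s0 t0
        \<le> ennreal (2 ^ ?N * (M / A) * CA)"
      proof -
        have k: "heat_kernel (y0 - y) (t0 - s0) \<le> 2 ^ ?N * (M / A)" for y
          using heat_kernel_le[of "t0 - s0" "y0 - y"] s0 pd d by simp
        have s0T: "s0 \<in> {0<..<T}" "s0 \<le> T0" using s0 y0 T1 T0 by auto
        have "initial_term u B y0 s0 t0
          \<le> (\<integral>\<^sup>+y. ennreal (2 ^ ?N * (M / A)) * (ennreal (u y s0) * indicator B y) \<partial>lborel)"
        proof (rule nn_integral_mono)
          fix y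
          have "ennreal (u y s0 * heat_kernel (y0 - y) (t0 - s0)) \<le> ennreal (2 ^ ?N * (M / A)) * ennreal (u y s0)"
          proof -
            have "u y s0 * heat_kernel (y0 - y) (t0 - s0) \<le> 2 ^ ?N * (M / A) * u y s0"
              using mult_left_mono[OF k pos[OF s0T(1)], of y y] by (simp add: mult.commute)
            moreover have "0 \<le> 2 ^ ?N * (M / A)" using M AA0 by simp
            ultimately show ?thesis using ennreal_mult'[of "2 ^ ?N * (M / A)" "u y s0"] by (metis ennreal_leI)
          qed
          then show "ennreal (u y s0 * heat_kernel (y0 - y) (t0 - s0)) * indicator B y \<le> ennreal (2 ^ ?N * (M / A)) * (ennreal (u y s0) * indicator B y)"
            by (auto split: split_indicator)
        qed
        also have "\<dots> = ennreal (2 ^ ?N * (M / A)) * local_mass u B s0"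
        proof (rule nn_integral_cmult)
          note [measurable] = C21_measurable_slice[OF u s0T(1)]
          have [measurable]: "B \<in> sets borel" by (rule borel_closed) (rule B)
          show "(\<lambda>y. ennreal (u y s0) * indicator B y) \<in> borel_measurable lborel" by measurable
        qed
        also have "\<dots> \<le> ennreal (2 ^ ?N * (M / A)) * ennreal CA"
          using mass[OF s0(3) s0T(2)] by (intro mult_left_mono) auto
        also have "\<dots> = ennreal (2 ^ ?N * (M / A) * CA)" using M AA0 CA by (intro ennreal_mult[symmetric]) auto
        finally show ?thesis .
      qed
      have X2: "source_term u B y0 s0 t0
        \<le> ennreal (k1 * \<epsilon>) + ennreal (k2 * \<delta>')"
      proof -
        define H where "H = (\<lambda>z. ennreal (heat_kernel (y0 - fst z) (t0 - snd z)) * indicator (UNIV \<times> {t0 - \<delta>'..t0}) z)"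
        have [measurable]: "(UNIV::(real^'n) set) \<times> {t0 - \<delta>'..t0} \<in> sets borel" by (intro borel_closed closed_Times) auto
        have Hm[measurable]: "H \<in> borel_measurable borel"
        proof -
          note [measurable (raw)] = borel_measurable_fst_snd
          show ?thesis unfolding H_def by measurable
        qed
        have "source_term u B y0 s0 t0
          \<le> (\<integral>\<^sup>+z. ennreal k1 * F1 z + ennreal k2 * H z \<partial>lborel)"
        proof (rule nn_integral_mono)
          fix z :: "(real^'n) \<times> real"
          obtain y s where z: "z = (y, s)" by (cases z)
          show "ennreal (heat_op u (fst z) (snd z) * heat_kernel (y0 - fst z) (t0 - snd z)) * indicator (B \<times> {s0..<t0}) z
            \<le> ennreal k1 * F1 z + ennreal k2 * H z"
          proof (cases "y \<in> B \<and> s \<in> {s0..<t0}")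
            case True
            then have s: "s0 \<le> s" "s < t0" "s \<in> {0<..<T}" "0 < s" "s \<le> T1" "s \<le> T0" using s0 y0 T1 T0 by auto
            have h0: "0 \<le> heat_op u y s" using True s by (intro sup) auto
            show ?thesis
            proof (cases "dist y y0 < d/2 \<and> t0 - s < \<delta>'")
              case near: True
              have "dist y x0 \<le> r" using near dt dist_triangle[of y x0 y0] d by simp
              then have yr: "y \<in> cball x0 r" by (simp add: dist_commute)
              have "heat_op u y s \<le> CI * u y s powr ((?n + 2) / ?n)" using f[OF yr] s by simp
              also have "\<dots> \<le> k2" unfolding k2_def
                using cyl[of y s] near s pos[OF s(3), of y] CI by (intro mult_left_mono powr_mono2) auto
              finally have "heat_op u y s * heat_kernel (y0 - y) (t0 - s) \<le> k2 * heat_kernel (y0 - y) (t0 - s)"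
                by (intro mult_right_mono heat_kernel_nonneg)
              then have "ennreal (heat_op u y s * heat_kernel (y0 - y) (t0 - s)) \<le> ennreal k2 * H z"
                using near s k0 by (simp add: H_def z ennreal_mult[symmetric] heat_kernel_nonneg ennreal_leI)
              then show ?thesis using True by (simp add: z add_increasing)
            next
              case far: False
              have "heat_kernel (y0 - y) (t0 - s) \<le> k1"
              proof (cases "t0 - s < \<delta>'")
                case False
                have "heat_kernel (y0 - y) (t0 - s) \<le> (t0 - s) powr (- ?n / 2)" using s by (intro heat_kernel_le) simp
                also have "\<dots> \<le> \<delta>' powr (- ?n / 2)" using False \<delta>' by (intro powr_mono2') auto
                also have "\<dots> \<le> k1" unfolding p\<delta> k1_def using Cn M AA0 by simp
                finally show ?thesis .
              next
                case True
                with far have dy: "d/2 \<le> norm (y0 - y)" by (simp add: dist_norm norm_minus_commute)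
                then have "y0 - y \<noteq> 0" using d by auto
                then have "heat_kernel (y0 - y) (t0 - s) \<le> Cn * norm (y0 - y) powr (- ?n)"
                  unfolding Cn_def using s by (intro heat_kernel_le_norm) auto
                also have "\<dots> \<le> Cn * (d/2) powr (- ?n)" using dy d Cn by (intro mult_left_mono powr_mono2') auto
                also have "(d/2) powr (- ?n) = 2 ^ ?N * (M / A)"
                proof -
                  have "(d/2) powr (- ?n) = 1 / (d/2) ^ ?N" using d by (simp add: powr_minus powr_realpow field_simps)
                  also have "\<dots> = 2 ^ ?N * (1 / d ^ ?N)" by (simp add: power_divide)
                  finally show ?thesis unfolding MA .
                qed
                also have "Cn * (2 ^ ?N * (M / A)) \<le> k1" unfolding k1_def using M by simp
                finally show ?thesis .
              qed
              then have "heat_op u y s * heat_kernel (y0 - y) (t0 - s) \<le> k1 * heat_op u y s"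
                using h0 mult_left_mono[of "heat_kernel (y0 - y) (t0 - s)" k1 "heat_op u y s"] by (simp add: mult.commute)
              then have "ennreal (heat_op u y s * heat_kernel (y0 - y) (t0 - s)) \<le> ennreal k1 * F1 z"
                using True s k0 h0 by (simp add: F1_def F_def z ennreal_mult[symmetric] ennreal_leI)
              then show ?thesis using True by (simp add: z add_increasing2)
            qed
          qed (auto simp: z)
        qed
        also have "\<dots> = ennreal k1 * (\<integral>\<^sup>+z. F1 z \<partial>lborel) + ennreal k2 * (\<integral>\<^sup>+z. H z \<partial>lborel)"
          by (simp add: nn_integral_add nn_integral_cmult)
        \<comment> \<open>The kernel has mass 1 at each time, so its mass over a time window is at
          most the length of the window.\<close>
        also have "(\<integral>\<^sup>+z. H z \<partial>lborel) \<le> ennreal \<delta>'"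
        proof -
          have Hm': "H \<in> borel_measurable (lborel \<Otimes>\<^sub>M lborel)" using Hm by (simp add: lborel_prod)
          have "(\<integral>\<^sup>+z. H z \<partial>lborel) = (\<integral>\<^sup>+s. \<integral>\<^sup>+y. H (y, s) \<partial>lborel \<partial>lborel)"
            using lborel_pair.nn_integral_snd[OF Hm'] by (simp add: lborel_prod)
          also have "\<dots> \<le> (\<integral>\<^sup>+s. indicator {t0 - \<delta>'..t0} s \<partial>lborel)"
          proof (rule nn_integral_mono)
            fix s
            show "(\<integral>\<^sup>+y. H (y, s) \<partial>lborel) \<le> indicator {t0 - \<delta>'..t0} s"
            proof (cases "s < t0 \<and> t0 - \<delta>' \<le> s")
              case True
              then have "(\<integral>\<^sup>+y. H (y, s) \<partial>lborel) = (\<integral>\<^sup>+y. ennreal (heat_kernel (y0 - y) (t0 - s)) \<partial>lborel)"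
                by (intro nn_integral_cong) (simp add: H_def)
              then show ?thesis using nn_integral_heat_kernel[of "t0 - s" y0] True by simp
            next
              case False
              then have "H (y, s) = 0" for y by (auto simp: H_def heat_kernel_def split: split_indicator)
              then show ?thesis by simp
            qed
          qed
          also have "\<dots> = ennreal \<delta>'" using \<delta>' by simp
          finally show ?thesis .
        qed
        also have "ennreal k1 * (\<integral>\<^sup>+z. F1 z \<partial>lborel) \<le> ennreal k1 * ennreal \<epsilon>" using F1 by (rule mult_left_mono) simp
        finally show ?thesis using k0 \<epsilon> \<delta>' by (simp add: ennreal_mult mult_left_mono add_mono)
      qed
      have "ennreal (c0 * M) \<le> ennreal (2 ^ ?N * (M / A) * CA) + (ennreal (k1 * \<epsilon>) + ennreal (k2 * \<delta>')) + ennreal CB"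
        unfolding M_def
        using repr[OF y0(1) s0(3) s0(2)] y0 T1 X1 X2 by (intro order_trans[OF repr[OF y0(1) s0(3) s0(2)]] add_mono) (auto simp: M_def)
      also have "\<dots> = ennreal (2 ^ ?N * (M / A) * CA + (k1 * \<epsilon> + k2 * \<delta>') + CB)"
        using M AA0 CA k0 \<epsilon> \<delta>' CB by (simp add: ennreal_plus)
      finally have le: "c0 * M \<le> 2 ^ ?N * (M / A) * CA + (k1 * \<epsilon> + k2 * \<delta>') + CB"
        using M AA0 CA k0 \<epsilon> \<delta>' CB by (subst (asm) ennreal_le_iff) (auto intro!: add_nonneg_nonneg mult_nonneg_nonneg divide_nonneg_nonneg)
      have k2e: "k2 * \<delta>' \<le> c0 / 8 * M"
      proof -
        have e: "(?n + 2) / ?n = 1 + 2 / ?n" using n by (simp add: field_simps)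
        have "((2::real) ^ ?N) powr ((?n + 2) / ?n) = 2 ^ (?N + 2)"
        proof -
          have "((2::real) ^ ?N) powr ((?n + 2) / ?n) = (2 powr ?n) powr ((?n + 2) / ?n)" by (simp add: powr_realpow)
          also have "\<dots> = 2 powr (?n + 2)" using n by (simp add: powr_powr)
          also have "\<dots> = 2 powr real (?N + 2)" by (simp add: add.commute)
          also have "\<dots> = 2 ^ (?N + 2)" by (rule powr_realpow) simp
          finally show ?thesis .
        qed
        moreover have "M powr ((?n + 2) / ?n) * M powr (- 2 / ?n) = M"
          unfolding e powr_add[symmetric] using M by simp
        ultimately have "k2 * \<delta>' = CI * 2 ^ (?N + 2) * \<delta> * M"
          using M by (simp add: k2_def \<delta>'_def powr_mult algebra_simps)
        also have "\<dots> \<le> (CI + 1) * 2 ^ (?N + 2) * \<delta> * M"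
          using \<delta> M by (intro mult_right_mono) auto
        also have "\<dots> = c0 / 8 * M" using CI by (simp add: \<delta>_def)
        finally show ?thesis .
      qed
      have dd1: "\<delta> powr (- ?n / 2) * \<epsilon> = c0 / 8"
        using \<delta> by (simp add: \<epsilon>_def powr_minus)
      have Ab: "2 ^ ?N * (1 / A) * (CA + \<epsilon> * Cn) \<le> c0 / 8"
      proof -
        have "8 * 2 ^ ?N * (CA + \<epsilon> * Cn) / c0 \<le> A" using AA0(1) by (simp add: A0_def)
        then have "8 * 2 ^ ?N * (CA + \<epsilon> * Cn) \<le> A * c0" using c0 by (simp add: pos_divide_le_eq)
        then show ?thesis using AA0 by (simp add: field_simps)
      qed
      have "2 ^ ?N * (M / A) * CA + k1 * \<epsilon> = M * (2 ^ ?N * (1 / A) * (CA + \<epsilon> * Cn)) + M * (\<delta> powr (- ?n / 2) * \<epsilon>)"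
        by (simp add: k1_def algebra_simps add_divide_distrib)
      also have "\<dots> \<le> M * (c0 / 8) + M * (c0 / 8)"
        unfolding dd1 using Ab M by (intro add_mono mult_left_mono) auto
      finally have s: "2 ^ ?N * (M / A) * CA + k1 * \<epsilon> \<le> M * (c0 / 8) + M * (c0 / 8)" .
      have "0 \<le> M * c0" using M c0 by simp
      with s le k2e have "c0 * M / 2 \<le> CB" by argo
      then have "M \<le> 2 * CB / c0" using c0 by (simp add: field_simps)
      then have "A \<le> 2 * CB / c0 * r ^ ?N"
        unfolding A_def using dt d CB c0 M by (intro mult_mono power_mono) auto
      then show False using nA by (simp add: Am_def)
    qed
    moreover have "u x t * dd (x, t) ^ ?N \<le> A" using xt by (intro Amax) (auto simp: S_def)
    ultimately show ?thesis by (simp add: dd_def)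
  qed
  \<comment> \<open>With \<tau> = t/2, the condition t \<le> (r/2)^2 makes sqrt (t - \<tau>) the
    smaller entry on the inner ball, which turns the bound into a power of t.\<close>
  define T2 where "T2 = min (T1 / 2) ((r/2)\<^sup>2)"
  have T2: "T2 > 0" "T2 < T" "T2 \<le> T1" using T1 T0 r by (auto simp: T2_def)
  have "u x t \<le> Am * 2 powr (?n / 2) * t powr (- ?n / 2)" if x: "x \<in> cball x0 (r/2)" and t: "0 < t" "t \<le> T2" for x t
  proof -
    have tt: "t/2 < T1" "t \<le> T1" "t \<le> (r/2)\<^sup>2" using t T2 T1 by (auto simp: T2_def)
    have xr: "x \<in> cball x0 r" using x r by auto
    have "sqrt (t/2) \<le> r/2"
    proof (rule real_le_lsqrt)
      show "t/2 \<le> (r/2)\<^sup>2" using tt t by simp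
    qed (use r in auto)
    also have "\<dots> \<le> r - dist x x0" using x by (simp add: dist_commute)
    finally have "min (sqrt (t - t/2)) (r - dist x x0) = sqrt (t/2)" by simp
    with bound[of "t/2" x t] tt t xr have b: "u x t * sqrt (t/2) ^ ?N \<le> Am" by simp
    have e: "(t/2) powr (- ?n / 2) = 1 / sqrt (t/2) ^ ?N"
      using powr_neg_half_square[of "sqrt (t/2)" ?N] t by simp
    have "u x t \<le> Am * (1 / sqrt (t/2) ^ ?N)" using b t by (simp add: field_simps)
    also have "\<dots> = Am * (2 powr (?n / 2) * t powr (- ?n / 2))"
      unfolding e[symmetric] using t by (simp add: powr_divide powr_minus field_simps)
    finally show ?thesis by (simp add: mult.assoc)
  qed
  then show thesis using Am T2 by (intro that[of "Am * 2 powr (?n / 2)" T2]) auto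
qed

text \<open>The radii shrink by factors of 2: the supersolution property on 4 \<rho>, the masses on
  2 \<rho>, Duhamel's bound and the L^p bound on \<rho>, the nonlocal bound on \<rho>/2, the
  pointwise bound on \<rho>/4.\<close>

lemma admissible_local_bound:
  fixes \<Omega> :: "(real^'n) set"
  assumes \<alpha>: "0 < \<alpha>" "\<alpha> < real CARD('n) + 2" and T: "T > 0" and \<Omega>: "open \<Omega>" "x0 \<in> \<Omega>"
    and lam: "0 < lam" "lam < (real CARD('n) + 2 - \<alpha>) / real CARD('n)"
    and adm: "admissible \<alpha> lam (g_exp (real CARD('n)) \<alpha> lam) T \<Omega> u"
  shows "\<exists>\<delta>>0. \<exists>C\<ge>0. \<exists>T1>0. T1 < T \<and>
    (\<forall>x\<in>cball x0 \<delta>. \<forall>t. 0 < t \<and> t \<le> T1 \<longrightarrow> u x t \<le> C * t powr (- real CARD('n) / 2))"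
proof -
  let ?n = "real CARD('n)"
  obtain e where e: "e > 0" "cball x0 e \<subseteq> \<Omega>" using \<Omega> open_contains_cball by blast
  define \<rho> where "\<rho> = e / 4"
  have \<rho>: "\<rho> > 0" "4 * \<rho> = e" using e by (auto simp: \<rho>_def)
  define T0 where "T0 = T / 2"
  have T0: "0 < T0" "T0 < T" using T by (auto simp: T0_def)
  have u: "C21 T u" and pos: "\<And>y s. s \<in> {0<..<T} \<Longrightarrow> 0 \<le> u y s"
    and Ll: "set_integrable lborel (UNIV \<times> {0<..<T}) (\<lambda>z. \<bar>u (fst z) (snd z)\<bar> powr lam)"
    using adm by (auto simp: admissible_def)
  have hp: "0 \<le> heat_op u y s" "ennreal (heat_op u y s) \<le> nonlocal T \<alpha> lam u y s * ennreal (rpow (u y s) (g_exp ?n \<alpha> lam))"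
    if "y \<in> cball x0 (4 * \<rho>)" "s \<in> {0<..<T}" for y s
    using adm that e unfolding admissible_def heat_op_def \<rho>(2) by auto
  have \<rho>4: "4 * \<rho> > 0" using \<rho> by simp
  obtain CA where CA: "CA \<ge> 0"
    "\<And>s. 0 < s \<Longrightarrow> s \<le> T0 \<Longrightarrow> local_mass u (cball x0 (4 * \<rho> / 2)) s \<le> ennreal CA"
    "source_mass u (cball x0 (4 * \<rho> / 2) \<times> {0<..T0}) \<le> ennreal CA"
    by (rule supersolution_mass[OF u pos hp(1) \<rho>4 T0], assumption, assumption, assumption, rule that)
  have r2: "4 * \<rho> / 2 = 2 * \<rho>" by simp
  note CA' = CA[unfolded r2]
  have sub: "y \<in> cball x0 (2 * \<rho>) \<Longrightarrow> y \<in> cball x0 (4 * \<rho>)" for y using \<rho> by auto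
  have sup2: "0 \<le> heat_op u y s" if "y \<in> cball x0 (2 * \<rho>)" "s \<in> {0<..<T}" for y s
    using hp(1)[OF sub] that by blast
  obtain c0 CB where c0: "c0 > 0" "CB \<ge> 0"
    "\<And>x t s0. x \<in> cball x0 \<rho> \<Longrightarrow> 0 < s0 \<Longrightarrow> s0 < t \<Longrightarrow> t \<le> T0 \<Longrightarrow>
      ennreal (c0 * u x t) \<le> initial_term u (cball x0 (2 * \<rho>)) x s0 t
       + source_term u (cball x0 (2 * \<rho>)) x s0 t + ennreal CB"
    by (rule supersolution_repr[OF u pos sup2 \<rho>(1) T0 CA'(1) CA'(2)], assumption, assumption, assumption, assumption, assumption, rule that)
  have Lp: "\<exists>Cp\<ge>0. (\<integral>\<^sup>+z. ennreal (u (fst z) (snd z) powr p) * indicator (cball x0 \<rho> \<times> {0<..T0}) z \<partial>lborel) \<le> ennreal Cp"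
    if "1 \<le> p" "p < (?n + 2) / ?n" for p
    by (rule supersolution_Lp[OF u pos T0 CA'(1) closed_cball CA'(2,3) c0 that closed_cball bounded_cball])
       (assumption+, blast)
  obtain CI where CI: "CI \<ge> 0"
    "\<And>x t. x \<in> cball x0 (\<rho>/2) \<Longrightarrow> 0 < t \<Longrightarrow> t \<le> T0 \<Longrightarrow> nonlocal T \<alpha> lam u x t \<le> ennreal CI"
    by (rule nonlocal_bounded[OF u pos T0 \<rho>(1) \<alpha> lam Lp Ll], assumption, assumption, assumption, rule that)
  have g: "g_exp ?n \<alpha> lam = (?n + 2) / ?n" using lam by (simp add: g_exp_def)
  have f: "heat_op u x t \<le> CI * u x t powr ((?n + 2) / ?n)" if "x \<in> cball x0 (\<rho>/2)" "0 < t" "t \<le> T0" for x t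
  proof -
    have "x \<in> cball x0 (4 * \<rho>)" "t \<in> {0<..<T}" using that \<rho> T0 by auto
    note h = hp(2)[OF this]
    have "rpow (u x t) (g_exp ?n \<alpha> lam) = u x t powr ((?n + 2) / ?n)"
      unfolding g rpow_def by (simp add: add_nonneg_eq_0_iff)
    with h have "ennreal (heat_op u x t) \<le> nonlocal T \<alpha> lam u x t * ennreal (u x t powr ((?n + 2) / ?n))" by simp
    also have "\<dots> \<le> ennreal CI * ennreal (u x t powr ((?n + 2) / ?n))"
      using CI(2)[OF that] by (intro mult_right_mono) auto
    also have "\<dots> = ennreal (CI * u x t powr ((?n + 2) / ?n))" using CI(1) by (simp add: ennreal_mult)
    finally show ?thesis using CI(1) by (simp add: ennreal_le_iff)
  qed
  have r: "\<rho>/2 > 0" using \<rho> by simp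
  have sub2: "x \<in> cball x0 (\<rho>/2) \<Longrightarrow> x \<in> cball x0 \<rho>" for x using \<rho> by auto
  obtain C T1 where C: "C \<ge> 0" "T1 > 0" "T1 < T"
    "\<And>x t. x \<in> cball x0 (\<rho>/2/2) \<Longrightarrow> 0 < t \<Longrightarrow> t \<le> T1 \<Longrightarrow> u x t \<le> C * t powr (- ?n / 2)"
    by (rule supersolution_pointwise[OF u pos sup2 T0 CA'(1) closed_cball CA'(2,3) c0(1,2) r c0(3)[OF sub2] CI(1) f]) 
       (assumption+, rule that)
  show ?thesis
    using \<rho> C by (intro exI[of _ "\<rho>/2/2"] exI[of _ C] exI[of _ T1] conjI) auto
qed

text \<open>Finitely many local bounds cover K; constants are added and times minimised. The Landau
  symbol speaks of absolute values, so the supremum is also shown to be nonnegative.\<close>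

lemma admissible_bound:
  fixes \<Omega> :: "(real^'n) set"
  assumes \<alpha>: "0 < \<alpha>" "\<alpha> < real CARD('n) + 2" and T: "T > 0" and \<Omega>: "open \<Omega>"
    and lam: "0 < lam" "lam < (real CARD('n) + 2 - \<alpha>) / real CARD('n)"
    and adm: "admissible \<alpha> lam (g_exp (real CARD('n)) \<alpha> lam) T \<Omega> u"
    and K: "compact K" "K \<noteq> {}" "K \<subseteq> \<Omega>"
  shows "(\<lambda>t. Sup ((\<lambda>x. u x t) ` K)) \<in> O[at_right 0](\<lambda>t. t powr (- real CARD('n) / 2))"
proof -
  let ?n = "real CARD('n)"
  have "\<forall>x0\<in>K. \<exists>\<delta>>0. \<exists>C\<ge>0. \<exists>T1>0. T1 < T \<and>
    (\<forall>x\<in>cball x0 \<delta>. \<forall>t. 0 < t \<and> t \<le> T1 \<longrightarrow> u x t \<le> C * t powr (- ?n / 2))"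
    using admissible_local_bound[OF \<alpha> T \<Omega> _ lam adm] K by blast
  then obtain \<delta> C T1 where L: "\<And>x0. x0 \<in> K \<Longrightarrow> \<delta> x0 > 0 \<and> C x0 \<ge> 0 \<and> T1 x0 > 0 \<and> T1 x0 < T \<and>
    (\<forall>x\<in>cball x0 (\<delta> x0). \<forall>t. 0 < t \<and> t \<le> T1 x0 \<longrightarrow> u x t \<le> C x0 * t powr (- ?n / 2))"
    by metis
  have "K \<subseteq> (\<Union>x0\<in>K. ball x0 (\<delta> x0))" using L by force
  then obtain D where D: "D \<subseteq> K" "finite D" "K \<subseteq> (\<Union>x0\<in>D. ball x0 (\<delta> x0))"
    by (rule compactE_image[OF K(1), rotated]) auto
  have Dne: "D \<noteq> {}" using D(3) K(2) by auto
  define Cm where "Cm = (\<Sum>x\<in>D. C x)"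
  define Tm where "Tm = Min (T1 ` D)"
  have Tm: "Tm > 0" "\<And>x. x \<in> D \<Longrightarrow> Tm \<le> T1 x" using D Dne L by (auto simp: Tm_def)
  have Cm: "C x \<le> Cm" if "x \<in> D" for x
    unfolding Cm_def using D L that by (intro member_le_sum) auto
  have ub: "u x t \<le> Cm * t powr (- ?n / 2)" if x: "x \<in> K" and t: "0 < t" "t \<le> Tm" for x t
  proof -
    obtain x0 where x0: "x0 \<in> D" "x \<in> ball x0 (\<delta> x0)" using D(3) x by blast
    then have "u x t \<le> C x0 * t powr (- ?n / 2)" using L[of x0] Tm(2)[of x0] D(1) t by auto
    also have "\<dots> \<le> Cm * t powr (- ?n / 2)" using Cm[OF x0(1)] by (intro mult_right_mono) auto
    finally show ?thesis .
  qed
  have TmT: "Tm < T" using Dne Tm(2) L D(1) by (metis all_not_in_conv le_less_trans subsetD)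
  show ?thesis
  proof (rule bigoI[of _ Cm])
    show "\<forall>\<^sub>F t in at_right 0. norm (Sup ((\<lambda>x. u x t) ` K)) \<le> Cm * norm (t powr (- ?n / 2))"
      unfolding eventually_at_right_field
    proof (intro exI[of _ Tm] conjI allI impI)
      fix t assume t: "t > 0" "t < Tm"
      have "Sup ((\<lambda>x. u x t) ` K) \<le> Cm * t powr (- ?n / 2)"
        using ub t K by (intro cSUP_least) auto
      moreover have "0 \<le> Sup ((\<lambda>x. u x t) ` K)"
      proof -
        obtain x where x: "x \<in> K" using K by auto
        have "0 \<le> u x t" using adm t TmT by (auto simp: admissible_def)
        also have "\<dots> \<le> Sup ((\<lambda>x. u x t) ` K)"
          using ub t by (intro cSUP_upper[OF x] bdd_aboveI2[where M = "Cm * t powr (- ?n / 2)"]) auto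
        finally show ?thesis .
      qed
      ultimately show "norm (Sup ((\<lambda>x. u x t) ` K)) \<le> Cm * norm (t powr (- ?n / 2))" by simp
    qed (rule Tm)
  qed
qed

section \<open>Functions of class C21 and their series\<close>

text \<open>\<open>D\<close>, \<open>G\<close> and \<open>H\<close> are the time derivative, the gradient and the Hessian of \<open>u\<close>.\<close>

definition jet :: "real \<Rightarrow> (real^'n \<Rightarrow> real \<Rightarrow> real) \<Rightarrow> (real^'n \<Rightarrow> real \<Rightarrow> real)
    \<Rightarrow> ('n \<Rightarrow> real^'n \<Rightarrow> real \<Rightarrow> real) \<Rightarrow> ('n \<Rightarrow> 'n \<Rightarrow> real^'n \<Rightarrow> real \<Rightarrow> real) \<Rightarrow> bool" where
  "jet T u D G H \<longleftrightarrow>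
     (\<forall>x. \<forall>t\<in>{0<..<T}. ((\<lambda>s. u x s) has_real_derivative D x t) (at t) \<and>
        ((\<lambda>y. u y t) has_derivative (\<lambda>h. \<Sum>i\<in>UNIV. h $ i * G i x t)) (at x) \<and>
        (\<forall>i. ((\<lambda>y. G i y t) has_derivative (\<lambda>h. \<Sum>j\<in>UNIV. h $ j * H i j x t)) (at x))) \<and>
     continuous_on (UNIV \<times> {0<..<T}) (\<lambda>(x,t). u x t) \<and>
     continuous_on (UNIV \<times> {0<..<T}) (\<lambda>(x,t). D x t) \<and>
     (\<forall>i. continuous_on (UNIV \<times> {0<..<T}) (\<lambda>(x,t). G i x t)) \<and>
     (\<forall>i j. continuous_on (UNIV \<times> {0<..<T}) (\<lambda>(x,t). H i j x t))"

text \<open>Bounds are asked only for t > \<tau>: the terms of the series below concentrate at times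
  tending to 0, so uniformity is sought away from time 0 only.\<close>

definition jet_le :: "real \<Rightarrow> real \<Rightarrow> (real^'n \<Rightarrow> real \<Rightarrow> real) \<Rightarrow> (real^'n \<Rightarrow> real \<Rightarrow> real)
    \<Rightarrow> ('n \<Rightarrow> real^'n \<Rightarrow> real \<Rightarrow> real) \<Rightarrow> ('n \<Rightarrow> 'n \<Rightarrow> real^'n \<Rightarrow> real \<Rightarrow> real) \<Rightarrow> real \<Rightarrow> bool" where
  "jet_le \<tau> T u D G H m \<longleftrightarrow> (\<forall>x. \<forall>t\<in>{\<tau><..<T}. \<bar>u x t\<bar> \<le> m \<and> \<bar>D x t\<bar> \<le> m
     \<and> (\<forall>i. \<bar>G i x t\<bar> \<le> m) \<and> (\<forall>i k. \<bar>H i k x t\<bar> \<le> m))"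

lemma partial_eqI:
  fixes g :: "real^'n \<Rightarrow> real"
  assumes "(g has_derivative (\<lambda>h. \<Sum>i\<in>UNIV. h $ i * G i)) (at x)"
  shows "partial i g x = G i"
proof -
  have "((\<lambda>h. x + h *\<^sub>R axis i 1) has_derivative (\<lambda>h. h *\<^sub>R axis i 1)) (at 0)"
    by (auto intro!: derivative_eq_intros)
  from has_derivative_compose[OF this, of g "\<lambda>h. \<Sum>i\<in>UNIV. h $ i * G i"] assms
  have "((\<lambda>h. g (x + h *\<^sub>R axis i 1)) has_derivative (\<lambda>h. \<Sum>j\<in>UNIV. (h *\<^sub>R axis i 1 :: real^'n) $ j * G j)) (at 0)"
    by simp
  moreover have "(\<Sum>j\<in>UNIV. (h *\<^sub>R axis i 1 :: real^'n) $ j * G j) = G i * h" for h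
  proof -
    have "(\<Sum>j\<in>UNIV. (h *\<^sub>R axis i 1 :: real^'n) $ j * G j) = (\<Sum>j\<in>UNIV. if j = i then G j * h else 0)"
      by (intro sum.cong) (auto simp: axis_def)
    then show ?thesis by simp
  qed
  ultimately have "((\<lambda>h. g (x + h *\<^sub>R axis i 1)) has_real_derivative G i) (at 0)"
    unfolding has_field_derivative_def by simp
  then show ?thesis unfolding partial_def by (rule DERIV_imp_deriv)
qed

text \<open>\<open>partial\<close> and \<open>dt\<close> are values of \<open>deriv\<close>, which
  are awkward to sum termwise. A jet carries the derivatives as explicit functions, so that sums are
  formed on jets and converted to \<open>C21\<close> afterwards.\<close>

lemma jet_C21:
  assumes "jet T u D G H"
  shows "C21 T u" and "t \<in> {0<..<T} \<Longrightarrow> dt u x t = D x t"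
    and "t \<in> {0<..<T} \<Longrightarrow> laplacian (\<lambda>y. u y t) x = (\<Sum>i\<in>UNIV. H i i x t)"
proof -
  have p1: "partial i (\<lambda>z. u z t) = (\<lambda>x. G i x t)" if "t \<in> {0<..<T}" for t i
    using assms that unfolding jet_def by (intro ext partial_eqI) blast
  have p2: "partial j (partial i (\<lambda>z. u z t)) x = H i j x t" if "t \<in> {0<..<T}" for t i j x
    unfolding p1[OF that] using assms that unfolding jet_def by (intro partial_eqI) blast
  have d: "dt u x t = D x t" if "t \<in> {0<..<T}" for x t
    unfolding dt_def using assms that unfolding jet_def by (intro DERIV_imp_deriv) blast
  then show "t \<in> {0<..<T} \<Longrightarrow> dt u x t = D x t" .
  show "t \<in> {0<..<T} \<Longrightarrow> laplacian (\<lambda>y. u y t) x = (\<Sum>i\<in>UNIV. H i i x t)"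
    by (simp add: laplacian_def p2)
  have cong: "continuous_on (UNIV \<times> {0<..<T}) (\<lambda>(x,t). f x t)"
    if "continuous_on (UNIV \<times> {0<..<T}) (\<lambda>(x,t). g x t)" "\<And>x t. t \<in> {0<..<T} \<Longrightarrow> f x t = g x t" for f g :: "real^'n \<Rightarrow> real \<Rightarrow> real"
    using that(1) by (rule continuous_on_eq) (use that(2) in auto)
  show "C21 T u" unfolding C21_def
  proof (intro conjI allI ballI)
    fix x t i assume t: "t \<in> {0<..<T}"
    show "(\<lambda>s. u x s) differentiable (at t)" "(\<lambda>y. u y t) differentiable (at x)"
      using assms t unfolding jet_def differentiable_def has_field_derivative_def by blast+
    show "(\<lambda>y. partial i (\<lambda>z. u z t) y) differentiable (at x)"
      unfolding p1[OF t] using assms t unfolding jet_def differentiable_def by blast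
  next
    show "continuous_on (UNIV \<times> {0<..<T}) (\<lambda>(x,t). u x t)" using assms by (simp add: jet_def)
    show "continuous_on (UNIV \<times> {0<..<T}) (\<lambda>(x,t). dt u x t)"
      by (rule cong[of D]) (use assms d in \<open>auto simp: jet_def\<close>)
    show "continuous_on (UNIV \<times> {0<..<T}) (\<lambda>(x,t). partial i (\<lambda>z. u z t) x)" for i
      by (rule cong[of "G i"]) (use assms p1 in \<open>auto simp: jet_def\<close>)
    show "continuous_on (UNIV \<times> {0<..<T}) (\<lambda>(x,t). partial j (partial i (\<lambda>z. u z t)) x)" for i j
      by (rule cong[of "H i j"]) (use assms p2 in \<open>auto simp: jet_def\<close>)
  qed
qed

lemma jet_sum:
  assumes "finite A" "\<And>k. k \<in> A \<Longrightarrow> jet T (u k) (D k) (G k) (H k)"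
  shows "jet T (\<lambda>x t. \<Sum>k\<in>A. u k x t) (\<lambda>x t. \<Sum>k\<in>A. D k x t) (\<lambda>i x t. \<Sum>k\<in>A. G k i x t) (\<lambda>i j x t. \<Sum>k\<in>A. H k i j x t)"
  unfolding jet_def
proof (intro conjI allI ballI)
  have sw: "(\<lambda>h::real^'n. \<Sum>k\<in>A. \<Sum>i\<in>UNIV. h $ i * g k i) = (\<lambda>h. \<Sum>i\<in>UNIV. h $ i * (\<Sum>k\<in>A. g k i))" for g
    by (rule ext) (subst sum.swap, simp add: sum_distrib_left)
  fix x t assume t: "t \<in> {0<..<T}"
  show "((\<lambda>s. \<Sum>k\<in>A. u k x s) has_real_derivative (\<Sum>k\<in>A. D k x t)) (at t)"
    using assms t unfolding jet_def by (intro DERIV_sum) blast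
  show "((\<lambda>y. \<Sum>k\<in>A. u k y t) has_derivative (\<lambda>h. \<Sum>i\<in>UNIV. h $ i * (\<Sum>k\<in>A. G k i x t))) (at x)"
    unfolding sw[symmetric] using assms t unfolding jet_def by (intro has_derivative_sum) blast
  show "((\<lambda>y. \<Sum>k\<in>A. G k i y t) has_derivative (\<lambda>h. \<Sum>j\<in>UNIV. h $ j * (\<Sum>k\<in>A. H k i j x t))) (at x)" for i
    unfolding sw[symmetric] using assms t unfolding jet_def by (intro has_derivative_sum) blast
next
  show "continuous_on (UNIV \<times> {0<..<T}) (\<lambda>(x, t). \<Sum>k\<in>A. u k x t)"
    "continuous_on (UNIV \<times> {0<..<T}) (\<lambda>(x, t). \<Sum>k\<in>A. D k x t)"
    using assms unfolding jet_def split_beta by (intro continuous_on_sum; blast)+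
  show "continuous_on (UNIV \<times> {0<..<T}) (\<lambda>(x, t). \<Sum>k\<in>A. G k i x t)" for i
    using assms unfolding jet_def split_beta by (intro continuous_on_sum; blast)
  show "continuous_on (UNIV \<times> {0<..<T}) (\<lambda>(x, t). \<Sum>k\<in>A. H k i j x t)" for i j
    using assms unfolding jet_def split_beta by (intro continuous_on_sum; blast)
qed

text \<open>Weierstrass's test for each component of the gradient gives convergence of the
  derivatives as linear maps, uniformly in x.\<close>

lemma has_derivative_grad_series:
  fixes g :: "nat \<Rightarrow> real^'n \<Rightarrow> real"
  assumes der: "\<And>j x. (g j has_derivative (\<lambda>h. \<Sum>i\<in>UNIV. h $ i * G j i x)) (at x)"
    and M: "summable M" "eventually (\<lambda>j. \<forall>i x. \<bar>G j i x\<bar> \<le> M j) sequentially"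
    and s: "\<And>x. summable (\<lambda>j. g j x)"
  shows "((\<lambda>x. \<Sum>j. g j x) has_derivative (\<lambda>h. \<Sum>i\<in>UNIV. h $ i * (\<Sum>j. G j i x))) (at x)"
proof -
  have ul: "uniform_limit UNIV (\<lambda>k x. \<Sum>j<k. G j i x) (\<lambda>x. \<Sum>j. G j i x) sequentially" for i
    by (rule Weierstrass_m_test_ev[OF _ M(1)]) (rule eventually_mono[OF M(2)], simp)
  have unif: "\<forall>\<^sub>F k in sequentially. \<forall>x\<in>UNIV. \<forall>h. norm ((\<Sum>j<k. \<Sum>i\<in>UNIV. h $ i * G j i x) - (\<Sum>i\<in>UNIV. h $ i * (\<Sum>j. G j i x))) \<le> e * norm h"
    if e: "e > 0" for e
  proof -
    \<comment> \<open>The norm of a tail as a linear map is at most the sum over its n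
      components.\<close>
    define e' where "e' = e / real CARD('n)"
    have e': "e' > 0" using e by (simp add: e'_def)
    have "\<forall>\<^sub>F k in sequentially. \<forall>i\<in>UNIV. \<forall>x\<in>UNIV. dist (\<Sum>j<k. G j i x) (\<Sum>j. G j i x) < e'"
      using uniform_limitD[OF ul e'] by (intro eventually_ball_finite) auto
    then show ?thesis
    proof (rule eventually_mono, intro ballI allI)
      fix k x and h :: "real^'n"
      assume k: "\<forall>i\<in>UNIV. \<forall>x\<in>UNIV. dist (\<Sum>j<k. G j i x) (\<Sum>j. G j i x) < e'"
      have "(\<Sum>j<k. \<Sum>i\<in>UNIV. h $ i * G j i x) - (\<Sum>i\<in>UNIV. h $ i * (\<Sum>j. G j i x))
         = (\<Sum>i\<in>UNIV. h $ i * ((\<Sum>j<k. G j i x) - (\<Sum>j. G j i x)))"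
        by (subst sum.swap) (simp add: sum_distrib_left right_diff_distrib sum_subtractf)
      also have "norm \<dots> \<le> (\<Sum>i\<in>(UNIV::'n set). norm h * e')"
      proof (rule order_trans[OF norm_sum sum_mono])
        fix i
        have "\<bar>h $ i\<bar> \<le> norm h" by (rule component_le_norm_cart)
        then show "norm (h $ i * ((\<Sum>j<k. G j i x) - (\<Sum>j. G j i x))) \<le> norm h * e'"
          using k e' unfolding real_norm_def abs_mult by (intro mult_mono) (auto simp: dist_real_def less_imp_le)
      qed
      also have "\<dots> = e * norm h" by (simp add: e'_def)
      finally show "norm ((\<Sum>j<k. \<Sum>i\<in>UNIV. h $ i * G j i x) - (\<Sum>i\<in>UNIV. h $ i * (\<Sum>j. G j i x))) \<le> e * norm h" .
    qed
  qed
  have "\<exists>gg. \<forall>x\<in>UNIV. (\<lambda>j. g j x) sums gg x \<and> (gg has_derivative (\<lambda>h. \<Sum>i\<in>UNIV. h $ i * (\<Sum>j. G j i x))) (at x within UNIV)"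
    by (rule has_derivative_series[where f' = "\<lambda>j x h. \<Sum>i\<in>UNIV. h $ i * G j i x" and x = 0 and l = "\<Sum>j. g j 0"])
       (use der unif s in \<open>auto simp: summable_sums\<close>)
  then obtain gg where gg: "\<And>x. (\<lambda>j. g j x) sums gg x" "\<And>x. (gg has_derivative (\<lambda>h. \<Sum>i\<in>UNIV. h $ i * (\<Sum>j. G j i x))) (at x)"
    by auto
  have "(\<lambda>x. \<Sum>j. g j x) = gg" using gg(1) by (auto simp: sums_iff)
  with gg(2) show ?thesis by simp
qed

text \<open>Continuity is local: a point at time t lies in the open strip of times above t/2, where
  a summable majorant is at hand.\<close>

lemma continuous_on_series_time:
  fixes f :: "nat \<Rightarrow> real^'n \<Rightarrow> real \<Rightarrow> real"
  assumes c: "\<And>j. continuous_on (UNIV \<times> {0<..<T}) (\<lambda>(x,t). f j x t)"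
    and M: "\<And>\<tau>. \<tau> > 0 \<Longrightarrow> \<exists>M. summable M \<and> eventually (\<lambda>j. \<forall>x. \<forall>t\<in>{\<tau><..<T}. \<bar>f j x t\<bar> \<le> M j) sequentially"
  shows "continuous_on (UNIV \<times> {0<..<T}) (\<lambda>(x,t). \<Sum>j. f j x t)"
proof -
  have op: "open ((UNIV :: (real^'n) set) \<times> {\<tau><..<T})" for \<tau> by (intro open_Times) auto
  have ct: "continuous_on (UNIV \<times> {\<tau><..<T}) (\<lambda>(x,t). \<Sum>j. f j x t)" if \<tau>: "\<tau> > 0" for \<tau>
  proof -
    obtain M where M': "summable M" "eventually (\<lambda>j. \<forall>x. \<forall>t\<in>{\<tau><..<T}. \<bar>f j x t\<bar> \<le> M j) sequentially"
      using M[OF \<tau>] by blast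
    have "uniform_limit (UNIV \<times> {\<tau><..<T}) (\<lambda>k z. \<Sum>j<k. f j (fst z) (snd z)) (\<lambda>z. \<Sum>j. f j (fst z) (snd z)) sequentially"
      by (rule Weierstrass_m_test_ev[OF _ M'(1)]) (rule eventually_mono[OF M'(2)], auto)
    then have "continuous_on (UNIV \<times> {\<tau><..<T}) (\<lambda>z. \<Sum>j. f j (fst z) (snd z))"
    proof (rule uniform_limit_theorem[rotated])
      show "\<forall>\<^sub>F k in sequentially. continuous_on (UNIV \<times> {\<tau><..<T}) (\<lambda>z. \<Sum>j<k. f j (fst z) (snd z))"
      proof -
        have "continuous_on (UNIV \<times> {\<tau><..<T}) (\<lambda>z. f j (fst z) (snd z))" for j
          by (rule continuous_on_subset[OF c[unfolded split_beta]]) (use \<tau> in auto)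
        then show ?thesis by (intro always_eventually allI continuous_on_sum)
      qed
    qed simp
    then show ?thesis by (simp add: split_beta)
  qed
  show ?thesis
  proof (rule continuous_at_imp_continuous_on, rule ballI)
    fix z :: "(real^'n) \<times> real" assume "z \<in> UNIV \<times> {0<..<T}"
    then have z: "0 < snd z / 2" "z \<in> UNIV \<times> {snd z / 2<..<T}" by auto
    show "continuous (at z) (\<lambda>(x,t). \<Sum>j. f j x t)"
      using ct[OF z(1)] z(2) op[of "snd z / 2"] continuous_on_eq_continuous_at by blast
  qed
qed

text \<open>The majorants may depend on \<tau> and need to hold only from some index on, since
  finitely many terms may still be large after time \<tau>. Each derivative at time t is justified
  on the strip above t/2.\<close>

lemma jet_suminf:
  fixes u :: "nat \<Rightarrow> real^'n \<Rightarrow> real \<Rightarrow> real"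
  assumes J: "\<And>j. jet T (u j) (D j) (G j) (H j)"
    and M: "\<And>\<tau>. \<tau> > 0 \<Longrightarrow> \<exists>M. summable M \<and> eventually (\<lambda>j. jet_le \<tau> T (u j) (D j) (G j) (H j) (M j)) sequentially"
  shows "jet T (\<lambda>x t. \<Sum>j. u j x t) (\<lambda>x t. \<Sum>j. D j x t) (\<lambda>i x t. \<Sum>j. G j i x t) (\<lambda>i k x t. \<Sum>j. H j i k x t)"
    and "t \<in> {0<..<T} \<Longrightarrow> summable (\<lambda>j. u j x t)" "t \<in> {0<..<T} \<Longrightarrow> summable (\<lambda>j. D j x t)"
    "t \<in> {0<..<T} \<Longrightarrow> summable (\<lambda>j. H j i k x t)"
proof -
  have Mt: "\<exists>M. summable M \<and> eventually (\<lambda>j. jet_le (t/2) T (u j) (D j) (G j) (H j) (M j)) sequentially"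
    if "t \<in> {0<..<T}" for t using M[of "t/2"] that by auto
  have sm: "summable (\<lambda>j. u j x t) \<and> summable (\<lambda>j. D j x t) \<and> summable (\<lambda>j. G j i x t) \<and> summable (\<lambda>j. H j i k x t)"
    if t: "t \<in> {0<..<T}" for x t i k
  proof -
    obtain M where M': "summable M" "eventually (\<lambda>j. jet_le (t/2) T (u j) (D j) (G j) (H j) (M j)) sequentially"
      using Mt[OF t] by blast
    have tt: "t \<in> {t/2<..<T}" using t by auto
    show ?thesis
      by (intro conjI summable_comparison_test_ev[OF _ M'(1)]; rule eventually_mono[OF M'(2)]; use tt in \<open>auto simp: jet_le_def\<close>)
  qed
  then show "t \<in> {0<..<T} \<Longrightarrow> summable (\<lambda>j. u j x t)" "t \<in> {0<..<T} \<Longrightarrow> summable (\<lambda>j. D j x t)"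
    "t \<in> {0<..<T} \<Longrightarrow> summable (\<lambda>j. H j i k x t)" by blast+
  show "jet T (\<lambda>x t. \<Sum>j. u j x t) (\<lambda>x t. \<Sum>j. D j x t) (\<lambda>i x t. \<Sum>j. G j i x t) (\<lambda>i k x t. \<Sum>j. H j i k x t)"
    unfolding jet_def
  proof (intro conjI allI ballI)
    fix x t assume t: "t \<in> {0<..<T}"
    obtain M where M': "summable M" "eventually (\<lambda>j. jet_le (t/2) T (u j) (D j) (G j) (H j) (M j)) sequentially"
      using Mt[OF t] by blast
    have tt: "t \<in> {t/2<..<T}" using t by auto
    show "((\<lambda>s. \<Sum>j. u j x s) has_real_derivative (\<Sum>j. D j x t)) (at t)"
    proof (rule has_field_derivative_series'(2)[where S = "{t/2<..<T}" and ?x0.0 = t])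
      show "(u j x has_real_derivative D j x s) (at s within {t/2<..<T})" if "s \<in> {t/2<..<T}" for j s
      proof -
        have "s \<in> {0<..<T}" using that t by auto
        then have "((\<lambda>s. u j x s) has_real_derivative D j x s) (at s)" using J[of j] unfolding jet_def by blast
        then show ?thesis by (rule has_field_derivative_at_within)
      qed
      have "uniform_limit {t/2<..<T} (\<lambda>k s. \<Sum>j<k. D j x s) (\<lambda>s. \<Sum>j. D j x s) sequentially"
        by (rule Weierstrass_m_test_ev[OF _ M'(1)]) (rule eventually_mono[OF M'(2)], auto simp: jet_le_def)
      then show "uniformly_convergent_on {t/2<..<T} (\<lambda>k s. \<Sum>j<k. D j x s)"
        by (auto simp: uniformly_convergent_on_def)
      show "t \<in> interior {t/2<..<T}" using tt by (simp add: interior_open)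
    qed (use sm[OF t] tt in auto)
    show "((\<lambda>y. \<Sum>j. u j y t) has_derivative (\<lambda>h. \<Sum>i\<in>UNIV. h $ i * (\<Sum>j. G j i x t))) (at x)"
    proof (rule has_derivative_grad_series[OF _ M'(1)])
      show "((\<lambda>y. u j y t) has_derivative (\<lambda>h. \<Sum>i\<in>UNIV. h $ i * G j i x t)) (at x)" for j x
        using J[of j] t unfolding jet_def by blast
      show "\<forall>\<^sub>F j in sequentially. \<forall>i x. \<bar>G j i x t\<bar> \<le> M j"
        by (rule eventually_mono[OF M'(2)]) (use tt in \<open>auto simp: jet_le_def\<close>)
    qed (use sm[OF t] in auto)
    fix i
    show "((\<lambda>y. \<Sum>j. G j i y t) has_derivative (\<lambda>h. \<Sum>k\<in>UNIV. h $ k * (\<Sum>j. H j i k x t))) (at x)"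
    proof (rule has_derivative_grad_series[OF _ M'(1)])
      show "((\<lambda>y. G j i y t) has_derivative (\<lambda>h. \<Sum>k\<in>UNIV. h $ k * H j i k x t)) (at x)" for j x
        using J[of j] t unfolding jet_def by blast
      show "\<forall>\<^sub>F j in sequentially. \<forall>k x. \<bar>H j i k x t\<bar> \<le> M j"
        by (rule eventually_mono[OF M'(2)]) (use tt in \<open>auto simp: jet_le_def\<close>)
    qed (use sm[OF t] in auto)
  next
    have cts: "continuous_on (UNIV \<times> {0<..<T}) (\<lambda>(x, t). \<Sum>j. f j x t)"
      if c: "\<And>j. continuous_on (UNIV \<times> {0<..<T}) (\<lambda>(x, t). f j x t)"
        and le: "\<And>j \<tau> m. jet_le \<tau> T (u j) (D j) (G j) (H j) m \<Longrightarrow> \<forall>x. \<forall>t\<in>{\<tau><..<T}. \<bar>f j x t\<bar> \<le> m" for f :: "nat \<Rightarrow> real^'n \<Rightarrow> real \<Rightarrow> real"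
    proof (rule continuous_on_series_time[OF c])
      fix \<tau> :: real assume "\<tau> > 0"
      from M[OF this] obtain M where M': "summable M" "eventually (\<lambda>j. jet_le \<tau> T (u j) (D j) (G j) (H j) (M j)) sequentially" by blast
      show "\<exists>M. summable M \<and> (\<forall>\<^sub>F j in sequentially. \<forall>x. \<forall>t\<in>{\<tau><..<T}. \<bar>f j x t\<bar> \<le> M j)"
        by (intro exI[of _ M] conjI M'(1) eventually_mono[OF M'(2)] le)
    qed
    show "continuous_on (UNIV \<times> {0<..<T}) (\<lambda>(x, t). \<Sum>j. u j x t)"
      by (rule cts) (use J in \<open>auto simp: jet_def jet_le_def\<close>)
    show "continuous_on (UNIV \<times> {0<..<T}) (\<lambda>(x, t). \<Sum>j. D j x t)"
      by (rule cts) (use J in \<open>auto simp: jet_def jet_le_def\<close>)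
    show "continuous_on (UNIV \<times> {0<..<T}) (\<lambda>(x, t). \<Sum>j. G j i x t)" for i
      by (rule cts) (use J in \<open>auto simp: jet_def jet_le_def\<close>)
    show "continuous_on (UNIV \<times> {0<..<T}) (\<lambda>(x, t). \<Sum>j. H j i k x t)" for i k
      by (rule cts) (use J in \<open>auto simp: jet_def jet_le_def\<close>)
  qed
qed

section \<open>Heat kernels switched on in time\<close>

text \<open>A piecewise polynomial that rises from 0 to 1 on the unit interval, nondecreasing and
  continuously differentiable. Only its first derivative enters the heat operator, so this
  smoothness is enough.\<close>

definition step :: "real \<Rightarrow> real" where
  "step z = 1 - (max 0 (1 - (max 0 z)\<^sup>2))\<^sup>2"

definition step' :: "real \<Rightarrow> real" where
  "step' z = 4 * (max 0 (1 - (max 0 z)\<^sup>2) * max 0 z)"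

lemma DERIV_step: "(step has_real_derivative step' z) (at z)"
proof -
  have p: "((\<lambda>z::real. (max 0 z)\<^sup>2) has_real_derivative 2 * max 0 z) (at z)" for z
    using DERIV_pos_power[of 0 z] by (simp add: numeral_2_eq_2)
  have "((\<lambda>z. 1 - (max 0 z)\<^sup>2) has_real_derivative - (2 * max 0 z)) (at z)"
    using DERIV_diff[OF DERIV_const p[of z], of 1] by simp
  note d = DERIV_chain2[where g = "\<lambda>z. 1 - (max 0 z)\<^sup>2" and x = z, OF p[of "1 - (max 0 z)\<^sup>2"] this]
  show ?thesis unfolding step_def[abs_def] step'_def
    by (rule DERIV_cong[OF DERIV_diff[OF DERIV_const d]]) simp
qed

lemma continuous_step [continuous_intros]:
  "continuous_on S f \<Longrightarrow> continuous_on S (\<lambda>x. step (f x))" "continuous_on S f \<Longrightarrow> continuous_on S (\<lambda>x. step' (f x))"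
  unfolding step_def step'_def by (intro continuous_intros; assumption)+

lemma step_props:
  "z \<le> 0 \<Longrightarrow> step z = 0" "1 \<le> z \<Longrightarrow> step z = 1" "0 \<le> step z" "step z \<le> 1"
  "z \<le> 0 \<Longrightarrow> step' z = 0" "1 \<le> z \<Longrightarrow> step' z = 0" "0 \<le> step' z" "step' z \<le> 4"
proof -
  show "z \<le> 0 \<Longrightarrow> step z = 0" "z \<le> 0 \<Longrightarrow> step' z = 0" by (simp_all add: step_def step'_def max_def)
  have z1: "max 0 (1 - (max 0 z)\<^sup>2) = 0" if "1 \<le> z"
  proof -
    have "1 \<le> (max 0 z)\<^sup>2" using that by simp
    then show ?thesis by (intro max_absorb1) linarith
  qed
  then show "1 \<le> z \<Longrightarrow> step z = 1" "1 \<le> z \<Longrightarrow> step' z = 0" by (simp_all add: step_def step'_def)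
  have m: "0 \<le> max 0 (1 - (max 0 z)\<^sup>2)" "max 0 (1 - (max 0 z)\<^sup>2) \<le> 1" by auto
  then show "0 \<le> step z" unfolding step_def using power_le_one[OF m] by simp
  show "step z \<le> 1" by (simp add: step_def)
  show "0 \<le> step' z" by (simp add: step'_def)
  show "step' z \<le> 4"
  proof (cases "1 \<le> z")
    case True then show ?thesis using z1 by (simp add: step'_def)
  next
    case False
    then have "max 0 (1 - (max 0 z)\<^sup>2) * max 0 z \<le> 1 * 1" using m by (intro mult_mono) auto
    then show ?thesis by (simp add: step'_def)
  qed
qed

lemma DERIV_heat_kernel_time:
  fixes x :: "real^'n"
  assumes "t > a"
  shows "((\<lambda>s. heat_kernel x (s - a)) has_real_derivative
    heat_kernel x (t - a) * ((norm x)\<^sup>2 / (4 * (t - a)\<^sup>2) - real CARD('n) / (2 * (t - a)))) (at t)"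
proof -
  let ?n = "real CARD('n)"
  let ?r = "(norm x)\<^sup>2"
  define E where "E = (\<lambda>s. (4 * pi * (s - a)) powr (- ?n / 2) * exp (- ?r / (4 * (s - a))))"
  have p: "((\<lambda>s. (4 * pi * (s - a)) powr (- ?n / 2)) has_real_derivative
      (4 * pi * (t - a)) powr (- ?n / 2) * (- ?n / (2 * (t - a)))) (at t)"
  proof -
    have "((\<lambda>s. 4 * pi * (s - a)) has_real_derivative 4 * pi) (at t)" by (auto intro!: derivative_eq_intros)
    from DERIV_fun_powr[OF this, of "- ?n / 2"] assms
    have *: "((\<lambda>s. (4 * pi * (s - a)) powr (- ?n / 2)) has_real_derivative
      - ?n / 2 * (4 * pi * (t - a)) powr (- ?n / 2 - 1) * (4 * pi)) (at t)" by simp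
    have "(4 * pi * (t - a)) powr (- ?n / 2 - 1) = (4 * pi * (t - a)) powr (- ?n / 2) / (4 * pi * (t - a))"
      using assms by (subst powr_diff) simp
    moreover have "- k / 2 * (p / X) * c = p * (- k / 2 * c / X)" for k p X c :: real by simp
    ultimately have "- ?n / 2 * (4 * pi * (t - a)) powr (- ?n / 2 - 1) * (4 * pi)
       = (4 * pi * (t - a)) powr (- ?n / 2) * (- ?n / 2 * (4 * pi) / (4 * pi * (t - a)))" by (simp only:)
    also have "- ?n / 2 * (4 * pi) / (4 * pi * (t - a)) = - ?n / (2 * (t - a))" using assms by (simp add: field_simps)
    finally show ?thesis by (rule DERIV_cong[OF *])
  qed
  have e: "((\<lambda>s. exp (- ?r / (4 * (s - a)))) has_real_derivative
      exp (- ?r / (4 * (t - a))) * (?r / (4 * (t - a)\<^sup>2))) (at t)"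
  proof -
    have "((\<lambda>s. s - a) has_real_derivative 1) (at t)" by (auto intro!: derivative_eq_intros)
    from DERIV_cmult[OF DERIV_inverse_fun[OF this], of "- ?r / 4"] assms
    have "((\<lambda>s. - ?r / (4 * (s - a))) has_real_derivative ?r / (4 * (t - a)\<^sup>2)) (at t)"
      by (simp add: field_simps power2_eq_square)
    then show ?thesis by (rule DERIV_fun_exp)
  qed
  have "(E has_real_derivative E t * (?r / (4 * (t - a)\<^sup>2) - ?n / (2 * (t - a)))) (at t)"
    unfolding E_def by (rule DERIV_cong[OF DERIV_mult[OF p e]]) (simp add: algebra_simps)
  then have "((\<lambda>s. heat_kernel x (s - a)) has_real_derivative E t * (?r / (4 * (t - a)\<^sup>2) - ?n / (2 * (t - a)))) (at t)"
    by (rule has_field_derivative_transform_within_open[of _ _ _ "{a<..}"]) (use assms in \<open>auto simp: E_def heat_kernel_def\<close>)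
  moreover have "E t = heat_kernel x (t - a)" using assms by (simp add: E_def heat_kernel_def)
  ultimately show ?thesis by simp
qed

text \<open>No sign of \<tau> is assumed: for \<tau> \<le> 0 the kernel vanishes identically, and so
  does the formula.\<close>

lemma has_derivative_heat_kernel_space:
  fixes x x0 :: "real^'n"
  shows "((\<lambda>y. heat_kernel (y - x0) \<tau>) has_derivative
    (\<lambda>h. \<Sum>i\<in>UNIV. h $ i * (- heat_kernel (x - x0) \<tau> * (x - x0) $ i / (2 * \<tau>)))) (at x)"
proof (cases "\<tau> > 0")
  case False
  then show ?thesis by (simp add: heat_kernel_def)
next
  case True
  have n2: "((\<lambda>y. (y - x0) \<bullet> (y - x0)) has_derivative (\<lambda>h. 2 * ((x - x0) \<bullet> h))) (at x)"
    by (auto intro!: derivative_eq_intros simp: inner_commute)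
  have "((\<lambda>y. (4 * pi * \<tau>) powr (- real CARD('n) / 2) * exp (- 1 / (4 * \<tau>) * ((y - x0) \<bullet> (y - x0)))) has_derivative
     (\<lambda>h. (4 * pi * \<tau>) powr (- real CARD('n) / 2) * (exp (- 1 / (4 * \<tau>) * ((x - x0) \<bullet> (x - x0))) * (- 1 / (4 * \<tau>) * (2 * ((x - x0) \<bullet> h)))))) (at x)"
  proof -
    note d = has_derivative_mult_right[OF has_derivative_exp[OF has_derivative_mult_right[OF n2]]]
    show ?thesis by (rule has_derivative_eq_rhs[OF d]) (simp add: mult_ac)
  qed
  moreover have "(\<lambda>y. (4 * pi * \<tau>) powr (- real CARD('n) / 2) * exp (- 1 / (4 * \<tau>) * ((y - x0) \<bullet> (y - x0)))) = (\<lambda>y. heat_kernel (y - x0) \<tau>)"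
    using True by (simp add: heat_kernel_def power2_norm_eq_inner)
  moreover have "(4 * pi * \<tau>) powr (- real CARD('n) / 2) * (exp (- 1 / (4 * \<tau>) * ((x - x0) \<bullet> (x - x0))) * (- 1 / (4 * \<tau>) * (2 * ((x - x0) \<bullet> h))))
     = (\<Sum>i\<in>UNIV. h $ i * (- heat_kernel (x - x0) \<tau> * (x - x0) $ i / (2 * \<tau>)))" for h
  proof -
    have k: "(4 * pi * \<tau>) powr (- real CARD('n) / 2) * exp (- 1 / (4 * \<tau>) * ((x - x0) \<bullet> (x - x0))) = heat_kernel (x - x0) \<tau>"
      using True by (simp add: heat_kernel_def power2_norm_eq_inner)
    have "(\<Sum>i\<in>UNIV. h $ i * (- heat_kernel (x - x0) \<tau> * (x - x0) $ i / (2 * \<tau>)))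
       = (\<Sum>i\<in>UNIV. - heat_kernel (x - x0) \<tau> / (2 * \<tau>) * ((x - x0) $ i * h $ i))"
      by (intro sum.cong) auto
    also have "\<dots> = - heat_kernel (x - x0) \<tau> / (2 * \<tau>) * ((x - x0) \<bullet> h)"
      by (simp only: sum_distrib_left[symmetric] inner_vec_def inner_real_def)
    finally show ?thesis unfolding mult.assoc[symmetric] k using True by simp
  qed
  ultimately show ?thesis by simp
qed

lemma continuous_heat_kernel:
  "continuous_on (UNIV \<times> {a<..}) (\<lambda>z. heat_kernel (fst z - x0 :: real^'n) (snd z - a))"
proof -
  have "continuous_on (UNIV \<times> {a<..}) (\<lambda>z. (4 * pi * (snd z - a)) powr (- real CARD('n) / 2) * exp (- (norm (fst z - x0 :: real^'n))\<^sup>2 / (4 * (snd z - a))))"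
    by (intro continuous_intros) auto
  then show ?thesis by (rule continuous_on_eq) (auto simp: heat_kernel_def)
qed

text \<open>The amplitude c vanishes until time a + e, while the kernel starts at time a, so its
  singularity at (x0, a) is multiplied by 0. Continuity is glued from the overlapping open regions t
  < a + e and t > a.\<close>

lemma jet_heat_kernel:
  fixes x0 :: "real^'n" and c c' :: "real \<Rightarrow> real"
  assumes c: "\<And>t. (c has_real_derivative c' t) (at t)" and c': "continuous_on UNIV c'"
    and z: "\<And>t. t < a + e \<Longrightarrow> c t = 0 \<and> c' t = 0" and e: "e > 0"
  defines "k \<equiv> \<lambda>x t. heat_kernel (x - x0) (t - a)"
  shows "jet T (\<lambda>x t. c t * k x t)
    (\<lambda>x t. c' t * k x t + c t * (k x t * ((norm (x - x0))\<^sup>2 / (4 * (t - a)\<^sup>2) - real CARD('n) / (2 * (t - a)))))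
    (\<lambda>i x t. c t * (- k x t * (x - x0) $ i / (2 * (t - a))))
    (\<lambda>i j x t. c t * (k x t * ((x - x0) $ i * (x - x0) $ j / (4 * (t - a)\<^sup>2) - (if i = j then 1 / (2 * (t - a)) else 0))))"
  unfolding jet_def
proof (intro conjI allI ballI)
  fix x t
  show "((\<lambda>s. c s * k x s) has_real_derivative c' t * k x t + c t * (k x t * ((norm (x - x0))\<^sup>2 / (4 * (t - a)\<^sup>2) - real CARD('n) / (2 * (t - a))))) (at t)"
  proof (cases "t > a")
    case True
    show ?thesis unfolding k_def
      by (rule DERIV_cong[OF DERIV_mult[OF c DERIV_heat_kernel_time[OF True]]]) (simp add: algebra_simps)
  next
    case False
    have "((\<lambda>s. c s * k x s) has_real_derivative 0) (at t)"
      by (rule has_field_derivative_transform_within_open[of "\<lambda>_. 0" _ _ "{..<a + e}"]) (use z False e in auto)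
    then show ?thesis using z[of t] False e by simp
  qed
  show d1: "((\<lambda>y. c t * k y t) has_derivative (\<lambda>h. \<Sum>i\<in>UNIV. h $ i * (c t * (- k x t * (x - x0) $ i / (2 * (t - a)))))) (at x)"
    unfolding k_def
    using has_derivative_mult_right[OF has_derivative_heat_kernel_space[of x0 "t - a" x], of "c t"]
    by (simp add: sum_distrib_left mult_ac)
  fix i
  have l: "((\<lambda>y. (y - x0) $ i) has_derivative (\<lambda>h. h $ i)) (at x)"
  proof -
    have "((\<lambda>y. y $ i - x0 $ i) has_derivative (\<lambda>h. h $ i)) (at x)"
      by (auto intro!: derivative_eq_intros bounded_linear.has_derivative[OF bounded_linear_vec_nth])
    then show ?thesis by simp
  qed
  have "((\<lambda>y. - c t / (2 * (t - a)) * (heat_kernel (y - x0) (t - a) * (y - x0) $ i)) has_derivative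
    (\<lambda>h. - c t / (2 * (t - a)) * (heat_kernel (x - x0) (t - a) * h $ i + (\<Sum>j\<in>UNIV. h $ j * (- heat_kernel (x - x0) (t - a) * (x - x0) $ j / (2 * (t - a)))) * (x - x0) $ i))) (at x)"
    by (intro has_derivative_mult_right has_derivative_mult has_derivative_heat_kernel_space l)
  moreover have "(\<lambda>y. - c t / (2 * (t - a)) * (heat_kernel (y - x0) (t - a) * (y - x0) $ i)) = (\<lambda>y. c t * (- k y t * (y - x0) $ i / (2 * (t - a))))"
    by (auto simp: k_def)
  moreover have "- c t / (2 * (t - a)) * (heat_kernel (x - x0) (t - a) * h $ i + (\<Sum>j\<in>UNIV. h $ j * (- heat_kernel (x - x0) (t - a) * (x - x0) $ j / (2 * (t - a)))) * (x - x0) $ i)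
    = (\<Sum>j\<in>UNIV. h $ j * (c t * (k x t * ((x - x0) $ i * (x - x0) $ j / (4 * (t - a)\<^sup>2) - (if i = j then 1 / (2 * (t - a)) else 0)))))" for h
  proof -
    have "(\<Sum>j\<in>UNIV. h $ j * (c t * (k x t * ((x - x0) $ i * (x - x0) $ j / (4 * (t - a)\<^sup>2) - (if i = j then 1 / (2 * (t - a)) else 0)))))
      = (\<Sum>j\<in>UNIV. - c t / (2 * (t - a)) * ((h $ j * (- k x t * (x - x0) $ j / (2 * (t - a)))) * (x - x0) $ i)
          + (if i = j then - c t / (2 * (t - a)) * (k x t * h $ j) else 0))"
    proof -
      have id: "hj * (cc * (kk * (xi * xj / (4 * \<tau>\<^sup>2) - d))) = - cc / (2 * \<tau>) * ((hj * (- kk * xj / (2 * \<tau>))) * xi) + - cc * (kk * hj) * d"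
        for hj cc kk xi xj \<tau> d :: real
        by (cases "\<tau> = 0") (auto simp: field_simps power2_eq_square)
      show ?thesis by (intro sum.cong refl, subst id) simp
    qed
    also have "\<dots> = - c t / (2 * (t - a)) * ((\<Sum>j\<in>UNIV. h $ j * (- k x t * (x - x0) $ j / (2 * (t - a)))) * (x - x0) $ i) + - c t / (2 * (t - a)) * (k x t * h $ i)"
      by (simp only: sum.distrib sum_distrib_left[symmetric] sum_distrib_right[symmetric] sum.delta finite_class.finite_UNIV) simp
    finally show ?thesis by (simp add: k_def distrib_left)
  qed
  ultimately show "((\<lambda>y. c t * (- k y t * (y - x0) $ i / (2 * (t - a)))) has_derivative
    (\<lambda>h. \<Sum>j\<in>UNIV. h $ j * (c t * (k x t * ((x - x0) $ i * (x - x0) $ j / (4 * (t - a)\<^sup>2) - (if i = j then 1 / (2 * (t - a)) else 0)))))) (at x)"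
    by simp
next
  have cc: "continuous_on UNIV c" by (rule DERIV_continuous_on, rule has_field_derivative_at_within, rule c)
  have cs: "continuous_on (UNIV \<times> {a<..}) (\<lambda>z::(real^'n) \<times> real. c (snd z))" "continuous_on (UNIV \<times> {a<..}) (\<lambda>z::(real^'n) \<times> real. c' (snd z))"
    by (rule continuous_on_compose2[OF cc] continuous_on_compose2[OF c'], (intro continuous_intros, simp))+
  have glue: "continuous_on (UNIV \<times> {0<..<T}) F"
    if "continuous_on (UNIV \<times> {a<..}) F" "\<And>x t. t < a + e \<Longrightarrow> F (x, t) = 0" for F :: "(real^'n) \<times> real \<Rightarrow> real"
  proof -
    have "continuous_on (UNIV \<times> {..<a + e}) (\<lambda>_::(real^'n) \<times> real. 0::real)" by simp
    then have "continuous_on (UNIV \<times> {..<a + e}) F"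
      by (rule continuous_on_eq) (use that(2) in auto)
    then have "continuous_on (UNIV \<times> {..<a + e} \<union> UNIV \<times> {a<..}) F"
      using that(1) by (intro continuous_on_open_Un open_Times) auto
    then show ?thesis by (rule continuous_on_subset) (use e in auto)
  qed
  note ck = continuous_heat_kernel[of a x0]
  show "continuous_on (UNIV \<times> {0<..<T}) (\<lambda>(x, t). c t * k x t)" unfolding k_def
    by (rule glue) (use z in \<open>auto simp: split_beta intro!: continuous_on_mult cs ck\<close>)
  show "continuous_on (UNIV \<times> {0<..<T}) (\<lambda>(x, t). c' t * k x t + c t * (k x t * ((norm (x - x0))\<^sup>2 / (4 * (t - a)\<^sup>2) - real CARD('n) / (2 * (t - a)))))"
    unfolding k_def split_beta
    by (rule glue; (intro continuous_intros cs ck)?; use z in auto)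
  fix i
  show "continuous_on (UNIV \<times> {0<..<T}) (\<lambda>(x, t). c t * (- k x t * (x - x0) $ i / (2 * (t - a))))"
    unfolding k_def split_beta
    by (rule glue; (intro continuous_intros cs ck)?; use z in auto)
  fix j
  have ij: "continuous_on (UNIV \<times> {a<..}) (\<lambda>z::(real^'n) \<times> real. if i = j then 1 / (2 * (snd z - a)) else 0)"
    by (cases "i = j") (auto intro!: continuous_intros)
  show "continuous_on (UNIV \<times> {0<..<T}) (\<lambda>(x, t). c t * (k x t * ((x - x0) $ i * (x - x0) $ j / (4 * (t - a)\<^sup>2) - (if i = j then 1 / (2 * (t - a)) else 0))))"
    unfolding k_def split_beta
    by (rule glue; (intro continuous_intros cs ck ij)?; use z in auto)
qed

text \<open>With Q = \<tau>0^(-n/2) the kernel is at most Q, and y exp (-y) \<le> 1 at y = |x|^2 /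
  (4 \<tau>) bounds its product with y by Q as well; further factors 1/\<tau> cost 1/\<tau>0. One
  crude bound common to all derivatives is enough for a majorant.\<close>

lemma heat_kernel_derivative_bounds:
  fixes x :: "real^'n"
  assumes "\<tau>0 > 0" "\<tau>0 \<le> \<tau>"
  defines "B \<equiv> \<tau>0 powr (- real CARD('n) / 2) * (3 + (2 + real CARD('n)) / \<tau>0)"
  shows "\<bar>heat_kernel x \<tau>\<bar> \<le> B"
    "\<bar>heat_kernel x \<tau> * ((norm x)\<^sup>2 / (4 * \<tau>\<^sup>2) - real CARD('n) / (2 * \<tau>))\<bar> \<le> B"
    "\<bar>- heat_kernel x \<tau> * x $ i / (2 * \<tau>)\<bar> \<le> B"
    "\<bar>heat_kernel x \<tau> * (x $ i * x $ j / (4 * \<tau>\<^sup>2) - (if i = j then 1 / (2 * \<tau>) else 0))\<bar> \<le> B"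
proof -
  let ?n = "real CARD('n)"
  define Q where "Q = \<tau>0 powr (- ?n / 2)"
  define k where "k = heat_kernel x \<tau>"
  define r where "r = (norm x)\<^sup>2"
  have \<tau>: "\<tau> > 0" using assms by simp
  have k0: "0 \<le> k" by (simp add: k_def heat_kernel_nonneg)
  have Q0: "Q > 0" using assms by (simp add: Q_def)
  have "k \<le> \<tau> powr (- ?n / 2)" unfolding k_def by (rule heat_kernel_le[OF \<tau>])
  also have pQ: "\<tau> powr (- ?n / 2) \<le> Q" unfolding Q_def using assms by (intro powr_mono2') auto
  finally have kQ: "k \<le> Q" .
  have kr: "k * (r / (4 * \<tau>)) \<le> Q"
  proof -
    define y where "y = r / (4 * \<tau>)"
    have y0: "y \<ge> 0" using \<tau> by (simp add: y_def r_def)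
    have "y \<le> exp y" using exp_ge_add_one_self[of y] by linarith
    then have "exp (- y) * y \<le> 1" by (simp add: exp_minus field_simps)
    moreover have "k = (4 * pi * \<tau>) powr (- ?n / 2) * exp (- y)" using \<tau> by (simp add: k_def heat_kernel_def y_def r_def)
    ultimately have "k * y \<le> (4 * pi * \<tau>) powr (- ?n / 2) * 1"
      using mult_left_mono[of "exp (- y) * y" 1 "(4 * pi * \<tau>) powr (- ?n / 2)"] by (simp add: mult.assoc)
    also have "\<dots> \<le> \<tau> powr (- ?n / 2)" using \<tau> pi_ge_two by (simp, intro powr_mono2') auto
    finally show ?thesis using pQ by (simp add: y_def)
  qed
  have i0: "1 / \<tau> \<le> 1 / \<tau>0" using assms by (intro divide_left_mono) auto
  have B: "B = 3 * Q + (2 + ?n) * (Q * (1 / \<tau>0))" by (simp add: B_def Q_def algebra_simps)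
  have Qt: "0 \<le> Q * (1 / \<tau>0)" using Q0 assms by simp
  have krt: "k * (r / (4 * \<tau>\<^sup>2)) \<le> Q * (1 / \<tau>0)"
  proof -
    have "k * (r / (4 * \<tau>\<^sup>2)) = k * (r / (4 * \<tau>)) * (1 / \<tau>)" by (simp add: power2_eq_square)
    also have "\<dots> \<le> Q * (1 / \<tau>0)" using kr i0 \<tau> Q0 by (intro mult_mono) auto
    finally show ?thesis .
  qed
  have kt: "k * (1 / \<tau>) \<le> Q * (1 / \<tau>0)" using kQ i0 \<tau> Q0 by (intro mult_mono) auto
  have r0: "0 \<le> r" by (simp add: r_def)
  define q where "q = Q * (1 / \<tau>0)"
  define N where "N = ?n * q"
  define p1 where "p1 = k * (1 / \<tau>)"
  define p2 where "p2 = k * (r / (4 * \<tau>\<^sup>2))"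
  define p3 where "p3 = k * (r / (4 * \<tau>))"
  have Bq: "B = 3 * Q + 2 * q + N" unfolding B q_def N_def by (simp only: distrib_right add.assoc)
  have p1: "0 \<le> p1" "p1 \<le> q" using kt k0 \<tau> by (auto simp: p1_def q_def)
  have p2: "0 \<le> p2" "p2 \<le> q" using krt k0 r0 by (auto simp: p2_def q_def)
  have p3: "p3 \<le> Q" using kr by (simp add: p3_def)
  have qN: "0 \<le> q" "0 \<le> N" unfolding N_def q_def by (rule Qt, rule mult_nonneg_nonneg[OF of_nat_0_le_iff Qt])
  have np: "?n * p1 \<le> N" unfolding N_def using p1 by (intro mult_left_mono) auto
  have np0: "0 \<le> ?n * p1" using p1 by simp
  show "\<bar>heat_kernel x \<tau>\<bar> \<le> B" unfolding k_def[symmetric] Bq using k0 kQ Q0 qN by linarith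
  have e2: "k * (r / (4 * \<tau>\<^sup>2) - ?n / (2 * \<tau>)) = p2 - ?n * p1 / 2"
    by (simp add: right_diff_distrib p1_def p2_def mult_ac)
  show "\<bar>heat_kernel x \<tau> * ((norm x)\<^sup>2 / (4 * \<tau>\<^sup>2) - ?n / (2 * \<tau>))\<bar> \<le> B"
    unfolding k_def[symmetric] r_def[symmetric] unfolding e2 Bq using p2 np np0 Q0 qN by linarith
  have xi: "\<bar>x $ i\<bar> \<le> norm x" for i by (rule component_le_norm_cart)
  have "\<bar>- k * x $ i / (2 * \<tau>)\<bar> = k * \<bar>x $ i\<bar> / (2 * \<tau>)" using k0 \<tau> by (simp add: abs_mult abs_divide)
  also have "\<dots> \<le> k * (1 + r) / (2 * \<tau>)"
  proof -
    have "0 \<le> (norm x - 1)\<^sup>2" by simp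
    then have "2 * norm x \<le> 1 + r" unfolding r_def by (simp add: power2_diff)
    then have "norm x \<le> 1 + r" using norm_ge_zero[of x] by linarith
    then show ?thesis using xi[of i] k0 \<tau> by (intro divide_right_mono mult_left_mono) auto
  qed
  also have "\<dots> = p1 / 2 + 2 * p3" using \<tau> by (simp add: p1_def p3_def field_simps)
  finally show "\<bar>- heat_kernel x \<tau> * x $ i / (2 * \<tau>)\<bar> \<le> B"
    unfolding k_def[symmetric] Bq using p1 p3 Q0 qN by linarith
  have "\<bar>x $ i * x $ j\<bar> \<le> r"
    unfolding r_def power2_eq_square abs_mult using xi by (intro mult_mono) auto
  then have h1: "k * (\<bar>x $ i * x $ j\<bar> / (4 * \<tau>\<^sup>2)) \<le> p2"
    unfolding p2_def using k0 by (intro mult_left_mono divide_right_mono) auto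
  have "\<bar>k * (x $ i * x $ j / (4 * \<tau>\<^sup>2) - (if i = j then 1 / (2 * \<tau>) else 0))\<bar>
     \<le> k * (\<bar>x $ i * x $ j\<bar> / (4 * \<tau>\<^sup>2)) + p1 / 2"
  proof -
    have "\<bar>x $ i * x $ j / (4 * \<tau>\<^sup>2) - (if i = j then 1 / (2 * \<tau>) else 0)\<bar> \<le> \<bar>x $ i * x $ j\<bar> / (4 * \<tau>\<^sup>2) + 1 / (2 * \<tau>)"
      using abs_triangle_ineq4[of "x $ i * x $ j / (4 * \<tau>\<^sup>2)" "if i = j then 1 / (2 * \<tau>) else 0"] \<tau>
      by (auto simp: abs_divide split: if_splits)
    from mult_left_mono[OF this k0] show ?thesis using k0 by (simp add: abs_mult distrib_left p1_def)
  qed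
  then show "\<bar>heat_kernel x \<tau> * (x $ i * x $ j / (4 * \<tau>\<^sup>2) - (if i = j then 1 / (2 * \<tau>) else 0))\<bar> \<le> B"
    unfolding k_def[symmetric] Bq using h1 p1 p2 Q0 qN by linarith
qed

section \<open>Cascades of bumps\<close>

text \<open>
  A bump of parameter \<open>\<rho>\<close> has height of order \<open>\<rho>\<^sup>-\<^sup>b\<close> and width of order \<open>\<rho>\<^bsup>1/2\<^esup>\<close>. Assumption \<open>b\<kappa>\<close> makes its nonlocal
  term exceed the source of the bump of parameter \<open>q\<rho>\<close> once \<open>\<rho>\<close> is small, \<open>b\<epsilon>\<close> makes the \<open>L\<^sup>l\<close> norms summable over
  a cascade, and \<open>bn\<close> the masses. The bound on \<open>q\<close> by \<open>1/(2l)\<close> lets the Gaussian tail of the \<open>l\<close>-th power of a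
  bump dominate the tail of the next one.
\<close>

locale cascade =
  fixes x0 :: "real^'n" and \<alpha> l T b q :: real
  assumes al: "0 < \<alpha>" and T: "T > 0"
    and l1: "l > 1" and ln: "l > (real CARD('n) + 2) / real CARD('n)"
    and b0: "b > 0" and bn: "b < real CARD('n) / 2"
    and b\<kappa>: "b * l - (real CARD('n) + 2 - \<alpha>) / 2 - b - 1 > 0"
    and b\<epsilon>: "1 + real CARD('n) / 2 - b * l > 0"
    and q0: "0 < q" and q8: "q \<le> 1 / 8" and ql: "q \<le> 1 / (2 * l)"
    and q\<epsilon>: "2 powr l * q powr (1 + real CARD('n) / 2 - b * l) \<le> 1 / 2"
    and qm: "q powr (real CARD('n) / 2 - b) \<le> 1 / 2"
begin

text \<open>The spatial integral of a bump that is fully switched on. A kernel of age about \<rho>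
  has height of order \<rho>^(-n/2), so this amplitude produces the height \<rho>^(-b).\<close>

definition mass :: "real \<Rightarrow> real" where "mass \<rho> = \<rho> powr (real CARD('n) / 2 - b)"

definition amp :: "real \<Rightarrow> real \<Rightarrow> real \<Rightarrow> real" where
  "amp s \<rho> t = mass \<rho> * step (2 * (t - s + \<rho>) / \<rho>)"

definition amp' :: "real \<Rightarrow> real \<Rightarrow> real \<Rightarrow> real" where
  "amp' s \<rho> t = mass \<rho> * (step' (2 * (t - s + \<rho>) / \<rho>) * (2 / \<rho>))"

definition ker :: "real \<Rightarrow> real \<Rightarrow> real^'n \<Rightarrow> real \<Rightarrow> real" where
  "ker s \<rho> x t = heat_kernel (x - x0) (t - (s - 2 * \<rho>))"

text \<open>The bump is switched on between the times \<open>s - \<rho>\<close> and \<open>s - \<rho>/2\<close>; its heat kernel starts at \<open>s - 2\<rho>\<close>.\<close>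

definition bump :: "real \<Rightarrow> real \<Rightarrow> real^'n \<Rightarrow> real \<Rightarrow> real" where
  "bump s \<rho> x t = amp s \<rho> t * ker s \<rho> x t"

definition src :: "real \<Rightarrow> real \<Rightarrow> real^'n \<Rightarrow> real \<Rightarrow> real" where
  "src s \<rho> x t = amp' s \<rho> t * ker s \<rho> x t"

definition bumpD :: "real \<Rightarrow> real \<Rightarrow> real^'n \<Rightarrow> real \<Rightarrow> real" where
  "bumpD s \<rho> x t = amp' s \<rho> t * ker s \<rho> x t + amp s \<rho> t * (ker s \<rho> x t *
     ((norm (x - x0))\<^sup>2 / (4 * (t - (s - 2 * \<rho>))\<^sup>2) - real CARD('n) / (2 * (t - (s - 2 * \<rho>)))))"

definition bumpG :: "real \<Rightarrow> real \<Rightarrow> 'n \<Rightarrow> real^'n \<Rightarrow> real \<Rightarrow> real" where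
  "bumpG s \<rho> i x t = amp s \<rho> t * (- ker s \<rho> x t * (x - x0) $ i / (2 * (t - (s - 2 * \<rho>))))"

definition bumpH :: "real \<Rightarrow> real \<Rightarrow> 'n \<Rightarrow> 'n \<Rightarrow> real^'n \<Rightarrow> real \<Rightarrow> real" where
  "bumpH s \<rho> i j x t = amp s \<rho> t * (ker s \<rho> x t * ((x - x0) $ i * (x - x0) $ j / (4 * (t - (s - 2 * \<rho>))\<^sup>2)
     - (if i = j then 1 / (2 * (t - (s - 2 * \<rho>))) else 0)))"

lemma mass_pos: "\<rho> > 0 \<Longrightarrow> mass \<rho> > 0" by (simp add: mass_def)

lemma jet_bump:
  assumes "\<rho> > 0"
  shows "jet T (bump s \<rho>) (bumpD s \<rho>) (bumpG s \<rho>) (bumpH s \<rho>)"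
proof -
  have "jet T (\<lambda>x t. amp s \<rho> t * heat_kernel (x - x0) (t - (s - 2 * \<rho>)))
    (\<lambda>x t. amp' s \<rho> t * heat_kernel (x - x0) (t - (s - 2 * \<rho>)) + amp s \<rho> t * (heat_kernel (x - x0) (t - (s - 2 * \<rho>)) * ((norm (x - x0))\<^sup>2 / (4 * (t - (s - 2 * \<rho>))\<^sup>2) - real CARD('n) / (2 * (t - (s - 2 * \<rho>))))))
    (\<lambda>i x t. amp s \<rho> t * (- heat_kernel (x - x0) (t - (s - 2 * \<rho>)) * (x - x0) $ i / (2 * (t - (s - 2 * \<rho>)))))
    (\<lambda>i j x t. amp s \<rho> t * (heat_kernel (x - x0) (t - (s - 2 * \<rho>)) * ((x - x0) $ i * (x - x0) $ j / (4 * (t - (s - 2 * \<rho>))\<^sup>2) - (if i = j then 1 / (2 * (t - (s - 2 * \<rho>))) else 0))))"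
  proof (rule jet_heat_kernel[where e = \<rho>])
    fix t
    have "((\<lambda>t. 2 * (t - s + \<rho>) / \<rho>) has_real_derivative 2 / \<rho>) (at t)"
      using assms by (auto intro!: derivative_eq_intros)
    from DERIV_cmult[OF DERIV_chain2[where g = "\<lambda>t. 2 * (t - s + \<rho>) / \<rho>" and x = t, OF DERIV_step this], of "mass \<rho>"]
    show "(amp s \<rho> has_real_derivative amp' s \<rho> t) (at t)" unfolding amp_def[abs_def] amp'_def .
    assume "t < s - 2 * \<rho> + \<rho>"
    then have "2 * (t - s + \<rho>) / \<rho> \<le> 0" using assms by (simp add: divide_nonpos_pos)
    then show "amp s \<rho> t = 0 \<and> amp' s \<rho> t = 0" by (simp add: amp_def amp'_def step_props)
  next
    show "continuous_on UNIV (amp' s \<rho>)" unfolding amp'_def using assms by (intro continuous_intros) auto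
  qed (rule assms)
  then show ?thesis
    unfolding bump_def[abs_def] bumpD_def[abs_def] bumpG_def[abs_def] bumpH_def[abs_def] ker_def .
qed

text \<open>The kernel solves the heat equation, so only the derivative of the amplitude survives in
  the heat operator of a bump.\<close>

lemma src_eq: "src s \<rho> x t = bumpD s \<rho> x t - (\<Sum>i\<in>UNIV. bumpH s \<rho> i i x t)"
proof -
  define \<tau> where "\<tau> = t - (s - 2 * \<rho>)"
  have nn: "(\<Sum>i\<in>UNIV. (x - x0) $ i * (x - x0) $ i) = (norm (x - x0))\<^sup>2"
    unfolding power2_norm_eq_inner by (simp add: inner_vec_def)
  have "(\<Sum>i\<in>UNIV. bumpH s \<rho> i i x t) = amp s \<rho> t * (ker s \<rho> x t * (\<Sum>i\<in>UNIV. (x - x0) $ i * (x - x0) $ i / (4 * \<tau>\<^sup>2) - 1 / (2 * \<tau>)))"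
    unfolding bumpH_def \<tau>_def[symmetric] by (simp add: sum_distrib_left)
  also have "(\<Sum>i\<in>UNIV. (x - x0) $ i * (x - x0) $ i / (4 * \<tau>\<^sup>2) - 1 / (2 * \<tau>)) = (norm (x - x0))\<^sup>2 / (4 * \<tau>\<^sup>2) - real CARD('n) / (2 * \<tau>)"
    unfolding nn[symmetric] by (simp only: sum_subtractf sum_divide_distrib) simp
  finally show ?thesis unfolding src_def bumpD_def \<tau>_def by simp
qed

lemma ker_nonneg: "0 \<le> ker s \<rho> x t" by (simp add: ker_def heat_kernel_nonneg)

lemma bump_nonneg: "\<rho> > 0 \<Longrightarrow> 0 \<le> bump s \<rho> x t"
  using mass_pos[of \<rho>] step_props(3) by (simp add: bump_def amp_def ker_nonneg)

lemma src_nonneg: "\<rho> > 0 \<Longrightarrow> 0 \<le> src s \<rho> x t"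
  using mass_pos[of \<rho>] step_props(7) by (simp add: src_def amp'_def ker_nonneg)

lemma src_zero:
  assumes "\<rho> > 0" "t \<le> s - \<rho> \<or> s - \<rho> / 2 \<le> t"
  shows "src s \<rho> x t = 0"
proof -
  have "2 * (t - s + \<rho>) / \<rho> \<le> 0 \<or> 1 \<le> 2 * (t - s + \<rho>) / \<rho>" using assms by (auto simp: field_simps)
  then have "step' (2 * (t - s + \<rho>) / \<rho>) = 0" using step_props(5,6) by blast
  then show ?thesis by (simp add: src_def amp'_def)
qed

lemma amp_after: "\<rho> > 0 \<Longrightarrow> s - \<rho> / 2 \<le> t \<Longrightarrow> amp s \<rho> t = mass \<rho>"
  by (subst amp_def, subst step_props(2)) (auto simp: field_simps)

lemma amp'_after: "\<rho> > 0 \<Longrightarrow> s - \<rho> / 2 \<le> t \<Longrightarrow> amp' s \<rho> t = 0"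
  by (subst amp'_def, subst step_props(6)) (auto simp: field_simps)

lemma mass_times: "\<rho> > 0 \<Longrightarrow> mass \<rho> * \<rho> powr (- real CARD('n) / 2) = \<rho> powr (- b)"
  unfolding mass_def powr_add[symmetric] by simp

lemma bump_center:
  assumes "\<rho> > 0"
  shows "bump s \<rho> x0 s = (8 * pi) powr (- real CARD('n) / 2) * \<rho> powr (- b)"
proof -
  have "ker s \<rho> x0 s = (8 * pi * \<rho>) powr (- real CARD('n) / 2)"
    using assms by (simp add: ker_def heat_kernel_def mult_ac)
  also have "\<dots> = (8 * pi) powr (- real CARD('n) / 2) * \<rho> powr (- real CARD('n) / 2)"
    using assms by (simp add: powr_mult)
  finally show ?thesis
    unfolding mass_times[OF assms, symmetric] using assms by (simp add: bump_def amp_after)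
qed

lemma bump_measurable [measurable]: "(\<lambda>z. bump s \<rho> (fst z) (snd z)) \<in> borel_measurable borel"
proof -
  note [measurable (raw)] = borel_measurable_fst_snd
  have [measurable]: "step \<in> borel_measurable borel"
    by (rule borel_measurable_continuous_onI) (intro continuous_intros)
  show ?thesis unfolding bump_def amp_def ker_def by measurable
qed

text \<open>The common constant of \<open>heat_kernel_derivative_bounds\<close>, as a function of
  the age of the kernel.\<close>

definition tail_bound :: "real \<Rightarrow> real" where
  "tail_bound \<tau> = \<tau> powr (- real CARD('n) / 2) * (3 + (2 + real CARD('n)) / \<tau>)"

text \<open>From time s on the amplitude is constant, and after a further \<tau> the kernel has age
  at least \<tau>. All derivatives are then controlled by the mass, which is small for small \<rho>,
  however high the bump was at time s.\<close>

lemma bump_tail: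
  assumes "\<rho> > 0" "\<tau> > 0" "s + \<tau> \<le> t"
  shows "\<bar>bump s \<rho> x t\<bar> \<le> mass \<rho> * tail_bound \<tau>" "\<bar>bumpD s \<rho> x t\<bar> \<le> mass \<rho> * tail_bound \<tau>"
    "\<bar>bumpG s \<rho> i x t\<bar> \<le> mass \<rho> * tail_bound \<tau>" "\<bar>bumpH s \<rho> i j x t\<bar> \<le> mass \<rho> * tail_bound \<tau>"
proof -
  have t: "\<tau> \<le> t - (s - 2 * \<rho>)" "s - \<rho> / 2 \<le> t" using assms by auto
  note B = heat_kernel_derivative_bounds[OF assms(2) t(1), of "x - x0", folded tail_bound_def]
  have m: "\<bar>mass \<rho> * y\<bar> \<le> mass \<rho> * tail_bound \<tau>" if "\<bar>y\<bar> \<le> tail_bound \<tau>" for y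
    using that mass_pos[OF assms(1)] by (simp add: abs_mult)
  show "\<bar>bump s \<rho> x t\<bar> \<le> mass \<rho> * tail_bound \<tau>" "\<bar>bumpD s \<rho> x t\<bar> \<le> mass \<rho> * tail_bound \<tau>"
    "\<bar>bumpG s \<rho> i x t\<bar> \<le> mass \<rho> * tail_bound \<tau>" "\<bar>bumpH s \<rho> i j x t\<bar> \<le> mass \<rho> * tail_bound \<tau>"
    unfolding bump_def bumpD_def bumpG_def bumpH_def amp_after[OF assms(1) t(2)] amp'_after[OF assms(1) t(2)] ker_def
    using m[OF B(1)] m[OF B(2)] m[OF B(3)] m[OF B(4)] by simp_all
qed

text \<open>Collects the constants in the lower bound of the nonlocal term: the kernel power, the
  l-th power of the bump, and the volume of the cylinder on which both are estimated.\<close>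

definition key_const :: real where
  "key_const = (2 * pi) powr (- \<alpha> / 2) * exp (- 2 * \<alpha> / real CARD('n)) * ((8 * pi) powr (- real CARD('n) * l / 2) * exp (- l / 3)) * (unit_ball_vol (real CARD('n)) / 4)"

lemma key_const_pos: "key_const > 0" by (simp add: key_const_def)

text \<open>The source of the bump of parameter \<rho>' = q \<rho> is active between s - \<rho>' and
  s - \<rho>'/2 and is at most of order \<rho>'^(-b-1). At such a time the nonlocal term is
  estimated from below by the contribution of a cylinder of size \<rho> shortly before, when the
  larger bump is fully switched on. Besides the powers of \<rho>, the Gaussian tails in the distance
  from x0 have to be compared.\<close>

lemma src_le_nonlocal:
  assumes \<rho>: "\<rho> > 0" and small: "8 * q powr (- (b + 1)) * \<rho> powr (b * l - (real CARD('n) + 2 - \<alpha>) / 2 - b - 1) \<le> key_const"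
    and s: "\<rho> / 2 \<le> s" "s < T"
  shows "ennreal (src s (q * \<rho>) x t) \<le> nonlocal T \<alpha> l (bump s \<rho>) x t"
proof (cases "s - q * \<rho> < t \<and> t < s - q * \<rho> / 2")
  case False
  then have "src s (q * \<rho>) x t = 0" using \<rho> q0 by (intro src_zero) auto
  then show ?thesis by simp
next
  case True
  define \<rho>' where "\<rho>' = q * \<rho>"
  have \<rho>': "\<rho>' > 0" "\<rho>' \<le> \<rho> / 8" "s - \<rho>' < t" "t < s - \<rho>' / 2"
    using \<rho> q0 q8 True mult_right_mono[of q "1/8" \<rho>] by (auto simp: \<rho>'_def)
  define r where "r = (norm (x - x0))\<^sup>2"
  have r0: "r \<ge> 0" by (simp add: r_def)
  have upper: "src s \<rho>' x t \<le> 8 * \<rho>' powr (- (b + 1)) * exp (- r / (6 * \<rho>'))"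
  proof -
    define \<tau> where "\<tau> = t - (s - 2 * \<rho>')"
    have \<tau>: "\<rho>' \<le> \<tau>" "\<tau> \<le> 3/2 * \<rho>'" using \<rho>' by (auto simp: \<tau>_def)
    have a: "amp' s \<rho>' t \<le> mass \<rho>' * (4 * (2 / \<rho>'))"
      unfolding amp'_def using mass_pos[OF \<rho>'(1)] step_props(8) \<rho>' by (intro mult_left_mono mult_right_mono) auto
    have k: "ker s \<rho>' x t \<le> \<rho>' powr (- real CARD('n) / 2) * exp (- r / (6 * \<rho>'))"
    proof -
      have "(4 * pi * \<tau>) powr (- real CARD('n) / 2) \<le> \<rho>' powr (- real CARD('n) / 2)"
      proof -
        have "1 * \<rho>' \<le> (4 * pi) * \<tau>" using \<tau> \<rho>' pi_ge_two by (intro mult_mono) auto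
        then show ?thesis using \<rho>' by (intro powr_mono2') auto
      qed
      moreover have "exp (- r / (4 * \<tau>)) \<le> exp (- r / (6 * \<rho>'))"
      proof -
        have "r / (6 * \<rho>') \<le> r / (4 * \<tau>)" using \<tau> \<rho>' r0 by (intro divide_left_mono) auto
        then show ?thesis by simp
      qed
      ultimately have "(4 * pi * \<tau>) powr (- real CARD('n) / 2) * exp (- r / (4 * \<tau>)) \<le> \<rho>' powr (- real CARD('n) / 2) * exp (- r / (6 * \<rho>'))"
        by (intro mult_mono) auto
      then show ?thesis using \<tau> \<rho>' by (simp add: ker_def heat_kernel_def \<tau>_def[symmetric] r_def)
    qed
    have "src s \<rho>' x t \<le> (mass \<rho>' * (4 * (2 / \<rho>'))) * (\<rho>' powr (- real CARD('n) / 2) * exp (- r / (6 * \<rho>')))"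
      unfolding src_def using a k mass_pos[OF \<rho>'(1)] \<rho>' by (intro mult_mono ker_nonneg) auto
    also have "\<dots> = 8 * (\<rho>' powr (real CARD('n) / 2 - b) * \<rho>' powr (- 1) * \<rho>' powr (- real CARD('n) / 2)) * exp (- r / (6 * \<rho>'))"
      using \<rho>' by (simp add: mass_def powr_minus field_simps)
    also have "\<rho>' powr (real CARD('n) / 2 - b) * \<rho>' powr (- 1) * \<rho>' powr (- real CARD('n) / 2) = \<rho>' powr (- (b + 1))"
      unfolding powr_add[symmetric] by (rule arg_cong[where f = "\<lambda>e. \<rho>' powr e"]) (simp add: field_simps)
    finally show ?thesis .
  qed
  \<comment> \<open>Since \<rho>' \<le> \<rho>/8, every time in this window precedes t by between
    \<rho>/8 and \<rho>/2, so that the kernel is of order \<rho>^(-n/2) on \<open>E\<close>; the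
    window lies after s - \<rho>/2, when the amplitude is constant.\<close>
  define E where "E = cball x (sqrt \<rho>) \<times> {s - \<rho> / 2<..<s - \<rho> / 4}"
  define m1 where "m1 = ((2 * pi * \<rho>) powr (- real CARD('n) / 2) * exp (- 2)) powr (\<alpha> / real CARD('n))"
  define m2 where "m2 = ((8 * pi) powr (- real CARD('n) / 2) * \<rho> powr (- b) * (exp (- 1 / 3) * exp (- r / (3 * \<rho>)))) powr l"
  have m0: "m1 \<ge> 0" "m2 \<ge> 0" by (simp_all add: m1_def m2_def)
  have Es: "E \<in> sets lborel" unfolding E_def lborel_prod[symmetric] by (rule pair_measureI) auto
  have Em: "emeasure lborel E = ennreal (unit_ball_vol (real CARD('n)) * \<rho> powr (real CARD('n) / 2) * (\<rho> / 4))"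
  proof -
    have "emeasure lborel E = emeasure lborel (cball x (sqrt \<rho>)) * emeasure lborel {s - \<rho> / 2<..<s - \<rho> / 4}"
      unfolding E_def lborel_prod[symmetric] by (rule lborel.emeasure_pair_measure_Times) auto
    also have "emeasure lborel (cball x (sqrt \<rho>)) = ennreal (unit_ball_vol (real CARD('n)) * sqrt \<rho> ^ CARD('n))"
      using emeasure_cball[of "sqrt \<rho>" x] \<rho> by simp
    also have "sqrt \<rho> ^ CARD('n) = \<rho> powr (real CARD('n) / 2)"
    proof -
      have "sqrt \<rho> ^ CARD('n) = (\<rho> powr (1/2)) powr real CARD('n)" using \<rho> by (simp add: powr_half_sqrt powr_realpow)
      then show ?thesis by (simp add: powr_powr)
    qed
    also have "emeasure lborel {s - \<rho> / 2<..<s - \<rho> / 4} = ennreal (\<rho> / 4)"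
      using \<rho> by (subst emeasure_lborel_Ioo) (auto simp: field_simps)
    finally show ?thesis using \<rho> by (subst (asm) ennreal_mult[symmetric]) auto
  qed
  have lower: "ennreal (m1 * m2) * emeasure lborel E \<le> nonlocal T \<alpha> l (bump s \<rho>) x t"
  proof -
    have "ennreal (m1 * m2) * emeasure lborel E = (\<integral>\<^sup>+z. ennreal (m1 * m2) * indicator E z \<partial>lborel)"
      using Es by (simp add: nn_integral_cmult_indicator)
    also have "\<dots> \<le> nonlocal T \<alpha> l (bump s \<rho>) x t"
      unfolding nonlocal_def
    proof (rule nn_integral_mono)
      fix z :: "(real^'n) \<times> real"
      obtain y w where z: "z = (y, w)" by (cases z)
      show "ennreal (m1 * m2) * indicator E z \<le> indicator (UNIV \<times> {0<..<T}) z *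
        ennreal (heat_kernel (x - fst z) (t - snd z) powr (\<alpha> / real CARD('n)) * bump s \<rho> (fst z) (snd z) powr l)"
      proof (cases "z \<in> E")
        case False then show ?thesis by simp
      next
        case True
        then have y: "dist x y \<le> sqrt \<rho>" and w: "s - \<rho> / 2 < w" "w < s - \<rho> / 4" by (auto simp: E_def z)
        have wT: "w \<in> {0<..<T}" using w s \<rho> by auto
        have d2: "(norm (x - y))\<^sup>2 \<le> \<rho>"
        proof -
          have "(norm (x - y))\<^sup>2 \<le> (sqrt \<rho>)\<^sup>2" using y by (intro power_mono) (auto simp: dist_norm)
          then show ?thesis using \<rho> by simp
        qed
        have k1: "(2 * pi * \<rho>) powr (- real CARD('n) / 2) * exp (- 2) \<le> heat_kernel (x - y) (t - w)"
        proof -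
          define \<tau> where "\<tau> = t - w"
          have \<tau>: "\<rho> / 8 \<le> \<tau>" "\<tau> \<le> \<rho> / 2" "\<tau> > 0" using w \<rho>' \<rho> by (auto simp: \<tau>_def)
          have "(2 * pi * \<rho>) powr (- real CARD('n) / 2) \<le> (4 * pi * \<tau>) powr (- real CARD('n) / 2)" using \<tau> by (intro powr_mono2') auto
          moreover have "exp (- 2) \<le> exp (- (norm (x - y))\<^sup>2 / (4 * \<tau>))"
          proof -
            have "(norm (x - y))\<^sup>2 / (4 * \<tau>) \<le> 2" using d2 \<tau> by (simp add: field_simps)
            then show ?thesis by simp
          qed
          ultimately show ?thesis using \<tau> unfolding heat_kernel_def \<tau>_def[symmetric] by (simp add: mult_mono)
        qed
        have k2: "(8 * pi) powr (- real CARD('n) / 2) * \<rho> powr (- b) * (exp (- 1 / 3) * exp (- r / (3 * \<rho>))) \<le> bump s \<rho> y w"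
        proof -
          define \<tau> where "\<tau> = w - (s - 2 * \<rho>)"
          have \<tau>: "3/2 * \<rho> \<le> \<tau>" "\<tau> \<le> 2 * \<rho>" "\<tau> > 0" using w \<rho> by (auto simp: \<tau>_def)
          \<comment> \<open>Passing from x to a point within sqrt \<rho> costs a factor 2 and a
            summand 2 \<rho> in the squared distance; this leaves the tail exp (- r / (3
            \<rho>)).\<close>
          have ny: "(norm (y - x0))\<^sup>2 \<le> 2 * r + 2 * \<rho>"
          proof -
            have "norm (y - x0) \<le> norm (x - x0) + norm (x - y)"
              using norm_triangle_ineq4[of "x - x0" "x - y"] by simp
            then have "(norm (y - x0))\<^sup>2 \<le> (norm (x - x0) + norm (x - y))\<^sup>2" by (intro power_mono) auto
            also have "\<dots> \<le> 2 * (norm (x - x0))\<^sup>2 + 2 * (norm (x - y))\<^sup>2"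
              using zero_le_power2[of "norm (x - x0) - norm (x - y)"] unfolding power2_sum power2_diff by linarith
            finally show ?thesis using d2 by (simp add: r_def)
          qed
          have "(norm (y - x0))\<^sup>2 / (4 * \<tau>) \<le> (2 * r + 2 * \<rho>) / (6 * \<rho>)"
            using ny \<tau> \<rho> r0 by (intro frac_le) auto
          also have "\<dots> = 1 / 3 + r / (3 * \<rho>)" using \<rho> by (simp add: field_simps)
          finally have "exp (- (1 / 3 + r / (3 * \<rho>))) \<le> exp (- (norm (y - x0))\<^sup>2 / (4 * \<tau>))" by simp
          then have e: "exp (- 1 / 3) * exp (- r / (3 * \<rho>)) \<le> exp (- (norm (y - x0))\<^sup>2 / (4 * \<tau>))"
            by (simp add: exp_add[symmetric])
          have p: "(8 * pi * \<rho>) powr (- real CARD('n) / 2) \<le> (4 * pi * \<tau>) powr (- real CARD('n) / 2)" using \<tau> by (intro powr_mono2') auto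
          have "(8 * pi) powr (- real CARD('n) / 2) * \<rho> powr (- b) = mass \<rho> * (8 * pi * \<rho>) powr (- real CARD('n) / 2)"
            unfolding mass_times[OF \<rho>, symmetric] using \<rho> by (simp add: powr_mult)
          then have "(8 * pi) powr (- real CARD('n) / 2) * \<rho> powr (- b) * (exp (- 1 / 3) * exp (- r / (3 * \<rho>)))
            = mass \<rho> * ((8 * pi * \<rho>) powr (- real CARD('n) / 2) * (exp (- 1 / 3) * exp (- r / (3 * \<rho>))))" by (simp only: mult.assoc)
          also have "\<dots> \<le> mass \<rho> * ((4 * pi * \<tau>) powr (- real CARD('n) / 2) * exp (- (norm (y - x0))\<^sup>2 / (4 * \<tau>)))"
            using p e mass_pos[OF \<rho>] by (intro mult_left_mono mult_mono) auto
          also have "\<dots> = bump s \<rho> y w"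
            using \<tau> w \<rho> by (simp add: bump_def amp_after ker_def heat_kernel_def \<tau>_def[symmetric])
          finally show ?thesis .
        qed
        have "m1 * m2 \<le> heat_kernel (x - y) (t - w) powr (\<alpha> / real CARD('n)) * bump s \<rho> y w powr l"
          unfolding m1_def m2_def using k1 k2 al l1 by (intro mult_mono powr_mono2) auto
        then show ?thesis using True wT by (simp add: z ennreal_leI)
      qed
    qed
    finally show ?thesis .
  qed
  \<comment> \<open>The surplus of the amplification, positive by \<open>b\<kappa>\<close>: the
    factor \<rho>^A is what outweighs all constants for small \<rho>.\<close>
  define A where "A = b * l - (real CARD('n) + 2 - \<alpha>) / 2 - b - 1"
  have prod: "m1 * m2 * (unit_ball_vol (real CARD('n)) * \<rho> powr (real CARD('n) / 2) * (\<rho> / 4)) = key_const * (\<rho> powr (- A) * \<rho> powr (- (b + 1))) * exp (- l * r / (3 * \<rho>))"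
  proof -
    have m1: "m1 = (2 * pi) powr (- \<alpha> / 2) * \<rho> powr (- \<alpha> / 2) * exp (- 2 * \<alpha> / real CARD('n))"
      unfolding m1_def using \<rho> by (simp add: powr_mult powr_powr exp_powr_real)
    have m2: "m2 = (8 * pi) powr (- real CARD('n) * l / 2) * \<rho> powr (- b * l) * (exp (- l / 3) * exp (- l * r / (3 * \<rho>)))"
      unfolding m2_def using \<rho> by (simp add: powr_mult powr_powr exp_powr_real mult_ac)
    have "\<rho> powr (- \<alpha> / 2) * \<rho> powr (- b * l) * \<rho> powr (real CARD('n) / 2) * \<rho> powr 1 = \<rho> powr (- A) * \<rho> powr (- (b + 1))"
      unfolding powr_add[symmetric] A_def by (rule arg_cong[where f = "\<lambda>e. \<rho> powr e"]) (simp add: field_simps)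
    then show ?thesis unfolding m1 m2 key_const_def using \<rho> by (simp add: algebra_simps)
  qed
  have "src s \<rho>' x t \<le> m1 * m2 * (unit_ball_vol (real CARD('n)) * \<rho> powr (real CARD('n) / 2) * (\<rho> / 4))"
  proof -
    have "8 * q powr (- (b + 1)) * \<rho> powr A * (\<rho> powr (- A) * \<rho> powr (- (b + 1))) \<le> key_const * (\<rho> powr (- A) * \<rho> powr (- (b + 1)))"
      using small unfolding A_def[symmetric] by (intro mult_right_mono) auto
    moreover have "8 * q powr (- (b + 1)) * \<rho> powr A * (\<rho> powr (- A) * \<rho> powr (- (b + 1))) = 8 * \<rho>' powr (- (b + 1))"
    proof -
      have "\<rho> powr A * \<rho> powr (- A) = 1" using \<rho> by (simp add: powr_add[symmetric])
      moreover have "\<rho>' powr (- (b + 1)) = q powr (- (b + 1)) * \<rho> powr (- (b + 1))"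
        unfolding \<rho>'_def using q0 \<rho> by (simp add: powr_mult)
      ultimately show ?thesis by (simp add: algebra_simps)
    qed
    ultimately have c: "8 * \<rho>' powr (- (b + 1)) \<le> key_const * (\<rho> powr (- A) * \<rho> powr (- (b + 1)))" by simp
    \<comment> \<open>By 2 l q \<le> 1 the source of the smaller bump decays in space at least as
      fast as the l-th power of the larger one.\<close>
    have e: "exp (- r / (6 * \<rho>')) \<le> exp (- l * r / (3 * \<rho>))"
    proof -
      have "2 * l * q \<le> 1" using ql l1 by (simp add: field_simps)
      then have "2 * l * \<rho>' \<le> \<rho>" using \<rho> mult_right_mono[of "2 * l * q" 1 \<rho>] by (simp add: \<rho>'_def mult_ac)
      then have "l * 6 * \<rho>' \<le> 3 * \<rho>" by (simp add: mult_ac)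
      then have "l / (3 * \<rho>) \<le> 1 / (6 * \<rho>')" using \<rho> \<rho>' by (simp add: field_simps)
      from mult_right_mono[OF this r0] show ?thesis by simp
    qed
    have "src s \<rho>' x t \<le> (8 * \<rho>' powr (- (b + 1))) * exp (- r / (6 * \<rho>'))" by (rule upper)
    also have "\<dots> \<le> (key_const * (\<rho> powr (- A) * \<rho> powr (- (b + 1)))) * exp (- l * r / (3 * \<rho>))"
      by (rule mult_mono[OF c e]) (use key_const_pos in auto)
    finally show ?thesis unfolding prod .
  qed
  then have "ennreal (src s \<rho>' x t) \<le> ennreal (m1 * m2) * emeasure lborel E"
    unfolding Em using m0 \<rho> by (subst ennreal_mult[symmetric]) (auto intro!: ennreal_leI)
  also note lower
  finally show ?thesis by (simp add: \<rho>'_def)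
qed

section \<open>Integrability of a single bump\<close>

definition norm_const :: real where
  "norm_const = l powr (- real CARD('n) / 2) / (real CARD('n) / 2 * (l - 1) - 1)"

lemma norm_const_den: "real CARD('n) / 2 * (l - 1) - 1 > 0"
  using ln by (simp add: field_simps)

lemma norm_const_pos: "norm_const > 0"
  using norm_const_den l1 by (simp add: norm_const_def)

text \<open>In space, the l-th power of the kernel leaves a multiple of \<tau>^(n/2 (1-l)). The ages
  \<tau> start at \<rho>, since the bump vanishes before, and the integral up to infinity converges
  because l > (n+2)/n.\<close>

lemma bump_norm:
  assumes \<rho>: "\<rho> > 0"
  shows "(\<integral>\<^sup>+z. ennreal (bump s \<rho> (fst z) (snd z) powr l) \<partial>lborel) \<le> ennreal (norm_const * \<rho> powr (1 + real CARD('n) / 2 - b * l))"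
proof -
  define a where "a = real CARD('n) / 2 * (1 - l)"
  have a: "a < - 1" using norm_const_den by (simp add: a_def algebra_simps)
  define g where "g = (\<lambda>\<tau>. ennreal (\<tau> powr a) * indicator {\<rho>..} \<tau>)"
  have [measurable]: "g \<in> borel_measurable borel" unfolding g_def by measurable
  have gi: "(\<integral>\<^sup>+\<tau>. g \<tau> \<partial>lborel) = ennreal (- (\<rho> powr (a + 1)) / (a + 1))"
    unfolding g_def by (rule nn_integral_has_integral_lebesgue'[OF _ has_integral_powr_to_inf[OF a \<rho>]]) auto
  have m: "(\<lambda>z. ennreal (bump s \<rho> (fst z) (snd z) powr l)) \<in> borel_measurable (lborel \<Otimes>\<^sub>M lborel)"
  proof -
    have "(\<lambda>z. ennreal (bump s \<rho> (fst z) (snd z) powr l)) \<in> borel_measurable borel" by measurable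
    then show ?thesis by (simp add: lborel_prod)
  qed
  have "(\<integral>\<^sup>+z. ennreal (bump s \<rho> (fst z) (snd z) powr l) \<partial>lborel)
    = (\<integral>\<^sup>+t. \<integral>\<^sup>+x. ennreal (bump s \<rho> x t powr l) \<partial>lborel \<partial>lborel)"
    using lborel_pair.nn_integral_snd[OF m] by (simp add: lborel_prod)
  also have "\<dots> \<le> (\<integral>\<^sup>+t. ennreal (mass \<rho> powr l * l powr (- real CARD('n) / 2)) * g (t - (s - 2 * \<rho>)) \<partial>lborel)"
  proof (rule nn_integral_mono)
    fix t
    define \<tau> where "\<tau> = t - (s - 2 * \<rho>)"
    show "(\<integral>\<^sup>+x. ennreal (bump s \<rho> x t powr l) \<partial>lborel) \<le> ennreal (mass \<rho> powr l * l powr (- real CARD('n) / 2)) * g (t - (s - 2 * \<rho>))"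
    proof (cases "\<tau> \<ge> \<rho>")
      case False
      then have "2 * (t - s + \<rho>) / \<rho> \<le> 0" using \<rho> by (simp add: \<tau>_def divide_nonpos_pos)
      then have "bump s \<rho> x t = 0" for x by (simp add: bump_def amp_def step_props)
      then show ?thesis using l1 by simp
    next
      case True
      then have \<tau>: "\<tau> > 0" using \<rho> by simp
      have "(\<integral>\<^sup>+x. ennreal (bump s \<rho> x t powr l) \<partial>lborel)
        \<le> (\<integral>\<^sup>+x. ennreal (mass \<rho> powr l) * ennreal (heat_kernel (x0 - x) \<tau> powr l) \<partial>lborel)"
      proof (rule nn_integral_mono)
        fix x
        have "bump s \<rho> x t \<le> mass \<rho> * heat_kernel (x0 - x) \<tau>"
        proof -
          have "amp s \<rho> t \<le> mass \<rho> * 1" unfolding amp_def using mass_pos[OF \<rho>] step_props(4) by (intro mult_left_mono) auto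
          then show ?thesis unfolding bump_def ker_def \<tau>_def[symmetric]
            using heat_kernel_nonneg[of "x - x0" \<tau>] by (simp add: heat_kernel_commute[of x0 x] mult_right_mono)
        qed
        then have "bump s \<rho> x t powr l \<le> (mass \<rho> * heat_kernel (x0 - x) \<tau>) powr l"
          using bump_nonneg[OF \<rho>] l1 by (intro powr_mono2) auto
        also have "\<dots> = mass \<rho> powr l * heat_kernel (x0 - x) \<tau> powr l"
          using mass_pos[OF \<rho>] heat_kernel_nonneg[of "x0 - x" \<tau>] by (simp add: powr_mult)
        finally show "ennreal (bump s \<rho> x t powr l) \<le> ennreal (mass \<rho> powr l) * ennreal (heat_kernel (x0 - x) \<tau> powr l)"
          by (simp add: ennreal_mult[symmetric] ennreal_leI)
      qed
      also have "\<dots> = ennreal (mass \<rho> powr l) * ennreal ((4 * pi * \<tau>) powr a * l powr (- real CARD('n) / 2))"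
        using nn_integral_heat_kernel_powr[OF \<tau>, of l x0] l1 by (subst nn_integral_cmult) (auto simp: a_def)
      also have "\<dots> \<le> ennreal (mass \<rho> powr l) * ennreal (\<tau> powr a * l powr (- real CARD('n) / 2))"
      proof -
        have "(4 * pi * \<tau>) powr a \<le> \<tau> powr a" using \<tau> a pi_ge_two by (intro powr_mono2') auto
        then show ?thesis by (intro mult_left_mono ennreal_leI mult_right_mono) auto
      qed
      also have "\<dots> = ennreal (mass \<rho> powr l * l powr (- real CARD('n) / 2)) * g \<tau>"
        using True by (simp add: g_def ennreal_mult mult_ac)
      finally show ?thesis by (simp add: \<tau>_def)
    qed
  qed
  also have "\<dots> = ennreal (mass \<rho> powr l * l powr (- real CARD('n) / 2)) * (\<integral>\<^sup>+t. g (t - (s - 2 * \<rho>)) \<partial>lborel)"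
    by (rule nn_integral_cmult) measurable
  also have "(\<integral>\<^sup>+t. g (t - (s - 2 * \<rho>)) \<partial>lborel) = (\<integral>\<^sup>+\<tau>. g \<tau> \<partial>lborel)"
    using nn_integral_real_affine[of g 1 "- (s - 2 * \<rho>)"] by (simp add: algebra_simps)
  also have "ennreal (mass \<rho> powr l * l powr (- real CARD('n) / 2)) * (\<integral>\<^sup>+\<tau>. g \<tau> \<partial>lborel)
     = ennreal (mass \<rho> powr l * l powr (- real CARD('n) / 2) * (- (\<rho> powr (a + 1)) / (a + 1)))"
    unfolding gi using a by (intro ennreal_mult[symmetric] divide_nonpos_neg) auto
  also have "mass \<rho> powr l * l powr (- real CARD('n) / 2) * (- (\<rho> powr (a + 1)) / (a + 1)) = norm_const * \<rho> powr (1 + real CARD('n) / 2 - b * l)"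
  proof -
    have "mass \<rho> powr l * \<rho> powr (a + 1) = \<rho> powr (1 + real CARD('n) / 2 - b * l)"
      unfolding mass_def powr_powr powr_add[symmetric] a_def
      by (rule arg_cong[where f = "\<lambda>e. \<rho> powr e"]) (simp add: field_simps)
    moreover have "real CARD('n) / 2 * (l - 1) - 1 = - (a + 1)" by (simp add: a_def field_simps)
    moreover have "X * L * (- Y / c) = L / (- c) * (X * Y)" for X L Y c :: real by simp
    ultimately show ?thesis unfolding norm_const_def by (simp only:)
  qed
  finally show ?thesis .
qed

end

section \<open>Superposition of cascades\<close>

text \<open>Each a_j is at most the sum S, so a_j^l \<le> a_j S^(l-1); summation gives
  superadditivity of the l-th power.\<close>

lemma suminf_powr_le:
  fixes a :: "nat \<Rightarrow> real"
  assumes a: "\<And>j. 0 \<le> a j" "summable a" and l: "l \<ge> 1"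
  shows "(\<Sum>j. ennreal (a j powr l)) \<le> ennreal ((\<Sum>j. a j) powr l)"
proof -
  define S where "S = (\<Sum>j. a j)"
  have S0: "0 \<le> S" unfolding S_def using a by (intro suminf_nonneg) auto
  have aS: "a j \<le> S" for j
    unfolding S_def using sum_le_suminf[OF a(2), of "{j}"] a(1) by simp
  have "a j powr l \<le> a j * S powr (l - 1)" for j
  proof (cases "a j = 0")
    case False
    then have "a j powr l = a j * a j powr (l - 1)" using a(1)[of j] powr_add[of "a j" 1 "l - 1"] by simp
    then show ?thesis using aS[of j] a(1)[of j] l by (simp add: mult_left_mono powr_mono2)
  qed (use l in auto)
  then have "(\<Sum>j. ennreal (a j powr l)) \<le> (\<Sum>j. ennreal (a j * S powr (l - 1)))"
    by (intro suminf_le summableI ennreal_leI) auto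
  also have "\<dots> = ennreal (\<Sum>j. a j * S powr (l - 1))"
    using a by (intro suminf_ennreal2) (auto intro: summable_mult2)
  also have "(\<Sum>j. a j * S powr (l - 1)) = S * S powr (l - 1)"
    unfolding S_def using a(2) by (rule suminf_mult2[symmetric])
  also have "\<dots> = S powr l"
    using S0 l powr_add[of S 1 "l - 1"] by (cases "S = 0") auto
  finally show ?thesis unfolding S_def .
qed

text \<open>A substitute for Minkowski's inequality that stays with sums of l-th powers. The weights
  2^(j+2) are affordable because it is applied to terms whose norms decay fast enough.\<close>

lemma powr_suminf_le:
  fixes a :: "nat \<Rightarrow> real"
  assumes a: "\<And>j. 0 \<le> a j" "summable a" and l: "l > 0"
  shows "ennreal ((\<Sum>j. a j) powr l) \<le> (\<Sum>j. ennreal ((2 ^ (j + 2) * a j) powr l))"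
proof -
  define S where "S = (\<Sum>j. a j)"
  have S0: "0 \<le> S" unfolding S_def using a by (intro suminf_nonneg) auto
  (* Otherwise every term is below the share S / 2^(j+2), and these shares only add up to S / 2. *)
  have "\<exists>j. S \<le> 2 ^ (j + 2) * a j"
  proof (rule ccontr)
    assume "\<not> ?thesis"
    then have lt: "2 ^ (j + 2) * a j < S" for j by (simp add: not_le)
    have Sp: "S > 0" using lt[of 0] a(1)[of 0] by (simp add: le_less_trans[rotated])
    have "a j \<le> S / 4 * (1 / 2) ^ j" for j using lt[of j] by (simp add: field_simps power_add)
    then have "S \<le> (\<Sum>j. S / 4 * (1 / 2) ^ j)" unfolding S_def[symmetric]
      using a(2) by (subst S_def, intro suminf_le) (auto intro!: summable_mult summable_geometric)
    also have "\<dots> = S / 2" by (subst suminf_mult) (auto simp: suminf_geometric summable_geometric)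
    finally show False using Sp by simp
  qed
  then obtain j where "S \<le> 2 ^ (j + 2) * a j" by blast
  then have "ennreal (S powr l) \<le> ennreal ((2 ^ (j + 2) * a j) powr l)"
    using S0 l by (intro ennreal_leI powr_mono2) auto
  also have "\<dots> \<le> (\<Sum>j. ennreal ((2 ^ (j + 2) * a j) powr l))"
  proof -
    define f where "f = (\<lambda>j. ennreal ((2 ^ (j + 2) * a j) powr l))"
    have "sum f {j} \<le> suminf f" by (rule sum_le_suminf[OF summableI]) auto
    then have "f j \<le> suminf f" by simp
    then show ?thesis unfolding f_def .
  qed
  finally show ?thesis unfolding S_def .
qed

text \<open>Superadditivity of the l-th power passes to the integral. This is why solutions of the
  inequality with exponent 0 may be superposed: the nonlocal term of the sum pays for the sum of the
  sources.\<close>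

lemma nonlocal_suminf_le:
  fixes w :: "nat \<Rightarrow> real^'n \<Rightarrow> real \<Rightarrow> real"
  assumes w: "\<And>j y s. s \<in> {0<..<T} \<Longrightarrow> 0 \<le> w j y s" "\<And>y s. s \<in> {0<..<T} \<Longrightarrow> summable (\<lambda>j. w j y s)"
    and m: "\<And>j. (\<lambda>z. w j (fst z) (snd z)) \<in> borel_measurable borel" and l: "l \<ge> 1"
  shows "(\<Sum>j. nonlocal T \<alpha> l (w j) x t) \<le> nonlocal T \<alpha> l (\<lambda>y s. \<Sum>j. w j y s) x t"
proof -
  define k where "k = (\<lambda>z. heat_kernel (x - fst z) (t - snd z) powr (\<alpha> / real CARD('n)))"
  define S where "S = (UNIV :: (real^'n) set) \<times> {0<..<T}"
  note [measurable (raw)] = borel_measurable_fst_snd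
  have [measurable]: "S \<in> sets borel" unfolding S_def by (intro borel_open open_Times) auto
  have [measurable]: "k \<in> borel_measurable borel" unfolding k_def by measurable
  note [measurable] = m
  have "(\<Sum>j. nonlocal T \<alpha> l (w j) x t) = (\<Sum>j. \<integral>\<^sup>+z. indicator S z * ennreal (k z * w j (fst z) (snd z) powr l) \<partial>lborel)"
    by (simp add: nonlocal_def k_def S_def)
  also have "\<dots> = (\<integral>\<^sup>+z. (\<Sum>j. indicator S z * ennreal (k z * w j (fst z) (snd z) powr l)) \<partial>lborel)"
    by (rule nn_integral_suminf[symmetric]) measurable
  also have "\<dots> \<le> (\<integral>\<^sup>+z. indicator S z * ennreal (k z * (\<Sum>j. w j (fst z) (snd z)) powr l) \<partial>lborel)"
  proof (rule nn_integral_mono)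
    fix z :: "(real^'n) \<times> real"
    show "(\<Sum>j. indicator S z * ennreal (k z * w j (fst z) (snd z) powr l)) \<le> indicator S z * ennreal (k z * (\<Sum>j. w j (fst z) (snd z)) powr l)"
    proof (cases "z \<in> S")
      case True
      then have t: "snd z \<in> {0<..<T}" by (auto simp: S_def)
      have k0: "0 \<le> k z" by (simp add: k_def)
      have "(\<Sum>j. indicator S z * ennreal (k z * w j (fst z) (snd z) powr l)) = ennreal (k z) * (\<Sum>j. ennreal (w j (fst z) (snd z) powr l))"
        using True k0 by (simp add: ennreal_mult ennreal_suminf_cmult)
      also have "\<dots> \<le> ennreal (k z) * ennreal ((\<Sum>j. w j (fst z) (snd z)) powr l)"
        using w t l by (intro mult_left_mono suminf_powr_le) auto
      finally show ?thesis using True k0 by (simp add: ennreal_mult)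
    qed simp
  qed
  finally show ?thesis by (simp add: nonlocal_def k_def S_def)
qed

text \<open>The infinite version, applied to the sequence padded by zeros.\<close>

lemma nonlocal_sum_le:
  fixes w :: "nat \<Rightarrow> real^'n \<Rightarrow> real \<Rightarrow> real"
  assumes w: "\<And>j y s. 0 \<le> w j y s"
    and m: "\<And>j. (\<lambda>z. w j (fst z) (snd z)) \<in> borel_measurable borel" and l: "l \<ge> 1"
  shows "(\<Sum>j<N. nonlocal T \<alpha> l (w j) x t) \<le> nonlocal T \<alpha> l (\<lambda>y s. \<Sum>j<N. w j y s) x t"
proof -
  define w' where "w' = (\<lambda>j y s. if j < N then w j y s else 0)"
  have fin: "w' j y s = 0" if "j \<notin> {..<N}" for j y s using that by (simp add: w'_def)
  have "(\<Sum>j<N. nonlocal T \<alpha> l (w j) x t) = (\<Sum>j<N. nonlocal T \<alpha> l (w' j) x t)"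
    by (intro sum.cong) (auto simp: w'_def)
  also have "\<dots> \<le> (\<Sum>j. nonlocal T \<alpha> l (w' j) x t)" by (intro sum_le_suminf summableI) auto
  also have "\<dots> \<le> nonlocal T \<alpha> l (\<lambda>y s. \<Sum>j. w' j y s) x t"
  proof (rule nonlocal_suminf_le[OF _ _ _ l])
    show "summable (\<lambda>j. w' j y s)" for y s by (rule summable_finite[of "{..<N}"]) (auto simp: fin)
    show "(\<lambda>z. w' j (fst z) (snd z)) \<in> borel_measurable borel" for j using m[of j] by (auto simp: w'_def)
  qed (auto simp: w'_def w)
  also have "(\<lambda>y s. \<Sum>j. w' j y s) = (\<lambda>y s. \<Sum>j<N. w j y s)"
    by (intro ext, subst suminf_finite[of "{..<N}"]) (auto simp: w'_def)
  finally show ?thesis .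
qed

section \<open>Finite cascades with a common focusing time, and their superposition\<close>

context cascade
begin

text \<open>All N + 1 bumps focus at time R/2. This choice switches the largest one on between the
  times -R/2 and 0, so that its source lies before the time interval under study.\<close>

definition blk :: "real \<Rightarrow> nat \<Rightarrow> real^'n \<Rightarrow> real \<Rightarrow> real" where
  "blk R N x t = (\<Sum>k<Suc N. bump (R / 2) (R * q ^ k) x t)"

definition blkD :: "real \<Rightarrow> nat \<Rightarrow> real^'n \<Rightarrow> real \<Rightarrow> real" where
  "blkD R N x t = (\<Sum>k<Suc N. bumpD (R / 2) (R * q ^ k) x t)"

definition blkG :: "real \<Rightarrow> nat \<Rightarrow> 'n \<Rightarrow> real^'n \<Rightarrow> real \<Rightarrow> real" where
  "blkG R N i x t = (\<Sum>k<Suc N. bumpG (R / 2) (R * q ^ k) i x t)"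

definition blkH :: "real \<Rightarrow> nat \<Rightarrow> 'n \<Rightarrow> 'n \<Rightarrow> real^'n \<Rightarrow> real \<Rightarrow> real" where
  "blkH R N i j x t = (\<Sum>k<Suc N. bumpH (R / 2) (R * q ^ k) i j x t)"

definition blkS :: "real \<Rightarrow> nat \<Rightarrow> real^'n \<Rightarrow> real \<Rightarrow> real" where
  "blkS R N x t = (\<Sum>k<Suc N. src (R / 2) (R * q ^ k) x t)"

lemma scale_pos: "R > 0 \<Longrightarrow> R * q ^ k > 0" using q0 by simp

lemma scale_le: "R > 0 \<Longrightarrow> R * q ^ k \<le> R"
  using q0 q8 by (simp add: power_le_one mult_left_le)

lemma scale_powr: "R > 0 \<Longrightarrow> (R * q ^ k) powr e = R powr e * (q powr e) ^ k"
proof -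
  assume "R > 0"
  moreover have "(q ^ k) powr e = (q powr e) ^ k"
    using q0 by (simp add: powr_realpow[symmetric] powr_powr mult.commute)
  ultimately show ?thesis using q0 by (simp add: powr_mult)
qed

lemma mass_sum:
  assumes "R > 0"
  shows "(\<Sum>k<N. mass (R * q ^ k)) \<le> 2 * mass R"
proof -
  have "(\<Sum>k<N. mass (R * q ^ k)) \<le> (\<Sum>k<N. mass R * (1 / 2) ^ k)"
    using assms qm q0 by (intro sum_mono) (simp add: mass_def scale_powr mult_left_mono power_mono)
  also have "\<dots> = mass R * (\<Sum>k<N. (1 / 2) ^ k)" by (simp add: sum_distrib_left)
  also have "(\<Sum>k<N. (1 / 2 :: real) ^ k) \<le> 2" by (simp add: sum_gp_strict)
  finally show ?thesis using mass_pos[OF assms] by (simp add: mult.commute mult_left_mono)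
qed

lemma jet_blk: "R > 0 \<Longrightarrow> jet T (blk R N) (blkD R N) (blkG R N) (blkH R N)"
  unfolding blk_def[abs_def] blkD_def[abs_def] blkG_def[abs_def] blkH_def[abs_def]
  using jet_sum[of "{..<Suc N}" T "\<lambda>k. bump (R / 2) (R * q ^ k)" "\<lambda>k. bumpD (R / 2) (R * q ^ k)"
    "\<lambda>k. bumpG (R / 2) (R * q ^ k)" "\<lambda>k. bumpH (R / 2) (R * q ^ k)"] jet_bump scale_pos by blast

lemma blkS_eq: "blkS R N x t = blkD R N x t - (\<Sum>i\<in>UNIV. blkH R N i i x t)"
  unfolding blkS_def blkD_def blkH_def by (subst sum.swap) (simp only: src_eq sum_subtractf)

lemma blk_nonneg: "R > 0 \<Longrightarrow> 0 \<le> blk R N x t"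
  unfolding blk_def by (intro sum_nonneg bump_nonneg scale_pos)

lemma blkS_nonneg: "R > 0 \<Longrightarrow> 0 \<le> blkS R N x t"
  unfolding blkS_def by (intro sum_nonneg src_nonneg scale_pos)

lemma blk_measurable [measurable]: "(\<lambda>z. blk R N (fst z) (snd z)) \<in> borel_measurable borel"
  unfolding blk_def by measurable

lemma tail_bound_nonneg: "\<tau> > 0 \<Longrightarrow> 0 \<le> tail_bound \<tau>"
  by (simp add: tail_bound_def)

text \<open>The masses are dominated by a geometric series, hence a bound that does not see N. The
  number of bumps, and with it the height reached, remains free.\<close>

lemma blk_tail:
  assumes "R > 0" "\<tau> > 0" "R / 2 + \<tau> \<le> t"
  shows "\<bar>blk R N x t\<bar> \<le> 2 * mass R * tail_bound \<tau>" "\<bar>blkD R N x t\<bar> \<le> 2 * mass R * tail_bound \<tau>"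
    "\<bar>blkG R N i x t\<bar> \<le> 2 * mass R * tail_bound \<tau>" "\<bar>blkH R N i j x t\<bar> \<le> 2 * mass R * tail_bound \<tau>"
proof -
  have *: "\<bar>\<Sum>k<Suc N. f k\<bar> \<le> 2 * mass R * tail_bound \<tau>" if "\<And>k. \<bar>f k\<bar> \<le> mass (R * q ^ k) * tail_bound \<tau>" for f
  proof -
    have "\<bar>\<Sum>k<Suc N. f k\<bar> \<le> (\<Sum>k<Suc N. mass (R * q ^ k) * tail_bound \<tau>)"
      by (rule order_trans[OF sum_abs sum_mono[OF that]])
    also have "\<dots> = (\<Sum>k<Suc N. mass (R * q ^ k)) * tail_bound \<tau>" by (simp only: sum_distrib_right)
    also have "\<dots> \<le> 2 * mass R * tail_bound \<tau>"
      using mass_sum[OF assms(1)] tail_bound_nonneg[OF assms(2)] by (rule mult_right_mono)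
    finally show ?thesis .
  qed
  show "\<bar>blk R N x t\<bar> \<le> 2 * mass R * tail_bound \<tau>" "\<bar>blkD R N x t\<bar> \<le> 2 * mass R * tail_bound \<tau>"
    "\<bar>blkG R N i x t\<bar> \<le> 2 * mass R * tail_bound \<tau>" "\<bar>blkH R N i j x t\<bar> \<le> 2 * mass R * tail_bound \<tau>"
    unfolding blk_def blkD_def blkG_def blkH_def
    by (rule *, rule bump_tail[OF scale_pos[OF assms(1)] assms(2,3)])+
qed

text \<open>The condition of \<open>src_le_nonlocal\<close> at the first scale; the exponent of R is
  positive, so all smaller scales inherit it.\<close>

definition small :: "real \<Rightarrow> bool" where
  "small R \<longleftrightarrow> 8 * q powr (- (b + 1)) * R powr (b * l - (real CARD('n) + 2 - \<alpha>) / 2 - b - 1) \<le> key_const"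

text \<open>The source of bump k + 1 is dominated by the nonlocal term of bump k, and the nonlocal
  term is superadditive.\<close>

lemma blkS_le_nonlocal:
  assumes R: "R > 0" "R / 2 < T" "small R" and t: "t > 0"
  shows "ennreal (blkS R N x t) \<le> nonlocal T \<alpha> l (blk R N) x t"
proof -
  let ?s = "R / 2"
  have "blkS R N x t = src ?s (R * q ^ 0) x t + (\<Sum>k<N. src ?s (R * q ^ Suc k) x t)"
    unfolding blkS_def by (rule sum.lessThan_Suc_shift)
  \<comment> \<open>Here s - \<rho>/2 = 0: the first bump is fully on from time 0.\<close>
  also have "src ?s (R * q ^ 0) x t = 0" using R t by (intro src_zero) auto
  finally have "ennreal (blkS R N x t) = (\<Sum>k<N. ennreal (src ?s (R * q ^ Suc k) x t))"
    using src_nonneg[OF scale_pos[OF R(1)]] by (simp add: sum_ennreal del: power_Suc)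
  also have "\<dots> \<le> (\<Sum>k<N. nonlocal T \<alpha> l (bump ?s (R * q ^ k)) x t)"
  proof (rule sum_mono)
    fix k
    have "R * q ^ Suc k = q * (R * q ^ k)" by simp
    moreover have "ennreal (src ?s (q * (R * q ^ k)) x t) \<le> nonlocal T \<alpha> l (bump ?s (R * q ^ k)) x t"
    proof (rule src_le_nonlocal[OF scale_pos[OF R(1)] _ _ R(2)])
      have "(R * q ^ k) powr (b * l - (real CARD('n) + 2 - \<alpha>) / 2 - b - 1) \<le> R powr (b * l - (real CARD('n) + 2 - \<alpha>) / 2 - b - 1)"
        using scale_le[OF R(1)] scale_pos[OF R(1), of k] b\<kappa> by (intro powr_mono2) auto
      then show "8 * q powr (- (b + 1)) * (R * q ^ k) powr (b * l - (real CARD('n) + 2 - \<alpha>) / 2 - b - 1) \<le> key_const"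
        using R(3) unfolding small_def by (elim order_trans[rotated]) (auto intro!: mult_left_mono)
      show "R * q ^ k / 2 \<le> R / 2" using scale_le[OF R(1), of k] by simp
    qed
    ultimately show "ennreal (src ?s (R * q ^ Suc k) x t) \<le> nonlocal T \<alpha> l (bump ?s (R * q ^ k)) x t" by (simp only:)
  qed
  also have "\<dots> \<le> (\<Sum>k<Suc N. nonlocal T \<alpha> l (bump ?s (R * q ^ k)) x t)" by simp
  also have "\<dots> \<le> nonlocal T \<alpha> l (blk R N) x t"
    unfolding blk_def[abs_def] using l1 bump_nonneg[OF scale_pos[OF R(1)]] by (intro nonlocal_sum_le) auto
  finally show ?thesis .
qed

definition blk_const :: real where "blk_const = 2 * 4 powr l * norm_const"

text \<open>Independent of N: the weights 2^(k+2) lose against the geometric decay of the bump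
  norms, by the condition \<open>q\<epsilon>\<close> on q.\<close>

lemma blk_norm:
  assumes R: "R > 0"
  shows "(\<integral>\<^sup>+z. ennreal (blk R N (fst z) (snd z) powr l) \<partial>lborel) \<le> ennreal (blk_const * R powr (1 + real CARD('n) / 2 - b * l))"
proof -
  define e where "e = 1 + real CARD('n) / 2 - b * l"
  define w where "w = (\<lambda>k y s. if k < Suc N then bump (R / 2) (R * q ^ k) y s else 0)"
  have fin: "w k y s = 0" if "k \<notin> {..<Suc N}" for k y s using that by (simp add: w_def)
  have w0: "0 \<le> w k y s" for k y s using bump_nonneg[OF scale_pos[OF R]] by (simp add: w_def)
  have sw: "summable (\<lambda>k. w k y s)" for y s by (rule summable_finite[of "{..<Suc N}"]) (auto simp: fin)
  have eq: "blk R N y s = (\<Sum>k. w k y s)" for y s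
    unfolding blk_def by (subst suminf_finite[of "{..<Suc N}"]) (auto simp: w_def)
  have wm [measurable]: "(\<lambda>z. w k (fst z) (snd z)) \<in> borel_measurable borel" for k by (cases "k < Suc N") (auto simp: w_def)
  have "(\<integral>\<^sup>+z. ennreal (blk R N (fst z) (snd z) powr l) \<partial>lborel)
     \<le> (\<integral>\<^sup>+z. (\<Sum>k. ennreal ((2 ^ (k + 2) * w k (fst z) (snd z)) powr l)) \<partial>lborel)"
    unfolding eq using l1 by (intro nn_integral_mono powr_suminf_le w0 sw) auto
  also have "\<dots> = (\<Sum>k. \<integral>\<^sup>+z. ennreal ((2 ^ (k + 2) * w k (fst z) (snd z)) powr l) \<partial>lborel)"
    by (rule nn_integral_suminf) measurable
  also have "\<dots> \<le> (\<Sum>k. ennreal (4 powr l * norm_const * R powr e * (1 / 2) ^ k))"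
  proof (intro suminf_le summableI)
    fix k
    have pw: "(2 ^ (k + 2) :: real) powr l = 4 powr l * (2 powr l) ^ k"
    proof -
      have "(2 ^ k :: real) powr l = (2 powr l) ^ k" by (simp add: powr_realpow[symmetric] powr_powr mult.commute)
      then show ?thesis by (simp add: power_add powr_mult)
    qed
    have "(\<integral>\<^sup>+z. ennreal ((2 ^ (k + 2) * w k (fst z) (snd z)) powr l) \<partial>lborel)
      = (\<integral>\<^sup>+z. ennreal ((2 ^ (k + 2)) powr l) * ennreal (w k (fst z) (snd z) powr l) \<partial>lborel)"
      using w0 by (intro nn_integral_cong) (simp add: powr_mult ennreal_mult)
    also have "\<dots> = ennreal ((2 ^ (k + 2)) powr l) * (\<integral>\<^sup>+z. ennreal (w k (fst z) (snd z) powr l) \<partial>lborel)"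
      by (rule nn_integral_cmult) measurable
    also have "\<dots> \<le> ennreal ((2 ^ (k + 2)) powr l) * ennreal (norm_const * (R * q ^ k) powr e)"
    proof (rule mult_left_mono)
      have "(\<integral>\<^sup>+z. ennreal (w k (fst z) (snd z) powr l) \<partial>lborel) \<le> (\<integral>\<^sup>+z. ennreal (bump (R / 2) (R * q ^ k) (fst z) (snd z) powr l) \<partial>lborel)"
        using l1 by (intro nn_integral_mono) (auto simp: w_def)
      also have "\<dots> \<le> ennreal (norm_const * (R * q ^ k) powr e)"
        unfolding e_def by (rule bump_norm[OF scale_pos[OF R]])
      finally show "(\<integral>\<^sup>+z. ennreal (w k (fst z) (snd z) powr l) \<partial>lborel) \<le> ennreal (norm_const * (R * q ^ k) powr e)" .
    qed simp
    also have "\<dots> = ennreal ((2 ^ (k + 2)) powr l * (norm_const * (R * q ^ k) powr e))"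
      using norm_const_pos by (intro ennreal_mult[symmetric]) auto
    also have "(2 ^ (k + 2)) powr l * (norm_const * (R * q ^ k) powr e) = 4 powr l * norm_const * R powr e * (2 powr l * q powr e) ^ k"
      unfolding pw scale_powr[OF R] by (simp add: power_mult_distrib mult_ac)
    also have "\<dots> \<le> 4 powr l * norm_const * R powr e * (1 / 2) ^ k"
      using q\<epsilon> norm_const_pos unfolding e_def[symmetric] by (intro mult_left_mono power_mono) auto
    finally show "(\<integral>\<^sup>+z. ennreal ((2 ^ (k + 2) * w k (fst z) (snd z)) powr l) \<partial>lborel) \<le> ennreal (4 powr l * norm_const * R powr e * (1 / 2) ^ k)"
      by (simp add: ennreal_leI)
  qed
  also have "\<dots> = ennreal (\<Sum>k. 4 powr l * norm_const * R powr e * (1 / 2) ^ k)"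
    using norm_const_pos by (intro suminf_ennreal2) (auto intro!: summable_mult summable_geometric)
  also have "(\<Sum>k. 4 powr l * norm_const * R powr e * (1 / 2) ^ k) = blk_const * R powr e"
    by (subst suminf_mult) (auto simp: suminf_geometric summable_geometric blk_const_def)
  finally show ?thesis unfolding e_def .
qed

lemma blk_center:
  assumes "R > 0"
  shows "(8 * pi) powr (- real CARD('n) / 2) * (R * q ^ N) powr (- b) \<le> blk R N x0 (R / 2)"
proof -
  have "bump (R / 2) (R * q ^ N) x0 (R / 2) \<le> blk R N x0 (R / 2)"
    unfolding blk_def using bump_nonneg[OF scale_pos[OF assms]]
    by (intro member_le_sum[of N "{..<Suc N}" "\<lambda>k. bump (R / 2) (R * q ^ k) x0 (R / 2)"]) auto
  then show ?thesis using bump_center[OF scale_pos[OF assms]] by simp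
qed

text \<open>On a strip t > \<tau> all but finitely many blocks are past their focusing time and sum
  up with geometric majorants, so the series is regular although its values at the times R_j / 2 may
  be prescribed as large as desired. The exponent 0 turns the power factor into 1, so that the
  inequality survives summation.\<close>

lemma cascade_solution:
  fixes R :: "nat \<Rightarrow> real" and N :: "nat \<Rightarrow> nat"
  assumes R: "\<And>j. R j > 0" "\<And>j. R j / 2 < T" "\<And>j. small (R j)" "\<And>j. R j \<le> (1 / 2) ^ j"
    and R1: "\<And>j. blk_const * R j powr (1 + real CARD('n) / 2 - b * l) * (2 ^ (j + 2)) powr l \<le> (1 / 2) ^ j"
    and R2: "\<And>j. 2 * mass (R j) \<le> (1 / 2) ^ j"
  defines "u \<equiv> \<lambda>x t. \<Sum>j. blk (R j) (N j) x t"
  shows "admissible \<alpha> l 0 T \<Omega> u"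
    and "(8 * pi) powr (- real CARD('n) / 2) * (R j * q ^ N j) powr (- b) \<le> u x0 (R j / 2)"
proof -
  have tailM: "\<exists>M. summable M \<and> eventually (\<lambda>j. jet_le \<tau> T (blk (R j) (N j)) (blkD (R j) (N j)) (blkG (R j) (N j))
        (blkH (R j) (N j)) (M j)) sequentially" if \<tau>: "\<tau> > 0" for \<tau>
  proof (intro exI[of _ "\<lambda>j. (1 / 2) ^ j * tail_bound (\<tau> / 2)"] conjI)
    show "summable (\<lambda>j. (1 / 2) ^ j * tail_bound (\<tau> / 2))" by (intro summable_mult2 summable_geometric) simp
    have "(\<lambda>j. (1 / 2 :: real) ^ j) \<longlonglongrightarrow> 0" by (rule LIMSEQ_realpow_zero) auto
    from order_tendstoD(2)[OF this \<tau>] have "eventually (\<lambda>j. (1 / 2) ^ j < \<tau>) sequentially" .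
    then show "eventually (\<lambda>j. jet_le \<tau> T (blk (R j) (N j)) (blkD (R j) (N j)) (blkG (R j) (N j))
        (blkH (R j) (N j)) ((1 / 2) ^ j * tail_bound (\<tau> / 2))) sequentially"
      unfolding jet_le_def
    proof (rule eventually_mono, intro allI ballI)
      fix j x t assume j: "(1 / 2) ^ j < \<tau>" and t: "t \<in> {\<tau><..<T}"
      \<comment> \<open>Block j focuses at R_j / 2 < \<tau>/2, which leaves an elapsed time of at
        least \<tau>/2.\<close>
      have h: "\<tau> / 2 > 0" "R j / 2 + \<tau> / 2 \<le> t" using \<tau> R(4)[of j] j t by auto
      have le: "2 * mass (R j) * tail_bound (\<tau> / 2) \<le> (1 / 2) ^ j * tail_bound (\<tau> / 2)"
        using R2[of j] tail_bound_nonneg[OF h(1)] by (rule mult_right_mono)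
      show "\<bar>blk (R j) (N j) x t\<bar> \<le> (1 / 2) ^ j * tail_bound (\<tau> / 2)
        \<and> \<bar>blkD (R j) (N j) x t\<bar> \<le> (1 / 2) ^ j * tail_bound (\<tau> / 2)
        \<and> (\<forall>i. \<bar>blkG (R j) (N j) i x t\<bar> \<le> (1 / 2) ^ j * tail_bound (\<tau> / 2))
        \<and> (\<forall>i k. \<bar>blkH (R j) (N j) i k x t\<bar> \<le> (1 / 2) ^ j * tail_bound (\<tau> / 2))"
        using blk_tail[OF R(1)[of j] h, THEN order_trans, OF le] by blast
    qed
  qed
  note js = jet_suminf[where u = "\<lambda>j. blk (R j) (N j)" and D = "\<lambda>j. blkD (R j) (N j)" and G = "\<lambda>j. blkG (R j) (N j)"
     and H = "\<lambda>j. blkH (R j) (N j)" and T = T, OF jet_blk[OF R(1)] tailM]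
  have J: "jet T (\<lambda>x t. \<Sum>j. blk (R j) (N j) x t) (\<lambda>x t. \<Sum>j. blkD (R j) (N j) x t)
      (\<lambda>i x t. \<Sum>j. blkG (R j) (N j) i x t) (\<lambda>i k x t. \<Sum>j. blkH (R j) (N j) i k x t)"
    by (rule js(1))
  have sm: "summable (\<lambda>j. blk (R j) (N j) x t)" and smD: "summable (\<lambda>j. blkD (R j) (N j) x t)"
    and smH: "summable (\<lambda>j. blkH (R j) (N j) i k x t)" if "t \<in> {0<..<T}" for x t i k
    by (rule js(2)[OF _ that], assumption) (rule js(3)[OF _ that], assumption, rule js(4)[OF _ that], assumption)
  have u0: "0 \<le> u x t" if "t \<in> {0<..<T}" for x t
    unfolding u_def using blk_nonneg[OF R(1)] sm[OF that] by (intro suminf_nonneg) auto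
  have C: "C21 T u" using jet_C21(1)[OF J] unfolding u_def .
  have heat: "dt u x t - laplacian (\<lambda>y. u y t) x = (\<Sum>j. blkS (R j) (N j) x t)"
    and smS: "summable (\<lambda>j. blkS (R j) (N j) x t)" if t: "t \<in> {0<..<T}" for x t
  proof -
    have sH: "summable (\<lambda>j. \<Sum>i\<in>UNIV. blkH (R j) (N j) i i x t)" using smH[OF t] by (intro summable_sum) auto
    have "dt u x t - laplacian (\<lambda>y. u y t) x = (\<Sum>j. blkD (R j) (N j) x t) - (\<Sum>i\<in>UNIV. \<Sum>j. blkH (R j) (N j) i i x t)"
      using jet_C21(2,3)[OF J t] unfolding u_def by simp
    also have "(\<Sum>i\<in>UNIV. \<Sum>j. blkH (R j) (N j) i i x t) = (\<Sum>j. \<Sum>i\<in>UNIV. blkH (R j) (N j) i i x t)"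
      using smH[OF t] by (intro suminf_sum[symmetric]) auto
    also have "(\<Sum>j. blkD (R j) (N j) x t) - \<dots> = (\<Sum>j. blkD (R j) (N j) x t - (\<Sum>i\<in>UNIV. blkH (R j) (N j) i i x t))"
      using smD[OF t] sH by (rule suminf_diff)
    finally show "dt u x t - laplacian (\<lambda>y. u y t) x = (\<Sum>j. blkS (R j) (N j) x t)" by (simp only: blkS_eq)
    show "summable (\<lambda>j. blkS (R j) (N j) x t)" unfolding blkS_eq using smD[OF t] sH by (rule summable_diff)
  qed
  have ineq: "ennreal (\<Sum>j. blkS (R j) (N j) x t) \<le> nonlocal T \<alpha> l u x t" if t: "t \<in> {0<..<T}" for x t
  proof -
    have "ennreal (\<Sum>j. blkS (R j) (N j) x t) = (\<Sum>j. ennreal (blkS (R j) (N j) x t))"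
      using smS[OF t] blkS_nonneg[OF R(1)] by (intro suminf_ennreal2[symmetric]) auto
    also have "\<dots> \<le> (\<Sum>j. nonlocal T \<alpha> l (blk (R j) (N j)) x t)"
      using t by (intro suminf_le summableI blkS_le_nonlocal R) auto
    also have "\<dots> \<le> nonlocal T \<alpha> l u x t"
      unfolding u_def using l1 blk_nonneg[OF R(1)] sm by (intro nonlocal_suminf_le) auto
    finally show ?thesis .
  qed
  have int: "set_integrable lborel (UNIV \<times> {0<..<T}) (\<lambda>z. \<bar>u (fst z) (snd z)\<bar> powr l)"
  proof -
    define S where "S = (UNIV :: (real^'n) set) \<times> {0<..<T}"
    have S: "S \<in> sets borel" unfolding S_def by (intro borel_open open_Times) auto
    have um: "(\<lambda>z. indicator S z *\<^sub>R u (fst z) (snd z)) \<in> borel_measurable borel"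
      by (rule C21_measurable(2)[OF C S]) (simp add: S_def)
    have "(\<lambda>z. \<bar>indicator S z *\<^sub>R u (fst z) (snd z)\<bar> powr l) \<in> borel_measurable borel" using um by measurable
    also have "(\<lambda>z. \<bar>indicator S z *\<^sub>R u (fst z) (snd z)\<bar> powr l) = (\<lambda>z. indicator S z *\<^sub>R \<bar>u (fst z) (snd z)\<bar> powr l)"
      using l1 by (auto split: split_indicator)
    finally have m: "(\<lambda>z. indicator S z *\<^sub>R \<bar>u (fst z) (snd z)\<bar> powr l) \<in> borel_measurable lborel" by simp
    have "(\<integral>\<^sup>+z. ennreal (indicator S z *\<^sub>R \<bar>u (fst z) (snd z)\<bar> powr l) \<partial>lborel)
      \<le> (\<integral>\<^sup>+z. (\<Sum>j. ennreal ((2 ^ (j + 2) * blk (R j) (N j) (fst z) (snd z)) powr l)) \<partial>lborel)"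
    proof (rule nn_integral_mono)
      fix z :: "(real^'n) \<times> real"
      show "ennreal (indicator S z *\<^sub>R \<bar>u (fst z) (snd z)\<bar> powr l) \<le> (\<Sum>j. ennreal ((2 ^ (j + 2) * blk (R j) (N j) (fst z) (snd z)) powr l))"
      proof (cases "z \<in> S")
        case True
        then have t: "snd z \<in> {0<..<T}" by (auto simp: S_def)
        have "ennreal (u (fst z) (snd z) powr l) \<le> (\<Sum>j. ennreal ((2 ^ (j + 2) * blk (R j) (N j) (fst z) (snd z)) powr l))"
          unfolding u_def using l1 blk_nonneg[OF R(1)] sm[OF t] by (intro powr_suminf_le) auto
        then show ?thesis using True u0[OF t, of "fst z"] by simp
      qed simp
    qed
    also have "\<dots> = (\<Sum>j. \<integral>\<^sup>+z. ennreal ((2 ^ (j + 2) * blk (R j) (N j) (fst z) (snd z)) powr l) \<partial>lborel)"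
      by (rule nn_integral_suminf) measurable
    also have "\<dots> \<le> (\<Sum>j. ennreal ((1 / 2) ^ j))"
    proof (intro suminf_le summableI)
      fix j
      let ?e = "1 + real CARD('n) / 2 - b * l"
      have "(\<integral>\<^sup>+z. ennreal ((2 ^ (j + 2) * blk (R j) (N j) (fst z) (snd z)) powr l) \<partial>lborel)
        = (\<integral>\<^sup>+z. ennreal ((2 ^ (j + 2)) powr l) * ennreal (blk (R j) (N j) (fst z) (snd z) powr l) \<partial>lborel)"
        using blk_nonneg[OF R(1)] by (intro nn_integral_cong) (simp add: powr_mult ennreal_mult)
      also have "\<dots> = ennreal ((2 ^ (j + 2)) powr l) * (\<integral>\<^sup>+z. ennreal (blk (R j) (N j) (fst z) (snd z) powr l) \<partial>lborel)"
        by (rule nn_integral_cmult) measurable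
      also have "\<dots> \<le> ennreal ((2 ^ (j + 2)) powr l) * ennreal (blk_const * R j powr ?e)"
        by (intro mult_left_mono blk_norm R) auto
      also have "\<dots> = ennreal (blk_const * R j powr ?e * (2 ^ (j + 2)) powr l)"
        using norm_const_pos by (subst ennreal_mult[symmetric]) (auto simp: blk_const_def mult_ac)
      also have "\<dots> \<le> ennreal ((1 / 2) ^ j)" by (intro ennreal_leI R1)
      finally show "(\<integral>\<^sup>+z. ennreal ((2 ^ (j + 2) * blk (R j) (N j) (fst z) (snd z)) powr l) \<partial>lborel) \<le> ennreal ((1 / 2) ^ j)" .
    qed
    also have "\<dots> = ennreal (\<Sum>j. (1 / 2) ^ j)"
      by (intro suminf_ennreal2) (auto intro!: summable_geometric)
    finally have "(\<integral>\<^sup>+z. ennreal (indicator S z *\<^sub>R \<bar>u (fst z) (snd z)\<bar> powr l) \<partial>lborel) < \<infinity>"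
      by (rule le_less_trans) simp
    then show ?thesis unfolding set_integrable_def S_def[symmetric]
      using m by (intro integrableI_nonneg) auto
  qed
  show "admissible \<alpha> l 0 T \<Omega> u"
    unfolding admissible_def rpow_def
  proof (intro conjI allI ballI)
    fix x t assume t: "t \<in> {0<..<T}"
    show "0 \<le> u x t" by (rule u0[OF t])
    show "0 \<le> dt u x t - laplacian (\<lambda>y. u y t) x"
      unfolding heat[OF t] using smS[OF t] blkS_nonneg[OF R(1)] by (intro suminf_nonneg) auto
    show "ennreal (dt u x t - laplacian (\<lambda>y. u y t) x) \<le> nonlocal T \<alpha> l u x t * ennreal (if (0::real) = 0 then 1 else u x t powr 0)"
      unfolding heat[OF t] using ineq[OF t] by simp
  qed (fact C int)+
  have t: "R j / 2 \<in> {0<..<T}" using R(1,2)[of j] by simp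
  have "blk (R j) (N j) x0 (R j / 2) \<le> u x0 (R j / 2)"
    unfolding u_def using sum_le_suminf[OF sm[OF t], of "{j}" x0] blk_nonneg[OF R(1)] by simp
  then show "(8 * pi) powr (- real CARD('n) / 2) * (R j * q ^ N j) powr (- b) \<le> u x0 (R j / 2)"
    using blk_center[OF R(1), of j "N j"] by linarith
qed

end

section \<open>Choice of the parameters and conclusion of part (ii)\<close>

lemma powr_small:
  fixes c d e :: real
  assumes "c > 0" "d > 0" "e > 0"
  obtains R0 where "R0 > 0" "\<And>R. 0 < R \<Longrightarrow> R \<le> R0 \<Longrightarrow> c * R powr e \<le> d"
proof
  show "(d / c) powr (1 / e) > 0" using assms by simp
  fix R assume R: "0 < R" "R \<le> (d / c) powr (1 / e)"
  have "R powr e \<le> ((d / c) powr (1 / e)) powr e" using R assms by (intro powr_mono2) auto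
  also have "\<dots> = d / c" using assms by (simp add: powr_powr)
  finally show "c * R powr e \<le> d" using assms by (simp add: field_simps)
qed

text \<open>The two competing conditions on b give an interval, and its upper end is below n/2
  because l > (n+2)/n. The point x0 does not occur in the assumptions of the locale, so its
  predicate takes only the type that fixes the dimension.\<close>

lemma cascade_exists:
  assumes \<alpha>: "2 < \<alpha>" "\<alpha> < real CARD('n) + 2" and T: "T > 0" and l: "l > (real CARD('n) + 2) / (\<alpha> - 2)"
  obtains b q where "cascade TYPE('n::finite) \<alpha> l T b q"
proof -
  let ?n = "real CARD('n)"
  have n: "?n > 0" by simp
  have la: "?n + 2 < l * (\<alpha> - 2)" using l \<alpha> by (simp add: pos_divide_less_eq)
  have ln: "l > (?n + 2) / ?n"
  proof -
    have "(?n + 2) / ?n \<le> (?n + 2) / (\<alpha> - 2)" using \<alpha> n by (intro divide_left_mono) auto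
    then show ?thesis using l by linarith
  qed
  have "1 < (?n + 2) / ?n" using n by (simp add: field_simps)
  then have l1: "l > 1" using ln by linarith
  \<comment> \<open>\<open>lo\<close> < b is \<open>b\<kappa>\<close> solved for b, and b <
    \<open>up\<close> is \<open>b\<epsilon>\<close>.\<close>
  define lo where "lo = (?n + 4 - \<alpha>) / (2 * (l - 1))"
  define up where "up = (?n + 2) / (2 * l)"
  have "lo < up"
  proof -
    have "(?n + 4 - \<alpha>) * l < (?n + 2) * (l - 1)" using la by (simp add: algebra_simps)
    then have "(?n + 4 - \<alpha>) * (2 * l) < (?n + 2) * (2 * (l - 1))" by (simp add: algebra_simps)
    then show ?thesis unfolding lo_def up_def using l1 by (simp add: divide_less_eq less_divide_eq mult_ac)
  qed
  then obtain b where b: "lo < b" "b < up" using dense by blast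
  have lo0: "lo > 0" unfolding lo_def using \<alpha> l1 by simp
  have b1: "b * (2 * (l - 1)) > ?n + 4 - \<alpha>" using b(1) l1 unfolding lo_def by (simp add: pos_divide_less_eq)
  have b2: "b * (2 * l) < ?n + 2" using b(2) l1 unfolding up_def by (simp add: pos_less_divide_eq)
  have b\<kappa>: "b * l - (?n + 2 - \<alpha>) / 2 - b - 1 > 0" using b1 by (simp add: field_simps)
  have b\<epsilon>: "1 + ?n / 2 - b * l > 0" using b2 by (simp add: field_simps)
  have bn: "b < ?n / 2"
  proof -
    have "?n + 2 < l * ?n" using ln n by (simp add: pos_divide_less_eq)
    then have "up < ?n / 2" unfolding up_def using l1 by (simp add: divide_less_eq less_divide_eq mult_ac)
    then show ?thesis using b(2) by linarith
  qed
  obtain q1 where q1: "q1 > 0" "\<And>R. 0 < R \<Longrightarrow> R \<le> q1 \<Longrightarrow> 2 powr l * R powr (1 + ?n / 2 - b * l) \<le> 1 / 2"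
    using powr_small[of "2 powr l" "1 / 2" "1 + ?n / 2 - b * l"] b\<epsilon> by auto
  obtain q2 where q2: "q2 > 0" "\<And>R. 0 < R \<Longrightarrow> R \<le> q2 \<Longrightarrow> 1 * R powr (?n / 2 - b) \<le> 1 / 2"
    using powr_small[of 1 "1 / 2" "?n / 2 - b"] bn by auto
  \<comment> \<open>All conditions on q hold once q is small, the exponents 1 + n/2 - b l and n/2 -
    b being positive.\<close>
  define q where "q = min (min (1 / 8) (1 / (2 * l))) (min q1 q2)"
  have q: "q > 0" "q \<le> 1 / 8" "q \<le> 1 / (2 * l)" "q \<le> q1" "q \<le> q2" using q1 q2 l1 by (auto simp: q_def)
  have "cascade TYPE('n) \<alpha> l T b q"
    using \<alpha> T l1 ln lo0 b bn b\<kappa> b\<epsilon> q q1(2)[of q] q2(2)[of q] by unfold_locales auto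
  then show thesis by (rule that)
qed

text \<open>Against a given \<phi>, the scale R_j is fixed by smallness conditions that do not
  involve the number of bumps; only then is N_j taken so large that the height at (x0, R_j / 2) is
  at least j \<phi>(R_j / 2). The times R_j / 2 tend to 0, so no constant can serve in the
  asymptotic bound, already on the compact set consisting of x0 alone.\<close>

lemma no_universal_bound:
  fixes \<Omega> :: "(real^'n) set" and \<phi> :: "real \<Rightarrow> real"
  assumes \<alpha>: "2 < \<alpha>" "\<alpha> < real CARD('n) + 2" and T: "T > 0" and x0: "x0 \<in> \<Omega>"
    and l: "l > (real CARD('n) + 2) / (\<alpha> - 2)"
    and \<phi>: "\<And>t. t \<in> {0<..<1} \<Longrightarrow> \<phi> t > 0"
    and bound: "\<And>u. admissible \<alpha> l (g_exp (real CARD('n)) \<alpha> l) T \<Omega> u \<Longrightarrow> (\<lambda>t. Sup ((\<lambda>x. u x t) ` {x0})) \<in> O[at_right 0](\<phi>)"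
  shows False
proof -
  let ?n = "real CARD('n)"
  obtain b q where "cascade TYPE('n) \<alpha> l T b q" by (rule cascade_exists[OF \<alpha> T l])
  then interpret cascade x0 \<alpha> l T b q .
  define c8 where "c8 = (8 * pi) powr (- ?n / 2)"
  have c8: "c8 > 0" by (simp add: c8_def)
  have ex: "\<exists>R N. R > 0 \<and> R / 2 < T \<and> small R \<and> R \<le> (1 / 2) ^ j
     \<and> blk_const * R powr (1 + ?n / 2 - b * l) * (2 ^ (j + 2)) powr l \<le> (1 / 2) ^ j
     \<and> 2 * mass R \<le> (1 / 2) ^ j \<and> real j * \<phi> (R / 2) \<le> c8 * (R * q ^ N) powr (- b)" for j
  proof -
    obtain R1 where R1: "R1 > 0" "\<And>R. 0 < R \<Longrightarrow> R \<le> R1 \<Longrightarrow> 8 * q powr (- (b + 1)) * R powr (b * l - (?n + 2 - \<alpha>) / 2 - b - 1) \<le> key_const"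
      using powr_small[of "8 * q powr (- (b + 1))" key_const "b * l - (?n + 2 - \<alpha>) / 2 - b - 1"] key_const_pos b\<kappa> q0 by auto
    obtain R2 where R2: "R2 > 0" "\<And>R. 0 < R \<Longrightarrow> R \<le> R2 \<Longrightarrow> blk_const * (2 ^ (j + 2)) powr l * R powr (1 + ?n / 2 - b * l) \<le> (1 / 2) ^ j"
      using powr_small[of "blk_const * (2 ^ (j + 2)) powr l" "(1 / 2) ^ j" "1 + ?n / 2 - b * l"] norm_const_pos b\<epsilon> by (auto simp: blk_const_def)
    obtain R3 where R3: "R3 > 0" "\<And>R. 0 < R \<Longrightarrow> R \<le> R3 \<Longrightarrow> 2 * R powr (?n / 2 - b) \<le> (1 / 2) ^ j"
      using powr_small[of 2 "(1 / 2) ^ j" "?n / 2 - b"] bn by auto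
    define R where "R = min (min T ((1 / 2) ^ j)) (min R1 (min R2 R3))"
    have R: "R > 0" "R \<le> T" "R \<le> (1 / 2) ^ j" "R \<le> R1" "R \<le> R2" "R \<le> R3"
      using T R1 R2 R3 by (auto simp: R_def)
    \<comment> \<open>The height c8 (R q^N)^(-b) grows geometrically in N.\<close>
    have q1: "1 < q powr (- b)" using q0 q8 b0 powr_less_mono2_neg[of "- b" q 1] by simp
    obtain N where N: "real j * \<phi> (R / 2) / (c8 * R powr (- b)) < (q powr (- b)) ^ N"
      using real_arch_pow[OF q1] by blast
    have "real j * \<phi> (R / 2) \<le> c8 * (R * q ^ N) powr (- b)"
      using N c8 R(1) unfolding scale_powr[OF R(1)] by (simp add: field_simps)
    then show ?thesis using R R1(2)[of R] R2(2)[of R] R3(2)[of R] T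
      by (intro exI[of _ R] exI[of _ N]) (auto simp: small_def mass_def mult_ac)
  qed
  obtain R N where RN: "\<And>j. R j > 0" "\<And>j. R j / 2 < T" "\<And>j. small (R j)" "\<And>j. R j \<le> (1 / 2) ^ j"
     "\<And>j. blk_const * R j powr (1 + ?n / 2 - b * l) * (2 ^ (j + 2)) powr l \<le> (1 / 2) ^ j"
     "\<And>j. 2 * mass (R j) \<le> (1 / 2) ^ j" "\<And>j. real j * \<phi> (R j / 2) \<le> c8 * (R j * q ^ N j) powr (- b)"
    using ex by metis
  define u where "u = (\<lambda>x t. \<Sum>j. blk (R j) (N j) x t)"
  \<comment> \<open>The bound on l exceeds (n+2)/n, which selects the last branch of
    \<open>g_exp\<close>, and it makes the affine term there negative.\<close>
  have "g_exp ?n \<alpha> l = 0"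
  proof -
    have n: "?n > 0" by simp
    have "(?n + 2 - \<alpha>) / ?n \<le> (?n + 2) / ?n" using \<alpha> by (intro divide_right_mono) auto
    moreover have "?n + 2 < (\<alpha> - 2) * l" using l \<alpha> by (simp add: pos_divide_less_eq mult.commute)
    then have "1 - (\<alpha> - 2) / (?n + 2) * l \<le> 0" by (simp add: field_simps)
    ultimately show ?thesis using ln by (simp add: g_exp_def max_def)
  qed
  then have "admissible \<alpha> l (g_exp ?n \<alpha> l) T \<Omega> u"
    using cascade_solution(1)[OF RN(1-6), of \<Omega> N] by (simp add: u_def)
  from bound[OF this] obtain c where c: "c > 0" "eventually (\<lambda>t. norm (u x0 t) \<le> c * norm (\<phi> t)) (at_right 0)"
    by (auto elim!: landau_o.bigE)
  then obtain e where e: "e > 0" "\<And>t. 0 < t \<Longrightarrow> t < e \<Longrightarrow> norm (u x0 t) \<le> c * norm (\<phi> t)"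
    by (auto simp: eventually_at_right_field)
  have "(\<lambda>j. (1 / 2 :: real) ^ j) \<longlonglongrightarrow> 0" by (rule LIMSEQ_realpow_zero) auto
  from order_tendstoD(2)[OF this e(1)] obtain j1 where j1: "\<And>j. j \<ge> j1 \<Longrightarrow> (1 / 2) ^ j < e"
    by (auto simp: eventually_sequentially)
  obtain j2 :: nat where j2: "c < real j2" using reals_Archimedean2 by blast
  \<comment> \<open>Past \<open>j1\<close> the times lie in the range of the asymptotic bound; past
    \<open>j2\<close> the index exceeds its constant.\<close>
  define j where "j = max j1 j2"
  define t where "t = R j / 2"
  have half: "(1 / 2 :: real) ^ j \<le> 1" by (simp add: power_le_one)
  have t: "0 < t" "t < e" "t \<in> {0<..<1}"
    using RN(1)[of j] RN(4)[of j] j1[of j] half by (auto simp: t_def j_def)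
  have "real j * \<phi> t \<le> u x0 t"
    using RN(7)[of j] cascade_solution(2)[OF RN(1-6), of j N] unfolding t_def u_def c8_def by linarith
  also have "u x0 t \<le> c * \<phi> t" using e(2)[OF t(1,2)] \<phi>[OF t(3)] by simp
  finally have "real j \<le> c" using \<phi>[OF t(3)] by simp
  moreover have "real j2 \<le> real j" by (simp add: j_def)
  ultimately show False using j2 by linarith
qed

theorem theorem1p4:
  fixes \<Omega> :: "(real^'n) set" and \<alpha> T :: real
  assumes "0 < \<alpha>" and "\<alpha> < real CARD('n) + 2"
    and "T > 0" and "open \<Omega>" and "\<Omega> \<noteq> {}"
  shows
   "(\<forall>lam. 0 < lam \<and> lam < (real CARD('n) + 2 - \<alpha>) / real CARD('n) \<longrightarrow>
       (\<forall>K u. compact K \<and> K \<noteq> {} \<and> K \<subseteq> \<Omega> \<and>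
              admissible \<alpha> lam (g_exp (real CARD('n)) \<alpha> lam) T \<Omega> u \<longrightarrow>
          (\<lambda>t. Sup ((\<lambda>x. u x t) ` K)) \<in> O[at_right 0](\<lambda>t. t powr (- real CARD('n) / 2))))
    \<and>
    (2 < \<alpha> \<longrightarrow>
     (\<forall>lam. lam > (real CARD('n) + 2) / (\<alpha> - 2) \<longrightarrow>
       \<not> (\<exists>\<phi> :: real \<Rightarrow> real.
             continuous_on {0<..<1} \<phi> \<and> (\<forall>t\<in>{0<..<1}. \<phi> t > 0) \<and>
             (\<forall>K u. compact K \<and> K \<noteq> {} \<and> K \<subseteq> \<Omega> \<and>
                admissible \<alpha> lam (g_exp (real CARD('n)) \<alpha> lam) T \<Omega> u \<longrightarrow>
                (\<lambda>t. Sup ((\<lambda>x. u x t) ` K)) \<in> O[at_right 0](\<phi>)))))"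
proof (intro conjI impI allI)
  fix lam K u
  assume "0 < lam \<and> lam < (real CARD('n) + 2 - \<alpha>) / real CARD('n)"
    and "compact K \<and> K \<noteq> {} \<and> K \<subseteq> \<Omega> \<and> admissible \<alpha> lam (g_exp (real CARD('n)) \<alpha> lam) T \<Omega> u"
  then show "(\<lambda>t. Sup ((\<lambda>x. u x t) ` K)) \<in> O[at_right 0](\<lambda>t. t powr (- real CARD('n) / 2))"
    using assms by (intro admissible_bound[of \<alpha> T \<Omega> lam u K]) auto
next
  fix lam
  assume \<alpha>: "2 < \<alpha>" and lam: "lam > (real CARD('n) + 2) / (\<alpha> - 2)"
  obtain x0 where x0: "x0 \<in> \<Omega>" using assms by auto
  show "\<not> (\<exists>\<phi> :: real \<Rightarrow> real.
             continuous_on {0<..<1} \<phi> \<and> (\<forall>t\<in>{0<..<1}. \<phi> t > 0) \<and>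
             (\<forall>K u. compact K \<and> K \<noteq> {} \<and> K \<subseteq> \<Omega> \<and>
                admissible \<alpha> lam (g_exp (real CARD('n)) \<alpha> lam) T \<Omega> u \<longrightarrow>
                (\<lambda>t. Sup ((\<lambda>x. u x t) ` K)) \<in> O[at_right 0](\<phi>)))"
  proof (rule notI, elim exE conjE)
    fix \<phi> :: "real \<Rightarrow> real"
    assume \<phi>: "\<forall>t\<in>{0<..<1}. \<phi> t > 0"
      and bound: "\<forall>K u. compact K \<and> K \<noteq> {} \<and> K \<subseteq> \<Omega> \<and>
        admissible \<alpha> lam (g_exp (real CARD('n)) \<alpha> lam) T \<Omega> u \<longrightarrow>
        (\<lambda>t. Sup ((\<lambda>x. u x t) ` K)) \<in> O[at_right 0](\<phi>)"
    show False
    proof (rule no_universal_bound[OF \<alpha> assms(2,3) x0 lam])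
      show "t \<in> {0<..<1} \<Longrightarrow> \<phi> t > 0" for t using \<phi> by blast
      fix u assume u: "admissible \<alpha> lam (g_exp (real CARD('n)) \<alpha> lam) T \<Omega> u"
      show "(\<lambda>t. Sup ((\<lambda>x. u x t) ` {x0})) \<in> O[at_right 0](\<phi>)"
        by (rule bound[rule_format]) (use x0 u in simp)
    qed
  qed
qed

end
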